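(* Let $(\mathfrak g,\mu;\rho)$ be an $n$-LieRep pair, with $\rho$ a representation on $V$; put $\pi=\mu+\rho$ and $\mathrm d_\pi=[\pi,-]_{n\text{-Lie}}$. Then $\big(\bigoplus_{k=0}^{+\infty}C^{k(n-1)|0}(\mathfrak g\oplus V,\mathfrak g\oplus V),[-,-]_{n\text{-Lie}},\mathrm d_\pi\big)$ is a differential graded Lie algebra. Furthermore, for $\mu'\in\mathrm{Hom}(\wedge^n\mathfrak g,\mathfrak g)$ and $\rho'\in\mathrm{Hom}(\wedge^{n-1}\mathfrak g\otimes V,V)$, $(\mathfrak g,\mu+\mu';\rho+\rho')$ is also an $n$-LieRep pair if and only if $\mu'+\rho'$ is a Maurer-Cartan element of this differential graded Lie algebra.
   Context: All vector spaces are finite dimensional over an algebraically closed field $\mathbb K$ of characteristic $0$; $n\ge 2$ is an integer; a hat denotes omission. An $n$-Lie algebra is a vector space $\mathfrak g$ with a skew-symmetric linear map $\mu=[-,\cdots,-]_{\mathfrak g}:\wedge^n\mathfrak g\to\mathfrak g$ such that $[x_1,\cdots,x_{n-1},[y_1,\cdots,y_n]]=\sum_{i=1}^n[y_1,\cdots,y_{i-1},[x_1,\cdots,x_{n-1},y_i],y_{i+1},\cdots,y_n]$. A representation of it on $V$ is a linear map $\rho:\wedge^{n-1}\mathfrak g\to\mathfrak{gl}(V)$ with (1) $[\rho(\mathfrak X),\rho(\mathfrak Y)]=\rho(\mathfrak X\circ\mathfrak Y)$ (commutator on the left), where for $\mathfrak X=x_1\wedge\cdots\wedge x_{n-1}$,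 $\mathfrak Y=y_1\wedge\cdots\wedge y_{n-1}$, $\mathfrak X\circ\mathfrak Y=\sum_{i=1}^{n-1}y_1\wedge\cdots\wedge[x_1,\cdots,x_{n-1},y_i]_{\mathfrak g}\wedge\cdots\wedge y_{n-1}$; and (2) $\rho(x_1,\cdots,x_{n-2},[y_1,\cdots,y_n]_{\mathfrak g})=\sum_{i=1}^n(-1)^{n-i}\rho(y_1,\cdots,\widehat{y_i},\cdots,y_n)\rho(x_1,\cdots,x_{n-2},y_i)$. An $n$-LieRep pair $(\mathfrak g,\mu;\rho)$ is an $n$-Lie algebra $(\mathfrak g,\mu)$ together with a representation $\rho$ on a vector space $V$. For a vector space $W$, $\otimes^p(\wedge^{n-1}W)\wedge W$ means $W$ if $p=0$ and $\otimes^{p-1}(\wedge^{n-1}W)\otimes\wedge^nW$ if $p\ge1$; a map on it is written $P(\mathfrak X_1,\cdots,\mathfrak X_p,x)$ with $\mathfrak X_i\in\wedge^{n-1}W$, $x\in W$. Put $C^p(W,W)=\mathrm{Hom}(\otimes^p(\wedge^{n-1}W)\wedge W,W)$ (degree $p$). It is known that $\bigoplus_{p\ge0}C^p(W,W)$ is a graded Lie algebra under $[P,Q]_{n\text{-Lie}}=P\circ Q-(-1)^{pq}Q\circ P$ for $P\in C^p$, $Q\in C^q$, where, with $\mathfrak X_i=x_i^1\wedge\cdots\wedge x_i^{n-1}$, $$(P\circ Q)(\mathfrak X_1,\cdots,\mathfrak X_{p+q},x)=\sum_{k=1}^p(-1)^{(k-1)q}\sum_{\sigma\in S(k-1,q)}(-1)^\sigma\sum_{i=1}^{n-1}P(\mathfrak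 X_{\sigma(1)},\cdots,\mathfrak X_{\sigma(k-1)},x_{k+q}^1\wedge\cdots\wedge x_{k+q}^{i-1}\wedge Q(\mathfrak X_{\sigma(k)},\cdots,\mathfrak X_{\sigma(k+q-1)},x_{k+q}^i)\wedge x_{k+q}^{i+1}\wedge\cdots\wedge x_{k+q}^{n-1},\mathfrak X_{k+q+1},\cdots,\mathfrak X_{p+q},x)$$ $$+\sum_{\sigma\in S(p,q)}(-1)^{pq}(-1)^\sigma P(\mathfrak X_{\sigma(1)},\cdots,\mathfrak X_{\sigma(p)},Q(\mathfrak X_{\sigma(p+1)},\cdots,\mathfrak X_{\sigma(p+q)},x)),$$ and $S(i,j)$ is the set of $(i,j)$-shuffles. Bidegree: for $W=\mathfrak g_1\oplus\mathfrak g_2$ let $\mathfrak g^{l,k}\subset\otimes^m(\wedge^{n-1}W)\wedge W$ be the subspace spanned by elements containing exactly $l$ entries from $\mathfrak g_1$ and $k$ entries from $\mathfrak g_2$ ($l+k=m(n-1)+1$). A map $f\in C^m(W,W)$ has bidegree $k|l$ if $k+l=m(n-1)$, $f(\mathfrak g^{k+1,l})\subset\mathfrak g_1$, $f(\mathfrak g^{k,l+1})\subset\mathfrak g_2$, and $f$ vanishes on all other $\mathfrak g^{i,j}$. $C^{k|l}(W,W)$ denotes the space of maps of bidegree $k|l$. Here $\mathfrak g_1=\mathfrak g$, $\mathfrak g_2=V$, and $C^{k(n-1)|0}$ is in degree $k$. For $\mu\in\mathrm{Hom}(\wedge^n\mathfrak g,\mathfrak g)$, $\rho\in\mathrm{Hom}(\wedge^{n-1}\mathfrak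 g\otimes V,V)$, $\mu+\rho$ denotes the element of $C^{n-1|0}(\mathfrak g\oplus V,\mathfrak g\oplus V)$ given by $(x_1+u_1,\cdots,x_n+u_n)\mapsto\mu(x_1,\cdots,x_n)+\sum_{i=1}^n(-1)^{n-i}\rho(x_1,\cdots,\widehat{x_i},\cdots,x_n)(u_i)$. A Maurer-Cartan element of a differential graded Lie algebra $(L,[-,-],\mathrm d)$ is a degree $1$ element $\alpha$ with $\mathrm d\alpha+\frac12[\alpha,\alpha]=0$. *)

theory Defs
  imports
    "HOL-Analysis.Product_Vector"
    "HOL-Library.Function_Algebras"
    "HOL-Combinatorics.Permutations"
    "HOL-Computational_Algebra.Polynomial"
begin

text \<open>
  Vector spaces are types with an explicit scalar multiplication. The direct sum of two of them is
  the product type with \<^const>\<open>module_prod.scale\<close>. A linear map out of an exterior power or a tensor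
  product is represented, through the universal property, by the corresponding alternating or
  multilinear map on lists of vectors. Lists are indexed from 0, so the exponent \<open>n - i\<close> of an
  index \<open>i\<close> counted from 1 becomes \<open>n - 1 - i\<close>.
\<close>

section \<open>\<open>n\<close>-Lie algebras and their representations\<close>

text \<open>\<open>Hom(\<wedge>\<^sup>m A, B)\<close>; only the values on lists of length \<open>m\<close> matter.\<close>

definition wedge_hom ::
    "('k::field \<Rightarrow> 'a::ab_group_add \<Rightarrow> 'a) \<Rightarrow> ('k \<Rightarrow> 'b::ab_group_add \<Rightarrow> 'b) \<Rightarrow> nat
      \<Rightarrow> ('a list \<Rightarrow> 'b) set" where
  "wedge_hom sA sB m = {f. \<forall>xs. length xs = m \<longrightarrow>
     (\<forall>i<m. Vector_Spaces.linear sA sB (\<lambda>y. f (xs[i := y]))) \<and>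
     (\<not> distinct xs \<longrightarrow> f xs = 0)}"

text \<open>\<open>Hom(\<wedge>\<^sup>m A \<otimes> B, B)\<close>, identified with the linear maps from \<open>\<wedge>\<^sup>m A\<close> to \<open>gl(B)\<close>.\<close>

definition action_hom ::
    "('k::field \<Rightarrow> 'a::ab_group_add \<Rightarrow> 'a) \<Rightarrow> ('k \<Rightarrow> 'b::ab_group_add \<Rightarrow> 'b) \<Rightarrow> nat
      \<Rightarrow> ('a list \<Rightarrow> 'b \<Rightarrow> 'b) set" where
  "action_hom sA sB m = {\<rho>.
     (\<forall>xs. length xs = m \<longrightarrow> Vector_Spaces.linear sB sB (\<rho> xs)) \<and>
     (\<forall>u. (\<lambda>xs. \<rho> xs u) \<in> wedge_hom sA sB m)}"

definition n_lie_algebra ::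
    "nat \<Rightarrow> ('k::field \<Rightarrow> 'g::ab_group_add \<Rightarrow> 'g) \<Rightarrow> ('g list \<Rightarrow> 'g) \<Rightarrow> bool" where
  "n_lie_algebra n sg \<mu> \<longleftrightarrow> \<mu> \<in> wedge_hom sg sg n \<and>
     (\<forall>xs ys. length xs = n - 1 \<longrightarrow> length ys = n \<longrightarrow>
        \<mu> (xs @ [\<mu> ys]) = (\<Sum>i<n. \<mu> (ys[i := \<mu> (xs @ [ys ! i])])))"

definition omit :: "nat \<Rightarrow> 'a list \<Rightarrow> 'a list" where
  "omit i xs = take i xs @ drop (Suc i) xs"

definition n_lie_representation ::
    "nat \<Rightarrow> ('k::field \<Rightarrow> 'g::ab_group_add \<Rightarrow> 'g) \<Rightarrow> ('k \<Rightarrow> 'v::ab_group_add \<Rightarrow> 'v)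
      \<Rightarrow> ('g list \<Rightarrow> 'g) \<Rightarrow> ('g list \<Rightarrow> 'v \<Rightarrow> 'v) \<Rightarrow> bool" where
  "n_lie_representation n sg sv \<mu> \<rho> \<longleftrightarrow> \<rho> \<in> action_hom sg sv (n - 1) \<and>
     (\<forall>xs ys u. length xs = n - 1 \<longrightarrow> length ys = n - 1 \<longrightarrow>
        \<rho> xs (\<rho> ys u) - \<rho> ys (\<rho> xs u) = (\<Sum>i<n - 1. \<rho> (ys[i := \<mu> (xs @ [ys ! i])]) u)) \<and>
     (\<forall>xs ys u. length xs = n - 2 \<longrightarrow> length ys = n \<longrightarrow>
        \<rho> (xs @ [\<mu> ys]) u =
          (\<Sum>i<n. sv ((-1) ^ (n - 1 - i)) (\<rho> (omit i ys) (\<rho> (xs @ [ys ! i]) u))))"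

definition n_lie_rep_pair ::
    "nat \<Rightarrow> ('k::field \<Rightarrow> 'g::ab_group_add \<Rightarrow> 'g) \<Rightarrow> ('k \<Rightarrow> 'v::ab_group_add \<Rightarrow> 'v)
      \<Rightarrow> ('g list \<Rightarrow> 'g) \<Rightarrow> ('g list \<Rightarrow> 'v \<Rightarrow> 'v) \<Rightarrow> bool" where
  "n_lie_rep_pair n sg sv \<mu> \<rho> \<longleftrightarrow> n_lie_algebra n sg \<mu> \<and> n_lie_representation n sg sv \<mu> \<rho>"

section \<open>The cochain space and its bracket\<close>

text \<open>
  A cochain \<open>P\<close> of degree \<open>p\<close> is applied as \<open>P Xs x\<close>, where \<open>Xs = [X\<^sub>1, \<dots>, X\<^sub>p]\<close> and each \<open>X\<^sub>i\<close> is a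
  list of \<open>n - 1\<close> vectors standing for their wedge product.
\<close>

type_synonym 'w cochain = "'w list list \<Rightarrow> 'w \<Rightarrow> 'w"

definition wedge_args :: "nat \<Rightarrow> nat \<Rightarrow> 'w list list set" where
  "wedge_args n p = {Xs. length Xs = p \<and> (\<forall>X\<in>set Xs. length X = n - 1)}"

text \<open>
  \<open>C\<^sup>p(W,W)\<close>. Cochains are normalised to vanish off their domain, so that they are determined by the
  linear maps they represent and the spaces of different degrees are independent inside one
  function space. For \<open>p > 0\<close> the last block \<open>X\<^sub>p\<close> together with \<open>x\<close> forms an \<open>n\<close>-fold wedge.
\<close>

definition cochains ::
    "nat \<Rightarrow> ('k::field \<Rightarrow> 'w::ab_group_add \<Rightarrow> 'w) \<Rightarrow> nat \<Rightarrow> 'w cochain set" where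
  "cochains n s p = {P.
     (\<forall>Xs x. Xs \<notin> wedge_args n p \<longrightarrow> P Xs x = 0) \<and>
     (\<forall>Xs\<in>wedge_args n p. Vector_Spaces.linear s s (P Xs)) \<and>
     (\<forall>Xs\<in>wedge_args n p. \<forall>x. \<forall>i<p. \<forall>j<n - 1.
        Vector_Spaces.linear s s (\<lambda>y. P (Xs[i := (Xs ! i)[j := y]]) x)) \<and>
     (\<forall>Xs\<in>wedge_args n p. \<forall>x. (\<exists>X\<in>set Xs. \<not> distinct X) \<longrightarrow> P Xs x = 0) \<and>
     (\<forall>Xs\<in>wedge_args n p. \<forall>x. p > 0 \<and> \<not> distinct (last Xs @ [x]) \<longrightarrow> P Xs x = 0)}"

definition cochain_scale :: "('k \<Rightarrow> 'w \<Rightarrow> 'w) \<Rightarrow> 'k \<Rightarrow> 'w cochain \<Rightarrow> 'w cochain" where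
  "cochain_scale s c P = (\<lambda>Xs x. s c (P Xs x))"

text \<open>\<open>(i,j)\<close>-shuffles, as permutations of \<open>{0, \<dots>, i + j - 1}\<close>.\<close>

definition shuffle_perms :: "nat \<Rightarrow> nat \<Rightarrow> (nat \<Rightarrow> nat) set" where
  "shuffle_perms i j = {\<sigma>. \<sigma> permutes {..<i + j} \<and>
     strict_mono_on {..<i} \<sigma> \<and> strict_mono_on {i..<i + j} \<sigma>}"

text \<open>
  \<open>P \<circ> Q\<close> for \<open>P\<close> of degree \<open>p\<close> and \<open>Q\<close> of degree \<open>q\<close>. The index \<open>k\<close> is one less than in the usual
  formula with \<open>k = 1, \<dots>, p\<close>.
\<close>

definition circ ::
    "nat \<Rightarrow> ('k::field \<Rightarrow> 'w::ab_group_add \<Rightarrow> 'w) \<Rightarrow> nat \<Rightarrow> nat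
      \<Rightarrow> 'w cochain \<Rightarrow> 'w cochain \<Rightarrow> 'w cochain" where
  "circ n s p q P Q = (\<lambda>Xs x.
     (\<Sum>k<p. \<Sum>\<sigma>\<in>shuffle_perms k q. s ((-1) ^ (k * q) * of_int (sign \<sigma>))
        (\<Sum>i<n - 1.
           P (map (\<lambda>a. Xs ! \<sigma> a) [0..<k]
              @ [(Xs ! (k + q))[i := Q (map (\<lambda>a. Xs ! \<sigma> a) [k..<k + q]) (Xs ! (k + q) ! i)]]
              @ drop (k + q + 1) Xs) x))
     + (\<Sum>\<sigma>\<in>shuffle_perms p q. s ((-1) ^ (p * q) * of_int (sign \<sigma>))
          (P (map (\<lambda>a. Xs ! \<sigma> a) [0..<p]) (Q (map (\<lambda>a. Xs ! \<sigma> a) [p..<p + q]) x))))"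

text \<open>
  The bracket on the direct sum of all \<open>C\<^sup>p(W,W)\<close>. Evaluating an element of the direct sum on a list
  of length \<open>p\<close> selects its component of degree \<open>p\<close>, so the sum below is the bilinear extension of
  \<open>[P,Q] = P \<circ> Q - (-1)\<^bsup>pq\<^esup> Q \<circ> P\<close> from homogeneous elements; see \<open>nlie_bracket_homogeneous\<close>.
\<close>

definition nlie_bracket ::
    "nat \<Rightarrow> ('k::field \<Rightarrow> 'w::ab_group_add \<Rightarrow> 'w) \<Rightarrow> 'w cochain \<Rightarrow> 'w cochain \<Rightarrow> 'w cochain" where
  "nlie_bracket n s P Q = (\<lambda>Xs x. \<Sum>p\<le>length Xs. let q = length Xs - p in
     circ n s p q P Q Xs x - s ((-1) ^ (p * q)) (circ n s q p Q P Xs x))"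

lemma circ_eq_0:
  assumes vs: "vector_space s" and P: "P \<in> cochains n s p" and ne: "p' \<noteq> p"
    and len: "length Xs = p' + q'"
  shows "circ n s p' q' P Q Xs x = 0"
proof -
  interpret vector_space s by (fact vs)
  have 0: "P Ys y = 0" if "length Ys \<noteq> p" for Ys y
    using P that by (auto simp: cochains_def wedge_args_def)
  have "P (map (\<lambda>a. Xs ! \<sigma> a) [0..<k] @ [Y] @ drop (k + q' + 1) Xs) x = 0" if "k < p'" for k \<sigma> Y
    using that len ne by (intro 0) auto
  moreover have "P (map (\<lambda>a. Xs ! \<sigma> a) [0..<p']) y = 0" for \<sigma> y
    using ne by (intro 0) auto
  ultimately show ?thesis
    unfolding circ_def by (simp add: scale_zero_right)
qed

lemma circ_eq_0_right:
  assumes vs: "vector_space s" and P: "P \<in> cochains n s p" and Q: "Q \<in> cochains n s q"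
    and ne: "q' \<noteq> q" and len: "length Xs = p + q'"
  shows "circ n s p q' P Q Xs x = 0"
proof -
  interpret vector_space s by (fact vs)
  have Q0: "Q Ys y = 0" if "length Ys \<noteq> q" for Ys y
    using Q that by (auto simp: cochains_def wedge_args_def)
  have P0: "P Ys 0 = 0" for Ys
  proof (cases "Ys \<in> wedge_args n p")
    case True
    then have "Vector_Spaces.linear s s (P Ys)" using P by (auto simp: cochains_def)
    then interpret L: Vector_Spaces.linear s s "P Ys" .
    show ?thesis by (rule L.zero)
  qed (use P in \<open>auto simp: cochains_def\<close>)
  have P1: "P (As @ [Y[i := 0]] @ Bs) x = 0" if i: "i < n - 1" and A: "length As < p" for As Y i Bs
  proof (cases "As @ [Y[i := 0]] @ Bs \<in> wedge_args n p")
    case True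
    let ?Xs = "As @ [Y[i := 0]] @ Bs"
    have "Vector_Spaces.linear s s (\<lambda>y. P (?Xs[length As := (?Xs ! length As)[i := y]]) x)"
      using P True i A unfolding cochains_def by blast
    then interpret L: Vector_Spaces.linear s s
      "\<lambda>y. P (?Xs[length As := (?Xs ! length As)[i := y]]) x" .
    show ?thesis using L.zero by simp
  qed (use P in \<open>auto simp: cochains_def\<close>)
  have "P (map (\<lambda>a. Xs ! \<sigma> a) [0..<k] @
      [(Xs ! (k + q'))[i := Q (map (\<lambda>a. Xs ! \<sigma> a) [k..<k + q']) y]] @ Bs) x = 0"
    if "k < p" "i < n - 1" for k \<sigma> i y Bs
    using P1[of i "map (\<lambda>a. Xs ! \<sigma> a) [0..<k]"] that ne by (simp add: Q0)
  moreover have "P Ys (Q (map (\<lambda>a. Xs ! \<sigma> a) [p..<p + q']) x) = 0" for \<sigma> Ys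
    using ne by (simp add: Q0 P0)
  ultimately show ?thesis
    unfolding circ_def by (simp add: scale_zero_right)
qed

lemma nlie_bracket_homogeneous:
  assumes vs: "vector_space s" and P: "P \<in> cochains n s p" and Q: "Q \<in> cochains n s q"
  shows "nlie_bracket n s P Q Xs x =
    (if length Xs = p + q
     then circ n s p q P Q Xs x - s ((-1) ^ (p * q)) (circ n s q p Q P Xs x) else 0)"
proof -
  interpret vector_space s by (fact vs)
  let ?t = "\<lambda>p'. circ n s p' (length Xs - p') P Q Xs x
    - s ((-1) ^ (p' * (length Xs - p'))) (circ n s (length Xs - p') p' Q P Xs x)"
  have *: "?t p' = 0" if "p' \<le> length Xs" "p' \<noteq> p \<or> length Xs \<noteq> p + q" for p'
  proof -
    let ?q = "length Xs - p'"
    have len: "length Xs = p' + ?q" "length Xs = ?q + p'" using that by auto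
    have 1: "circ n s p' ?q P Q Xs x = 0"
    proof (cases "p' = p")
      case True
      then show ?thesis using circ_eq_0_right[OF vs P Q _ ] that len by auto
    qed (rule circ_eq_0[OF vs P _ len(1)])
    have 2: "circ n s ?q p' Q P Xs x = 0"
    proof (cases "?q = q")
      case True
      then have "p' \<noteq> p" using that len by auto
      then show ?thesis using circ_eq_0_right[OF vs Q P, of p' Xs x] True len by simp
    qed (rule circ_eq_0[OF vs Q _ len(2)])
    show ?thesis using 1 2 by (simp add: scale_zero_right)
  qed
  have "nlie_bracket n s P Q Xs x = (\<Sum>p'\<le>length Xs. ?t p')"
    by (simp add: nlie_bracket_def Let_def)
  also have "\<dots> = (if length Xs = p + q then ?t p else 0)"
  proof (cases "length Xs = p + q")
    case True
    then have "(\<Sum>p'\<le>length Xs. ?t p') = (\<Sum>p'\<in>{p}. ?t p')"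
      by (intro sum.mono_neutral_right) (use * in auto)
    then show ?thesis using True by simp
  next
    case False
    then show ?thesis using * by (auto intro: sum.neutral)
  qed
  finally show ?thesis by simp
qed

section \<open>Bidegree\<close>

text \<open>
  \<open>pure_entries l k Xs x\<close>: the entries are designated, \<open>l\<close> of them as lying in the first summand and
  \<open>k\<close> in the second. The designation is ambiguous only if some entry is 0, where the tensor
  vanishes.
\<close>

definition pure_entries ::
    "nat \<Rightarrow> nat \<Rightarrow> ('g::zero \<times> 'v::zero) list list \<Rightarrow> 'g \<times> 'v \<Rightarrow> bool" where
  "pure_entries l k Xs x \<longleftrightarrow> (let ws = concat Xs @ [x] in
     length ws = l + k \<and>
     (\<exists>A\<subseteq>{..<l + k}. card A = l \<and>
        (\<forall>i<l + k. if i \<in> A then snd (ws ! i) = 0 else fst (ws ! i) = 0)))"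

text \<open>The maps of degree \<open>m\<close> and bidegree \<open>k|l\<close> on the direct sum of the two spaces.\<close>

definition bideg_cochains ::
    "nat \<Rightarrow> ('k::field \<Rightarrow> 'g::ab_group_add \<Rightarrow> 'g) \<Rightarrow> ('k \<Rightarrow> 'v::ab_group_add \<Rightarrow> 'v)
      \<Rightarrow> nat \<Rightarrow> nat \<Rightarrow> nat \<Rightarrow> ('g \<times> 'v) cochain set" where
  "bideg_cochains n sg sv m k l = {f \<in> cochains n (module_prod.scale sg sv) m.
     k + l = m * (n - 1) \<and>
     (\<forall>Xs\<in>wedge_args n m. \<forall>x i j. pure_entries i j Xs x \<longrightarrow>
        (if (i, j) = (k + 1, l) then snd (f Xs x) = 0
         else if (i, j) = (k, l + 1) then fst (f Xs x) = 0
         else f Xs x = 0))}"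

text \<open>The element \<open>\<mu> + \<rho>\<close> of degree 1.\<close>

definition sum_cochain ::
    "nat \<Rightarrow> ('k::field \<Rightarrow> 'v::ab_group_add \<Rightarrow> 'v) \<Rightarrow> ('g list \<Rightarrow> 'g::ab_group_add)
      \<Rightarrow> ('g list \<Rightarrow> 'v \<Rightarrow> 'v) \<Rightarrow> ('g \<times> 'v) cochain" where
  "sum_cochain n sv \<mu> \<rho> = (\<lambda>Xs x. if Xs \<in> wedge_args n 1 then
     (let ws = hd Xs @ [x] in
       (\<mu> (map fst ws),
        \<Sum>i<n. sv ((-1) ^ (n - 1 - i)) (\<rho> (omit i (map fst ws)) (snd (ws ! i)))))
     else 0)"

section \<open>Differential graded Lie algebras\<close>

text \<open>
  The homogeneous components \<open>L p\<close> are independent subspaces of an ambient space and the algebra is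
  their internal direct sum, the span of their union. Components of negative degree are zero.
\<close>

locale dg_lie_algebra = vector_space s
  for s :: "'k::field \<Rightarrow> 'c::ab_group_add \<Rightarrow> 'c" +
  fixes L :: "nat \<Rightarrow> 'c set"
    and br :: "'c \<Rightarrow> 'c \<Rightarrow> 'c"
    and d :: "'c \<Rightarrow> 'c"
  assumes subspace_component: "subspace (L p)"
    and independent_components:
      "finite I \<Longrightarrow> (\<And>p. p \<in> I \<Longrightarrow> f p \<in> L p) \<Longrightarrow> (\<Sum>p\<in>I. f p) = 0 \<Longrightarrow> p \<in> I \<Longrightarrow> f p = 0"
    and bracket_add_left: "\<lbrakk>x \<in> span (\<Union>p. L p); y \<in> span (\<Union>p. L p); z \<in> span (\<Union>p. L p)\<rbrakk>
      \<Longrightarrow> br (x + y) z = br x z + br y z"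
    and bracket_add_right: "\<lbrakk>x \<in> span (\<Union>p. L p); y \<in> span (\<Union>p. L p); z \<in> span (\<Union>p. L p)\<rbrakk>
      \<Longrightarrow> br x (y + z) = br x y + br x z"
    and bracket_scale_left: "\<lbrakk>x \<in> span (\<Union>p. L p); y \<in> span (\<Union>p. L p)\<rbrakk>
      \<Longrightarrow> br (s c x) y = s c (br x y)"
    and bracket_scale_right: "\<lbrakk>x \<in> span (\<Union>p. L p); y \<in> span (\<Union>p. L p)\<rbrakk>
      \<Longrightarrow> br x (s c y) = s c (br x y)"
    and bracket_degree: "\<lbrakk>x \<in> L p; y \<in> L q\<rbrakk> \<Longrightarrow> br x y \<in> L (p + q)"
    and bracket_skew: "\<lbrakk>x \<in> L p; y \<in> L q\<rbrakk> \<Longrightarrow> br x y = - s ((-1) ^ (p * q)) (br y x)"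
    and bracket_jacobi: "\<lbrakk>x \<in> L p; y \<in> L q; z \<in> L r\<rbrakk>
      \<Longrightarrow> br x (br y z) = br (br x y) z + s ((-1) ^ (p * q)) (br y (br x z))"
    and diff_add: "\<lbrakk>x \<in> span (\<Union>p. L p); y \<in> span (\<Union>p. L p)\<rbrakk> \<Longrightarrow> d (x + y) = d x + d y"
    and diff_scale: "x \<in> span (\<Union>p. L p) \<Longrightarrow> d (s c x) = s c (d x)"
    and diff_degree: "x \<in> L p \<Longrightarrow> d x \<in> L (p + 1)"
    and diff_square: "x \<in> span (\<Union>p. L p) \<Longrightarrow> d (d x) = 0"
    and diff_derivation: "\<lbrakk>x \<in> L p; y \<in> L q\<rbrakk>
      \<Longrightarrow> d (br x y) = br (d x) y + s ((-1) ^ p) (br x (d y))"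

definition maurer_cartan ::
    "('k::field \<Rightarrow> 'c::ab_group_add \<Rightarrow> 'c) \<Rightarrow> (nat \<Rightarrow> 'c set) \<Rightarrow> ('c \<Rightarrow> 'c \<Rightarrow> 'c)
      \<Rightarrow> ('c \<Rightarrow> 'c) \<Rightarrow> 'c \<Rightarrow> bool" where
  "maurer_cartan s L br d \<alpha> \<longleftrightarrow> \<alpha> \<in> L 1 \<and> d \<alpha> + s (1 / 2) (br \<alpha> \<alpha>) = 0"

end

theory Submission
  imports Defs
begin

text \<open>
  Splitting a shuffle according to the block that receives the argument \<open>X\<^sub>1\<close> turns the composition
  into a product with the recursion
  \<open>i\<^sub>X (P \<circ> Q) = (-1)\<^sup>q (i\<^sub>X P) \<circ> Q + P \<circ> (i\<^sub>X Q)\<close>, where \<open>i\<^sub>X\<close> inserts \<open>X\<close> as first argument and, for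
  \<open>q = 0\<close>, the last term is replaced by the action of \<open>Q\<close> on the block \<open>X\<close> as a derivation. From this
  recursion, \<open>F \<circ> [P, Q] = (F \<circ> P) \<circ> Q - (-1)\<^bsup>pq\<^esup> (F \<circ> Q) \<circ> P\<close> follows by induction on the number of
  arguments, and the graded Jacobi identity is a consequence. A multilinear map has bidegree \<open>k|0\<close> iff
  it is equivariant under \<open>(x, u) \<mapsto> (x, 2u)\<close>, a property that composition clearly preserves.
  Finally \<open>\<pi> \<circ> \<pi>\<close> is the defect of the fundamental identity on \<open>\<gg> \<oplus> V\<close>; as it has bidegree \<open>2(n-1)|0\<close>
  and is skew in each block, it vanishes iff it does so on arguments from \<open>\<gg>\<close> and on arguments whose
  only entry from \<open>V\<close> is the last one of a block, which gives the axioms of an \<open>n\<close>-Lie algebra and of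
  a representation.
\<close>

section \<open>The composition product by recursion\<close>

text \<open>In terms of shuffles a double composition is a sum over pairs of permutations, and
  comparing two such sums means matching them. With the recursion every identity is checked on the
  first block only, and signs reduce to parities. The price is that \<open>contract\<close> lowers
  the degree and leaves the spaces of interest, since a contracted cochain need not have bidegree
  \<open>k|0\<close>. The inductions therefore run over all multilinear maps on lists of blocks; the
  degree enters only through \<open>homog\<close> and through signs. The identity for
  \<open>F \<circ> [P, Q]\<close> says that the composition is a graded right pre-Lie product: its
  associator is symmetric in the last two arguments up to \<open>(-1)^(pq)\<close>. It is a
  statement about multilinear maps; skewness is a separate matter, settled when the composition is
  shown to stay within the cochain spaces. Likewise the bidegree condition is recast because
  counting entries from each summand through all terms of a composition would be laborious, whereas
  equivariance is inherited at once.\<close>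

lemmas fun_apply_simps = plus_fun_apply zero_fun_apply minus_apply uminus_apply

declare fun_apply_simps [simp del]

text \<open>Evaluates both arguments at once. The general pointwise equations are kept out of the
  simpset, so that equations between cochains stay at the level of cochains until values are
  wanted.\<close>

lemma cochain_apply:
  fixes F G :: "'w::ab_group_add cochain"
  shows "(F + G) Xs x = F Xs x + G Xs x" "(F - G) Xs x = F Xs x - G Xs x" "(- F) Xs x = - F Xs x"
    "(0 :: 'w cochain) Xs x = 0"
  by (simp_all add: fun_apply_simps)

lemma sum_fun_apply: "(\<Sum>i\<in>I. f i) x = (\<Sum>i\<in>I. f i x)"
  by (induction I rule: infinite_finite_induct) (auto simp: fun_apply_simps)

text \<open>The sign \<open>(-1)^q\<close> without a scalar: the calculus of signs takes place in
  any abelian group, and \<open>scale_neg_one_power\<close> links it to scaling.\<close>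

definition sgnp :: "nat \<Rightarrow> 'a::ab_group_add \<Rightarrow> 'a" where
  "sgnp q t = (if even q then t else - t)"

definition contract :: "'w list \<Rightarrow> 'w cochain \<Rightarrow> 'w cochain" where
  "contract X F = (\<lambda>Ys. F (X # Ys))"

text \<open>A cochain \<open>Q\<close> of degree 0 is the endomorphism \<open>Q []\<close> of
  \<open>W\<close>; this is its extension to a derivation of the exterior power, applied to the
  block \<open>X\<close> in the first argument of \<open>F\<close>.\<close>

definition slot_deriv ::
    "nat \<Rightarrow> 'w list \<Rightarrow> 'w::ab_group_add cochain \<Rightarrow> 'w cochain \<Rightarrow> 'w cochain" where
  "slot_deriv m X Q F = (\<lambda>Ys x. \<Sum>i<m. F (X[i := Q [] (X ! i)] # Ys) x)"

text \<open>Here \<open>q\<close> counts the arguments that \<open>Q\<close> still has to receive. A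
  block given to \<open>F\<close> passes them, whence \<open>sgnp q\<close>: in the shuffle formula,
  \<open>(-1)^(pq)\<close> times the sign of the shuffle counts the pairs with the argument of
  \<open>F\<close> in front. Once \<open>q = 0\<close>, \<open>Q\<close> with its collected
  arguments is an endomorphism and enters the block \<open>X\<close> or, at the end of the list, the
  vector \<open>x\<close>. If the list ends with \<open>q > 0\<close>, the degrees do not fit and
  the value is 0.\<close>

primrec rec_circ :: "nat \<Rightarrow> nat \<Rightarrow> 'w::ab_group_add cochain \<Rightarrow> 'w cochain \<Rightarrow> 'w cochain" where
  rec_circ_Nil: "rec_circ m q F Q [] x = (if q = 0 then F [] (Q [] x) else 0)"
| rec_circ_Cons: "rec_circ m q F Q (X # Xs) x = sgnp q (rec_circ m q (contract X F) Q Xs x) +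
     (if q = 0 then slot_deriv m X Q F Xs x else rec_circ m (q - 1) F (contract X Q) Xs x)"

declare rec_circ.simps [simp del]

lemma contract_apply: "contract X F Ys x = F (X # Ys) x"
  by (simp add: contract_def)

lemma contract_rec_circ:
  "contract X (rec_circ m q F Q) = sgnp q (rec_circ m q (contract X F) Q) +
     (if q = 0 then slot_deriv m X Q F else rec_circ m (q - 1) F (contract X Q))"
  by (intro ext) (simp add: contract_def rec_circ_Cons sgnp_def cochain_apply)

lemma contract_linear [simp]:
  "contract X (F + G) = contract X F + contract X G"
  "contract X (F - G) = contract X F - contract X G"
  "contract X (- F) = - contract X F"
  "contract X 0 = 0"
  "contract X (sgnp q F) = sgnp q (contract X F)"
  by (auto simp: contract_def sgnp_def fun_eq_iff fun_apply_simps)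

lemma slot_deriv_left [simp]:
  "slot_deriv m X Q (F + G) = slot_deriv m X Q F + slot_deriv m X Q G"
  "slot_deriv m X Q (F - G) = slot_deriv m X Q F - slot_deriv m X Q G"
  "slot_deriv m X Q (- F) = - slot_deriv m X Q F"
  "slot_deriv m X Q 0 = 0"
  by (auto simp: slot_deriv_def fun_eq_iff fun_apply_simps sum.distrib sum_subtractf sum_negf)

lemma rec_circ_add_left [simp]: "rec_circ m q (F + G) Q = rec_circ m q F Q + rec_circ m q G Q"
proof -
  have "rec_circ m q (F + G) Q Xs x = rec_circ m q F Q Xs x + rec_circ m q G Q Xs x" for Xs x
    by (induction Xs arbitrary: F G Q q) (auto simp: rec_circ_Nil rec_circ_Cons sgnp_def fun_apply_simps)
  then show ?thesis by (auto simp: fun_eq_iff fun_apply_simps)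
qed

lemma rec_circ_zero_left [simp]: "rec_circ m q 0 Q = 0"
  using rec_circ_add_left[of m q 0 0 Q] by simp

lemma rec_circ_minus_left [simp]: "rec_circ m q (- F) Q = - rec_circ m q F Q"
  using rec_circ_add_left[of m q F "-F" Q] by (simp add: eq_neg_iff_add_eq_0 add.commute)

lemma rec_circ_diff_left [simp]: "rec_circ m q (F - G) Q = rec_circ m q F Q - rec_circ m q G Q"
  using rec_circ_add_left[of m q F "-G" Q] by simp

lemma rec_circ_sgnp_left [simp]: "rec_circ m q (sgnp k F) Q = sgnp k (rec_circ m q F Q)"
  by (simp add: sgnp_def)

lemma rec_circ_sum_left: "rec_circ m q (\<Sum>i\<in>I. F i) Q = (\<Sum>i\<in>I. rec_circ m q (F i) Q)"
  by (induction I rule: infinite_finite_induct) auto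

lemma slot_deriv_sum: "slot_deriv m X Q F = (\<Sum>i<m. contract (X[i := Q [] (X ! i)]) F)"
  by (simp add: slot_deriv_def contract_def fun_eq_iff sum_fun_apply fun_apply_simps)

text \<open>The lengths of the blocks are not restricted, so \<open>F\<close> vanishes if a block is shorter than \<open>m\<close>:
  an update beyond the end of a list does not change it.\<close>

definition multilin :: "nat \<Rightarrow> ('k::field \<Rightarrow> 'w::ab_group_add \<Rightarrow> 'w) \<Rightarrow> 'w cochain \<Rightarrow> bool" where
  "multilin m s F \<longleftrightarrow> (\<forall>Xs. Vector_Spaces.linear s s (F Xs)) \<and>
     (\<forall>As X Bs x j. j < m \<longrightarrow> Vector_Spaces.linear s s (\<lambda>y. F (As @ X[j := y] # Bs) x))"

lemma multilin_contract: "multilin m s F \<Longrightarrow> multilin m s (contract X F)"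
  unfolding multilin_def contract_def append_Cons[symmetric] by blast

lemma linear_additive:
  assumes "Vector_Spaces.linear s s f"
  shows "f (x + y) = f x + f y" "f (x - y) = f x - f y" "f (- x) = - f x" "f 0 = 0"
proof -
  interpret Vector_Spaces.linear s s f by fact
  show "f (x + y) = f x + f y" "f (x - y) = f x - f y" "f (- x) = - f x" "f 0 = 0"
    by (rule add diff neg zero)+
qed

lemma multilin_last:
  assumes "multilin m s F"
  shows "F Xs (x + y) = F Xs x + F Xs y" "F Xs (x - y) = F Xs x - F Xs y"
    "F Xs (- x) = - F Xs x" "F Xs 0 = 0"
  by (rule linear_additive, use assms in \<open>auto simp: multilin_def\<close>)+

lemma multilin_head:
  assumes "multilin m s F" "j < m"
  shows "F (X[j := x + y] # Xs) z = F (X[j := x] # Xs) z + F (X[j := y] # Xs) z"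
    "F (X[j := x - y] # Xs) z = F (X[j := x] # Xs) z - F (X[j := y] # Xs) z"
    "F (X[j := 0] # Xs) z = 0"
proof -
  have "Vector_Spaces.linear s s (\<lambda>y. F ([] @ X[j := y] # Xs) z)"
    using assms unfolding multilin_def by blast
  from linear_additive[OF this]
  show "F (X[j := x + y] # Xs) z = F (X[j := x] # Xs) z + F (X[j := y] # Xs) z"
    "F (X[j := x - y] # Xs) z = F (X[j := x] # Xs) z - F (X[j := y] # Xs) z"
    "F (X[j := 0] # Xs) z = 0" by auto
qed

lemma multilin_short:
  assumes "multilin m s F" "length X < m"
  shows "F (X # Xs) z = 0"
  using multilin_head(3)[OF assms, of X Xs z] by (simp add: list_update_beyond)

lemma rec_circ_add_right:
  assumes "multilin m s F"
  shows "rec_circ m q F (P + Q) = rec_circ m q F P + rec_circ m q F Q"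
proof -
  have "rec_circ m q F (P + Q) Xs x = rec_circ m q F P Xs x + rec_circ m q F Q Xs x" for Xs x
    using assms
  proof (induction Xs arbitrary: F P Q q)
    case Nil
    have "rec_circ m q F (P + Q) [] x = rec_circ m q F P [] x + rec_circ m q F Q [] x"
      by (simp add: rec_circ_Nil multilin_last[OF Nil] cochain_apply)
    then show ?case .
  next
    case (Cons X Xs)
    have "slot_deriv m X (P + Q) F Xs x = slot_deriv m X P F Xs x + slot_deriv m X Q F Xs x"
      by (simp add: slot_deriv_def multilin_head[OF Cons.prems] sum.distrib cochain_apply)
    moreover have "rec_circ m q F (P + Q) Xs x = rec_circ m q F P Xs x + rec_circ m q F Q Xs x"
      if "multilin m s F" for F P Q q
      using that by (rule Cons.IH)
    ultimately have "rec_circ m q F (P + Q) (X # Xs) x = rec_circ m q F P (X # Xs) x + rec_circ m q F Q (X # Xs) x"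
      using Cons.prems multilin_contract[OF Cons.prems] by (simp add: rec_circ_Cons sgnp_def)
    then show ?case .
  qed
  then show ?thesis by (intro ext) (simp only: cochain_apply)
qed

lemma rec_circ_zero_right: "multilin m s F \<Longrightarrow> rec_circ m q F 0 = 0"
  using rec_circ_add_right[of m s F q 0 0] by simp

lemma rec_circ_minus_right: "multilin m s F \<Longrightarrow> rec_circ m q F (- P) = - rec_circ m q F P"
  using rec_circ_add_right[of m s F q P "-P"]
  by (simp add: rec_circ_zero_right eq_neg_iff_add_eq_0 add.commute)

lemma rec_circ_diff_right: "multilin m s F \<Longrightarrow> rec_circ m q F (P - Q) = rec_circ m q F P - rec_circ m q F Q"
  using rec_circ_add_right[of m s F q P "-Q"] by (simp add: rec_circ_minus_right)

lemma rec_circ_sgnp_right: "multilin m s F \<Longrightarrow> rec_circ m q F (sgnp k P) = sgnp k (rec_circ m q F P)"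
  by (simp add: sgnp_def rec_circ_minus_right)

lemma rec_circ_sum_right: "multilin m s F \<Longrightarrow> rec_circ m q F (\<Sum>i\<in>I. P i) = (\<Sum>i\<in>I. rec_circ m q F (P i))"
  by (induction I rule: infinite_finite_induct) (auto simp: rec_circ_zero_right rec_circ_add_right)

lemma sgnp_sum: "sgnp q (\<Sum>i\<in>I. f i) = (\<Sum>i\<in>I. sgnp q (f i))"
  by (simp add: sgnp_def sum_negf)

text \<open>\<open>slot_deriv m X P\<close> is a sum of contractions and so obeys the recursion of a
  contraction; for \<open>q = 0\<close> the two endomorphisms act on the block one after the
  other.\<close>

lemma slot_deriv_rec_circ:
  assumes "multilin m s F"
  shows "slot_deriv m X P (rec_circ m q F Q) = sgnp q (rec_circ m q (slot_deriv m X P F) Q) +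
     (if q = 0 then (\<Sum>i<m. slot_deriv m (X[i := P [] (X ! i)]) Q F)
      else rec_circ m (q - 1) F (slot_deriv m X P Q))"
  using assms
  by (simp add: slot_deriv_sum[of m X P] contract_rec_circ sum.distrib rec_circ_sum_left rec_circ_sum_right sgnp_sum)

text \<open>The commutator of two derivations is the derivation of the commutator: contributions to
  different slots agree in either order, and those to the same slot compose the
  endomorphisms.\<close>

lemma slot_deriv_commutator:
  assumes F: "multilin m s F"
  shows "slot_deriv m X (rec_circ m 0 P Q - rec_circ m 0 Q P) F =
    (\<Sum>i<m. slot_deriv m (X[i := Q [] (X ! i)]) P F) - (\<Sum>i<m. slot_deriv m (X[i := P [] (X ! i)]) Q F)"
proof -
  have "slot_deriv m X (rec_circ m 0 P Q - rec_circ m 0 Q P) F Xs x =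
    (\<Sum>i<m. slot_deriv m (X[i := Q [] (X ! i)]) P F Xs x) -
    (\<Sum>i<m. slot_deriv m (X[i := P [] (X ! i)]) Q F Xs x)" (is "?l = ?a - ?b") for Xs x
  \<comment> \<open>In a short block some \<open>X ! i\<close> are unspecified and the updates there
    are void; both sides vanish by \<open>multilin_short\<close>.\<close>
  proof (cases "length X < m")
    case True
    then show ?thesis by (simp add: slot_deriv_def multilin_short[OF F])
  next
    case False
    let ?u = "\<lambda>R S i j. F (X[i := R [] (X ! i), j := S [] (X[i := R [] (X ! i)] ! j)] # Xs) x"
    have "?a - ?b = (\<Sum>i<m. \<Sum>j<m. ?u Q P i j) - (\<Sum>i<m. \<Sum>j<m. ?u P Q i j)"
      by (simp add: slot_deriv_def)
    \<comment> \<open>Exchanging the indices pairs each term with the one in which the same two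
      slots are changed in the opposite order, so that only \<open>i = j\<close> survives.\<close>
    also have "(\<Sum>i<m. \<Sum>j<m. ?u P Q i j) = (\<Sum>i<m. \<Sum>j<m. ?u P Q j i)"
      by (rule sum.swap)
    also have "(\<Sum>i<m. \<Sum>j<m. ?u Q P i j) - \<dots> = (\<Sum>i<m. \<Sum>j<m. ?u Q P i j - ?u P Q j i)"
      by (simp add: sum_subtractf)
    also have "\<dots> = (\<Sum>i<m. \<Sum>j<m. if i = j then F (X[i := P [] (Q [] (X ! i))] # Xs) x -
        F (X[i := Q [] (P [] (X ! i))] # Xs) x else 0)"
    proof (intro sum.cong refl)
      fix i j assume "i \<in> {..<m}" "j \<in> {..<m}"
      then show "?u Q P i j - ?u P Q j i = (if i = j then F (X[i := P [] (Q [] (X ! i))] # Xs) x -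
        F (X[i := Q [] (P [] (X ! i))] # Xs) x else 0)"
        using False by (auto simp: list_update_swap[of i j])
    qed
    also have "\<dots> = ?l"
      by (simp add: slot_deriv_def rec_circ_Nil multilin_head[OF F] cochain_apply)
    finally show ?thesis by simp
  qed
  then show ?thesis by (intro ext) (simp add: cochain_apply sum_fun_apply)
qed

section \<open>The graded commutator and its behaviour under contraction\<close>

definition homog :: "nat \<Rightarrow> 'w::ab_group_add cochain \<Rightarrow> bool" where
  "homog p P \<longleftrightarrow> (\<forall>Xs x. length Xs \<noteq> p \<longrightarrow> P Xs x = 0)"

definition rec_bracket :: "nat \<Rightarrow> nat \<Rightarrow> nat \<Rightarrow> 'w::ab_group_add cochain \<Rightarrow> 'w cochain \<Rightarrow> 'w cochain" where
  "rec_bracket m p q P Q = rec_circ m q P Q - sgnp (p * q) (rec_circ m p Q P)"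

lemma homog_contract: "homog (Suc p) P \<Longrightarrow> homog p (contract X P)"
  by (simp add: homog_def contract_def)

lemma contract_homog_0: "homog 0 P \<Longrightarrow> contract X P = 0"
  by (simp add: homog_def contract_def fun_eq_iff cochain_apply)

lemma sgnp_simps:
  "sgnp 0 t = t" "sgnp (Suc q) t = - sgnp q t" "sgnp q (- t) = - sgnp q t" "sgnp q (sgnp q t) = t"
  "sgnp q (0::'a::ab_group_add) = 0"
  "sgnp (p + q) t = sgnp p (sgnp q t)"
  "sgnp q (t + u) = sgnp q t + sgnp q u" "sgnp q (t - u) = sgnp q t - sgnp q u"
  by (auto simp: sgnp_def)

text \<open>Contraction is a graded derivation of the bracket, with the sign of \<open>X\<close>
  passing the arguments of \<open>Q\<close>. A factor of degree 0 cannot be contracted; in the next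
  two lemmas its action on the block \<open>X\<close> takes the place of the missing term.\<close>

lemma contract_rec_bracket_Suc_Suc:
  "contract X (rec_bracket m (Suc p) (Suc q) P Q) =
    sgnp (Suc q) (rec_bracket m p (Suc q) (contract X P) Q) + rec_bracket m (Suc p) q P (contract X Q)"
  unfolding rec_bracket_def by (simp add: contract_rec_circ) (auto simp: sgnp_def algebra_simps)

lemma contract_rec_bracket_0_Suc:
  "homog 0 P \<Longrightarrow> contract X (rec_bracket m 0 (Suc q) P Q) =
    rec_bracket m 0 q P (contract X Q) - slot_deriv m X P Q"
  unfolding rec_bracket_def by (simp add: contract_rec_circ contract_homog_0 sgnp_simps)

lemma contract_rec_bracket_Suc_0:
  "homog 0 Q \<Longrightarrow> contract X (rec_bracket m (Suc p) 0 P Q) =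
    rec_bracket m p 0 (contract X P) Q + slot_deriv m X Q P"
  unfolding rec_bracket_def by (simp add: contract_rec_circ contract_homog_0 sgnp_simps)

text \<open>The terms in which \<open>P\<close> and \<open>Q\<close> act on different arguments of \<open>F\<close> cancel.\<close>

lemma rec_circ_rec_bracket:
  assumes "multilin m s F" "multilin m s P" "multilin m s Q" "homog p P" "homog q Q"
  shows "rec_circ m (p + q) F (rec_bracket m p q P Q) =
    rec_circ m q (rec_circ m p F P) Q - sgnp (p * q) (rec_circ m p (rec_circ m q F Q) P)"
proof -
  have "rec_circ m (p + q) F (rec_bracket m p q P Q) Xs x =
    rec_circ m q (rec_circ m p F P) Q Xs x - sgnp (p * q) (rec_circ m p (rec_circ m q F Q) P Xs x)" for Xs x
    using assms
  proof (induction Xs arbitrary: F P Q p q)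
    case Nil
    have "rec_circ m (p + q) F (rec_bracket m p q P Q) [] x =
      rec_circ m q (rec_circ m p F P) Q [] x - sgnp (p * q) (rec_circ m p (rec_circ m q F Q) P [] x)"
      by (simp add: rec_circ_Nil rec_bracket_def sgnp_def multilin_last[OF Nil(1)] cochain_apply)
    then show ?case .
  next
    case (Cons X Xs)
    note ml = Cons.prems(1-3)
    note mlc = ml[THEN multilin_contract]
    note hom = Cons.prems(4,5)
    have *: "A (X # Xs) x = contract X A Xs x" for A by (simp add: contract_def)
    have IH: "rec_circ m (p + q) F (rec_bracket m p q P Q) Xs x =
      rec_circ m q (rec_circ m p F P) Q Xs x - sgnp (p * q) (rec_circ m p (rec_circ m q F Q) P Xs x)"
      if "multilin m s F" "multilin m s P" "multilin m s Q" "homog p P" "homog q Q" for F P Q p q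
      using that by (rule Cons.IH)
    note step = contract_rec_circ slot_deriv_rec_circ[OF ml(1)] sgnp_simps rec_circ_add_right[OF ml(1)]
      rec_circ_diff_right[OF ml(1)] rec_circ_minus_right[OF ml(1)] rec_circ_sgnp_right[OF ml(1)]
    show ?case
    \<comment> \<open>The block \<open>X\<close> can be received by \<open>F\<close>,
      \<open>P\<close> or \<open>Q\<close>, with one instance of the induction hypothesis for each.
      A factor of degree 0 receives nothing and contributes a derivation instead, hence the four
      cases.\<close>
    proof (cases p; cases q)
      assume pq: "p = 0" "q = 0"
      have h: "rec_bracket m 0 0 P Q = rec_circ m 0 P Q - rec_circ m 0 Q P" by (simp add: rec_bracket_def sgnp_simps)
      show ?thesis unfolding * pq
        using IH[OF mlc(1)[of X] ml(2,3) hom, unfolded pq]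
        by (simp add: contract_rec_circ slot_deriv_rec_circ[OF ml(1)] sgnp_simps h slot_deriv_commutator[OF ml(1)]) (simp only: cochain_apply, simp)
    next
      \<comment> \<open>Expanding \<open>slot_deriv m X P (rec_circ m q F Q)\<close> gives a term
        with \<open>slot_deriv m X P F\<close>, which cancels, and one with
        \<open>slot_deriv m X P Q\<close>, which is the correction in
        \<open>contract_rec_bracket_0_Suc\<close>. The next case is symmetric.\<close>
      fix q' assume pq: "p = 0" "q = Suc q'"
      show ?thesis unfolding * pq
        using IH[OF mlc(1)[of X] ml(2,3) hom, unfolded pq]
          IH[OF ml(1,2) mlc(3)[of X], of 0 q'] hom[unfolded pq] homog_contract[of q' Q X]
        by (simp add: step contract_rec_bracket_0_Suc) (simp add: cochain_apply sgnp_def)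
    next
      fix p' assume pq: "p = Suc p'" "q = 0"
      show ?thesis unfolding * pq
        using IH[OF mlc(1)[of X] ml(2,3) hom, unfolded pq]
          IH[OF ml(1) mlc(2)[of X] ml(3), of p' 0] hom[unfolded pq] homog_contract[of p' P X]
        by (simp add: step contract_rec_bracket_Suc_0) (simp add: cochain_apply sgnp_def)
    next
      fix p' q' assume pq: "p = Suc p'" "q = Suc q'"
      show ?thesis unfolding * pq
        using IH[OF mlc(1)[of X] ml(2,3) hom, unfolded pq]
          IH[OF ml(1) mlc(2)[of X] ml(3), of p' "Suc q'"] IH[OF ml(1,2) mlc(3)[of X], of "Suc p'" q']
          hom[unfolded pq] homog_contract[of p' P X] homog_contract[of q' Q X]
        by (simp add: step contract_rec_bracket_Suc_Suc) (auto simp: sgnp_def cochain_apply)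
    qed
  qed
  then show ?thesis by (intro ext) (simp add: sgnp_def cochain_apply)
qed

section \<open>Graded Lie algebra structure\<close>

text \<open>Brackets in the left factor of a composition expand by additivity, those in the right
  factor by \<open>rec_circ_rec_bracket\<close>. Only left-nested double compositions remain; each
  of the six orders of \<open>P\<close>, \<open>Q\<close>, \<open>R\<close> occurs twice and
  cancels.\<close>

lemma rec_bracket_jacobi:
  assumes ml: "multilin m s P" "multilin m s Q" "multilin m s R"
    and hom: "homog p P" "homog q Q" "homog r R"
  shows "rec_bracket m p (q + r) P (rec_bracket m q r Q R) = rec_bracket m (p + q) r (rec_bracket m p q P Q) R +
    sgnp (p * q) (rec_bracket m q (p + r) Q (rec_bracket m p r P R))"
proof -
  note rep = rec_circ_rec_bracket[OF ml(1) ml(2,3) hom(2,3)] rec_circ_rec_bracket[OF ml(3) ml(1,2) hom(1,2)]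
    rec_circ_rec_bracket[OF ml(2) ml(1,3) hom(1,3)]
  have left: "rec_circ m k (rec_bracket m i j F G) H = rec_circ m k (rec_circ m j F G) H - sgnp (i * j) (rec_circ m k (rec_circ m i G F) H)"
    for i j k F G and H :: "'b cochain"
    by (simp add: rec_bracket_def)
  have "rec_bracket m p (q + r) P (rec_bracket m q r Q R) =
      rec_circ m (q + r) P (rec_bracket m q r Q R) - sgnp (p * (q + r)) (rec_circ m p (rec_bracket m q r Q R) P)"
    "rec_bracket m (p + q) r (rec_bracket m p q P Q) R =
      rec_circ m r (rec_bracket m p q P Q) R - sgnp ((p + q) * r) (rec_circ m (p + q) R (rec_bracket m p q P Q))"
    "rec_bracket m q (p + r) Q (rec_bracket m p r P R) =
      rec_circ m (p + r) Q (rec_bracket m p r P R) - sgnp (q * (p + r)) (rec_circ m q (rec_bracket m p r P R) Q)"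
    by (simp_all add: rec_bracket_def[of m p "q + r"] rec_bracket_def[of m "p + q" r] rec_bracket_def[of m q "p + r"])
  then show ?thesis
    unfolding rep left
    by (cases "even p"; cases "even q"; cases "even r") (simp_all add: sgnp_def)
qed

section \<open>Closure of the multilinear maps under composition\<close>

context vector_space
begin

lemma linear_zero_fun: "Vector_Spaces.linear scale scale (\<lambda>y. 0)"
  and linear_add_fun: "\<lbrakk>Vector_Spaces.linear scale scale f; Vector_Spaces.linear scale scale g\<rbrakk>
    \<Longrightarrow> Vector_Spaces.linear scale scale (\<lambda>y. f y + g y)"
  and linear_sgnp: "Vector_Spaces.linear scale scale f
    \<Longrightarrow> Vector_Spaces.linear scale scale (\<lambda>y. sgnp q (f y))"
  and linear_sum_fun: "(\<And>i. i \<in> I \<Longrightarrow> Vector_Spaces.linear scale scale (h i))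
    \<Longrightarrow> Vector_Spaces.linear scale scale (\<lambda>y. \<Sum>i\<in>I. h i y)"
  and linear_comp_fun: "\<lbrakk>Vector_Spaces.linear scale scale f; Vector_Spaces.linear scale scale g\<rbrakk>
    \<Longrightarrow> Vector_Spaces.linear scale scale (\<lambda>y. f (g y))"
proof -
  interpret vector_space_pair scale scale by unfold_locales
  show z: "Vector_Spaces.linear scale scale (\<lambda>y. 0)" by (rule linear_zero)
  show a: "Vector_Spaces.linear scale scale (\<lambda>y. f y + g y)"
    if "Vector_Spaces.linear scale scale f" "Vector_Spaces.linear scale scale g" for f g
    using that by (rule linear_compose_add)
  show "Vector_Spaces.linear scale scale (\<lambda>y. sgnp q (f y))"
    if "Vector_Spaces.linear scale scale f"
    using that by (cases "even q") (simp_all add: sgnp_def linear_compose_neg)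
  show "Vector_Spaces.linear scale scale (\<lambda>y. \<Sum>i\<in>I. h i y)"
    if "\<And>i. i \<in> I \<Longrightarrow> Vector_Spaces.linear scale scale (h i)"
    using that by (induction I rule: infinite_finite_induct) (simp_all add: z a)
  show "Vector_Spaces.linear scale scale (\<lambda>y. f (g y))"
    if "Vector_Spaces.linear scale scale f" "Vector_Spaces.linear scale scale g"
    using Vector_Spaces.linear_compose[OF that(2,1)] by (simp add: o_def)
qed

lemmas linear_fun_intros = linear_zero_fun linear_add_fun linear_sgnp linear_sum_fun

lemma multilinD:
  assumes "multilin m scale F"
  shows "Vector_Spaces.linear scale scale (F Xs)"
    "j < m \<Longrightarrow> Vector_Spaces.linear scale scale (\<lambda>y. F (As @ X[j := y] # Bs) x)"
    "j < m \<Longrightarrow> Vector_Spaces.linear scale scale (\<lambda>y. F (X[j := y] # Bs) x)"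
proof -
  show *: "j < m \<Longrightarrow> Vector_Spaces.linear scale scale (\<lambda>y. F (As @ X[j := y] # Bs) x)" for As
    using assms by (simp add: multilin_def)
  show "j < m \<Longrightarrow> Vector_Spaces.linear scale scale (\<lambda>y. F (X[j := y] # Bs) x)"
    using *[of "[]"] by simp
qed (use assms in \<open>simp add: multilin_def\<close>)

text \<open>\<open>F\<close> is an arbitrary linear family: it arises as the contraction of a
  cochain with a block in which one entry \<open>y\<close> varies.\<close>

lemma rec_circ_linear_left:
  assumes "\<And>Ys z. Vector_Spaces.linear scale scale (\<lambda>y. F y Ys z)"
  shows "Vector_Spaces.linear scale scale (\<lambda>y. rec_circ m q (F y) Q Xs x)"
  using assms
proof (induction Xs arbitrary: F Q q)
  case Nil
  then show ?case by (cases "q = 0") (simp_all add: rec_circ_Nil linear_zero_fun)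
next
  case (Cons X Xs)
  have "Vector_Spaces.linear scale scale (\<lambda>y. rec_circ m q (contract X (F y)) Q Xs x)"
    by (rule Cons.IH) (simp add: contract_def Cons.prems)
  moreover have "Vector_Spaces.linear scale scale (\<lambda>y. rec_circ m (q - 1) (F y) (contract X Q) Xs x)"
    by (rule Cons.IH) (rule Cons.prems)
  moreover have "Vector_Spaces.linear scale scale (\<lambda>y. slot_deriv m X Q (F y) Xs x)"
    unfolding slot_deriv_def by (intro linear_fun_intros Cons.prems)
  ultimately show ?case
    unfolding rec_circ_Cons by (cases "q = 0") (simp_all add: linear_fun_intros)
qed

lemma rec_circ_linear_right:
  assumes "multilin m scale F" and "\<And>Ys z. Vector_Spaces.linear scale scale (\<lambda>y. Q y Ys z)"
  shows "Vector_Spaces.linear scale scale (\<lambda>y. rec_circ m q F (Q y) Xs x)"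
  using assms
proof (induction Xs arbitrary: F Q q)
  case Nil
  then have "Vector_Spaces.linear scale scale (\<lambda>y. F [] (Q y [] x))"
    by (intro linear_comp_fun[OF multilinD(1)[OF Nil(1)]])
  then show ?case by (cases "q = 0") (simp_all add: rec_circ_Nil linear_zero_fun)
next
  case (Cons X Xs)
  have "Vector_Spaces.linear scale scale (\<lambda>y. rec_circ m q (contract X F) (Q y) Xs x)"
    by (rule Cons.IH[OF multilin_contract[OF Cons.prems(1)]]) (rule Cons.prems(2))
  moreover have "Vector_Spaces.linear scale scale (\<lambda>y. rec_circ m (q - 1) F (contract X (Q y)) Xs x)"
    unfolding contract_def by (rule Cons.IH[OF Cons.prems(1)]) (rule Cons.prems(2))
  moreover have "Vector_Spaces.linear scale scale (\<lambda>y. slot_deriv m X (Q y) F Xs x)"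
    unfolding slot_deriv_def
  proof (intro linear_sum_fun)
    fix i assume "i \<in> {..<m}"
    then have "Vector_Spaces.linear scale scale (\<lambda>z. F (X[i := z] # Xs) x)"
      by (intro multilinD(3)[OF Cons.prems(1)]) simp
    then show "Vector_Spaces.linear scale scale (\<lambda>y. F (X[i := Q y [] (X ! i)] # Xs) x)"
      by (rule linear_comp_fun) (rule Cons.prems)
  qed
  ultimately show ?case
    unfolding rec_circ_Cons by (cases "q = 0") (simp_all add: linear_fun_intros)
qed

lemma multilin_rec_circ:
  assumes F: "multilin m scale F" and Q: "multilin m scale Q"
  shows "multilin m scale (rec_circ m q F Q)"
  unfolding multilin_def
proof (intro allI conjI impI)
  show "Vector_Spaces.linear scale scale (rec_circ m q F Q Xs)" for Xs
    using F Q
  proof (induction Xs arbitrary: F Q q)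
    case Nil
    have "rec_circ m q F Q [] = (\<lambda>x. if q = 0 then F [] (Q [] x) else 0)"
      by (intro ext) (rule rec_circ_Nil)
    then show ?case
      using linear_comp_fun[OF multilinD(1)[OF Nil(1), of "[]"] multilinD(1)[OF Nil(2), of "[]"]]
      by (cases "q = 0") (simp_all add: linear_zero_fun)
  next
    case (Cons X Xs)
    have "Vector_Spaces.linear scale scale (\<lambda>x. rec_circ m q (contract X F) Q Xs x)"
      "Vector_Spaces.linear scale scale (\<lambda>x. rec_circ m (q - 1) F (contract X Q) Xs x)"
      using Cons.IH[of "contract X F" Q q] Cons.IH[of F "contract X Q" "q - 1"] Cons.prems
      by (simp_all add: multilin_contract)
    moreover have "Vector_Spaces.linear scale scale (\<lambda>x. slot_deriv m X Q F Xs x)"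
      unfolding slot_deriv_def by (intro linear_sum_fun multilinD(1)[OF Cons.prems(1)])
    moreover have "rec_circ m q F Q (X # Xs) = (\<lambda>x. sgnp q (rec_circ m q (contract X F) Q Xs x) +
        (if q = 0 then slot_deriv m X Q F Xs x else rec_circ m (q - 1) F (contract X Q) Xs x))"
      by (intro ext) (rule rec_circ_Cons)
    ultimately show ?case
      by (cases "q = 0") (simp_all add: linear_fun_intros)
  qed
  show "Vector_Spaces.linear scale scale (\<lambda>y. rec_circ m q F Q (As @ X[j := y] # Bs) x)"
    if j: "j < m" for As X Bs x j
    using F Q
  \<comment> \<open>The induction is on the blocks in front of the varied one, so that in the base
    case \<open>y\<close> occurs in the first block.\<close>
  proof (induction As arbitrary: F Q q)
    case Nil
    have "Vector_Spaces.linear scale scale (\<lambda>y. rec_circ m q (contract (X[j := y]) F) Q Bs x)"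
      unfolding contract_def by (intro rec_circ_linear_left multilinD(3)[OF Nil(1) j])
    moreover have "Vector_Spaces.linear scale scale (\<lambda>y. rec_circ m (q - 1) F (contract (X[j := y]) Q) Bs x)"
      unfolding contract_def by (intro rec_circ_linear_right[OF Nil(1)] multilinD(3)[OF Nil(2) j])
    moreover have "Vector_Spaces.linear scale scale (\<lambda>y. slot_deriv m (X[j := y]) Q F Bs x)"
      unfolding slot_deriv_def
    proof (intro linear_sum_fun)
      fix i assume i: "i \<in> {..<m}"
      show "Vector_Spaces.linear scale scale (\<lambda>y. F (X[j := y, i := Q [] (X[j := y] ! i)] # Bs) x)"
      \<comment> \<open>If the derivation acts on the varied slot, \<open>y\<close> enters through
        \<open>Q []\<close> and linearity is that of a composite; if it acts elsewhere, the two
        updates commute.\<close>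
      proof (cases "i = j")
        case True
        show ?thesis
        proof (cases "j < length X")
          case True
          with \<open>i = j\<close> linear_comp_fun[OF multilinD(3)[OF Nil(1) j, of X Bs x] multilinD(1)[OF Nil(2), of "[]"]]
          show ?thesis by simp
        next
          \<comment> \<open>Beyond the end of \<open>X\<close> neither update has an effect, and the
            constant function that results is the one that \<open>multilin\<close> already declares
            linear.\<close>
          case False
          with \<open>i = j\<close> multilinD(3)[OF Nil(1) j, of X Bs x] show ?thesis
            by (simp add: list_update_beyond)
        qed
      next
        case False
        with multilinD(3)[OF Nil(1) j, of "X[i := Q [] (X ! i)]" Bs x] show ?thesis
          by (simp add: list_update_swap[of i j])
      qed
    qed
    ultimately have "Vector_Spaces.linear scale scale (\<lambda>y. rec_circ m q F Q (X[j := y] # Bs) x)"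
      unfolding rec_circ_Cons by (cases "q = 0") (simp_all add: linear_fun_intros)
    then show ?case by simp
  next
    case (Cons A As)
    have "Vector_Spaces.linear scale scale (\<lambda>y. rec_circ m q (contract A F) Q (As @ X[j := y] # Bs) x)"
      "Vector_Spaces.linear scale scale (\<lambda>y. rec_circ m (q - 1) F (contract A Q) (As @ X[j := y] # Bs) x)"
      using Cons.IH[of "contract A F" Q q] Cons.IH[of F "contract A Q" "q - 1"] Cons.prems
      by (simp_all add: multilin_contract)
    moreover have "Vector_Spaces.linear scale scale (\<lambda>y. slot_deriv m A Q F (As @ X[j := y] # Bs) x)"
      unfolding slot_deriv_def
    proof (intro linear_sum_fun)
      fix i
      show "Vector_Spaces.linear scale scale
          (\<lambda>y. F (A[i := Q [] (A ! i)] # As @ X[j := y] # Bs) x)"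
        using multilinD(2)[OF Cons.prems(1) j, of "A[i := Q [] (A ! i)] # As" X Bs x] by simp
    qed
    ultimately have "Vector_Spaces.linear scale scale (\<lambda>y. rec_circ m q F Q (A # As @ X[j := y] # Bs) x)"
      unfolding rec_circ_Cons by (cases "q = 0") (simp_all add: linear_fun_intros)
    then show ?case by simp
  qed
qed

end

lemma homog_rec_circ:
  assumes "multilin m s P" "homog p P" "homog q Q"
  shows "homog (p + q) (rec_circ m q P Q)"
  unfolding homog_def
proof (intro allI impI)
  fix Xs :: "'b list list" and x assume "length Xs \<noteq> p + q"
  then show "rec_circ m q P Q Xs x = 0"
    using assms
  proof (induction Xs arbitrary: P Q p q)
    case Nil
    then show ?case by (auto simp: rec_circ_Nil homog_def)
  next
    case (Cons X Xs)
    have "rec_circ m q (contract X P) Q Xs x = 0"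
    proof (cases p)
      case 0
      then show ?thesis using Cons.prems by (simp add: contract_homog_0 cochain_apply)
    next
      case (Suc p')
      show ?thesis
        by (rule Cons.IH[of p'])
          (use Suc Cons.prems in \<open>simp_all add: multilin_contract homog_contract\<close>)
    qed
    moreover have "rec_circ m (q - 1) P (contract X Q) Xs x = 0" if "q \<noteq> 0"
      by (rule Cons.IH[of p "q - 1"])
        (use that Cons.prems homog_contract[of "q - 1" Q] in auto)
    moreover have "slot_deriv m X Q P Xs x = 0" if "q = 0"
      using that Cons.prems by (auto simp: slot_deriv_def homog_def intro!: sum.neutral)
    ultimately show ?case by (simp add: rec_circ_Cons sgnp_def)
  qed
qed

text \<open>Equivariance of the composition under a change of variables, stated for pairs of cochains
  because contraction with a block does not preserve equivariance of a single one.\<close>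

definition intertwines :: "('w \<Rightarrow> 'z) \<Rightarrow> 'w cochain \<Rightarrow> 'z cochain \<Rightarrow> bool" where
  "intertwines \<phi> F F' \<longleftrightarrow> (\<forall>Xs x. F' (map (map \<phi>) Xs) (\<phi> x) = \<phi> (F Xs x))"

lemma intertwines_rec_circ:
  assumes add: "\<And>x y. \<phi> (x + y) = \<phi> x + \<phi> y"
    and "multilin m s F" "multilin m s' F'" "intertwines \<phi> F F'" "intertwines \<phi> Q Q'"
  shows "intertwines \<phi> (rec_circ m q F Q) (rec_circ m q F' Q')"
proof -
  have zero: "\<phi> 0 = 0" using add[of 0 0] by simp
  have minus: "\<phi> (- x) = - \<phi> x" for x using add[of x "- x"] zero by (simp add: eq_neg_iff_add_eq_0 add.commute)
  have sgn: "\<phi> (sgnp q x) = sgnp q (\<phi> x)" for q x by (simp add: sgnp_def minus)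
  have sum: "\<phi> (\<Sum>i\<in>I. f i) = (\<Sum>i\<in>I. \<phi> (f i))" for I and f :: "nat \<Rightarrow> 'a"
    by (induction I rule: infinite_finite_induct) (simp_all add: zero add)
  have "rec_circ m q F' Q' (map (map \<phi>) Xs) (\<phi> x) = \<phi> (rec_circ m q F Q Xs x)" for Xs x
    using assms(2-)
  proof (induction Xs arbitrary: F F' Q Q' q)
    case Nil
    have "F' [] (\<phi> y) = \<phi> (F [] y)" "Q' [] (\<phi> y) = \<phi> (Q [] y)" for y
      using Nil(3,4) unfolding intertwines_def by (metis list.map(1))+
    then show ?case by (simp add: rec_circ_Nil zero)
  next
    case (Cons X Xs)
    have c: "intertwines \<phi> (contract X G) (contract (map \<phi> X) G')" if "intertwines \<phi> G G'" for G G'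
      using that unfolding intertwines_def contract_def by (metis list.map(2))
    have "rec_circ m q (contract (map \<phi> X) F') Q' (map (map \<phi>) Xs) (\<phi> x) = \<phi> (rec_circ m q (contract X F) Q Xs x)"
      by (intro Cons.IH multilin_contract c Cons.prems)
    moreover have "rec_circ m (q - 1) F' (contract (map \<phi> X) Q') (map (map \<phi>) Xs) (\<phi> x) =
        \<phi> (rec_circ m (q - 1) F (contract X Q) Xs x)"
      by (intro Cons.IH c Cons.prems)
    moreover have "slot_deriv m (map \<phi> X) Q' F' (map (map \<phi>) Xs) (\<phi> x) = \<phi> (slot_deriv m X Q F Xs x)"
    \<comment> \<open>Mapping commutes with indexing only inside the list; for blocks shorter than
      \<open>m\<close> both \<open>F\<close> and \<open>F'\<close> vanish.\<close>
    proof (cases "length X < m")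
      case True
      then show ?thesis
        using multilin_short[OF Cons.prems(1)] multilin_short[OF Cons.prems(2)]
        by (simp add: slot_deriv_def zero)
    next
      case False
      have "F' ((map \<phi> X)[i := Q' [] (map \<phi> X ! i)] # map (map \<phi>) Xs) (\<phi> x) =
          \<phi> (F (X[i := Q [] (X ! i)] # Xs) x)" if "i < m" for i
      proof -
        have Q: "Q' [] (map \<phi> X ! i) = \<phi> (Q [] (X ! i))"
          using Cons.prems(4) that False unfolding intertwines_def
          by (metis list.map(1) not_less nth_map order_less_le_trans)
        have "(map \<phi> X)[i := Q' [] (map \<phi> X ! i)] # map (map \<phi>) Xs =
            map (map \<phi>) (X[i := Q [] (X ! i)] # Xs)"
          by (simp add: Q map_update)
        then show ?thesis using Cons.prems(3) unfolding intertwines_def by metis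
      qed
      then show ?thesis by (simp add: slot_deriv_def sum)
    qed
    ultimately show ?case by (simp add: rec_circ_Cons add sgn)
  qed
  then show ?thesis unfolding intertwines_def by blast
qed

section \<open>Alternating maps and skewness of the composition\<close>

definition alternating :: "nat \<Rightarrow> ('a::ab_group_add list \<Rightarrow> 'b::ab_group_add) \<Rightarrow> bool" where
  "alternating N g \<longleftrightarrow> (\<forall>xs. length xs = N \<longrightarrow> \<not> distinct xs \<longrightarrow> g xs = 0) \<and>
     (\<forall>xs i x y. length xs = N \<longrightarrow> i < N \<longrightarrow> g (xs[i := x + y]) = g (xs[i := x]) + g (xs[i := y]))"

text \<open>Polarisation: the value with \<open>u + v\<close> in both positions vanishes, and so do
  its two diagonal terms.\<close>

lemma alternating_swap:
  assumes g: "alternating N g" and len: "length xs = N" and ab: "a < N" "b < N" "a \<noteq> b"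
  shows "g (xs[a := u, b := v]) = - g (xs[a := v, b := u])"
proof -
  have nd: "g (xs[a := w, b := w]) = 0" for w
  proof -
    have "\<not> distinct (xs[a := w, b := w])"
      using len ab by (metis length_list_update nth_eq_iff_index_eq nth_list_update_eq nth_list_update_neq)
    then show ?thesis using g len by (simp add: alternating_def)
  qed
  have add: "g (ys[i := x + y]) = g (ys[i := x]) + g (ys[i := y])" if "length ys = N" "i < N" for ys i x y
    using g that by (simp add: alternating_def)
  have "0 = g (xs[a := u + v, b := u + v])" by (simp add: nd)
  also have "\<dots> = g (xs[a := u + v, b := u]) + g (xs[a := u + v, b := v])"
    using len ab by (simp add: add)
  also have "\<dots> = g (xs[b := u, a := u + v]) + g (xs[b := v, a := u + v])"
    using ab by (simp add: list_update_swap)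
  also have "\<dots> = g (xs[b := u, a := u]) + g (xs[b := u, a := v]) + g (xs[b := v, a := u]) + g (xs[b := v, a := v])"
    using len ab by (simp add: add)
  also have "\<dots> = g (xs[a := v, b := u]) + g (xs[a := u, b := v])"
    using ab nd by (simp add: list_update_swap[of b a])
  finally show ?thesis by (simp add: eq_neg_iff_add_eq_0 add.commute)
qed

text \<open>Only the terms acting on one of two equal entries can survive, and these two differ by a
  transposition. This is what lets an endomorphism act on wedges.\<close>

lemma alternating_derivation:
  assumes g: "alternating N g" and len: "length xs = N" and nd: "\<not> distinct xs"
  shows "(\<Sum>i<N. g (xs[i := D (xs ! i)])) = 0"
proof -
  obtain a b where ab: "a < N" "b < N" "a \<noteq> b" "xs ! a = xs ! b"
    using nd len by (auto simp: distinct_conv_nth)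
  have "(\<Sum>i<N. g (xs[i := D (xs ! i)])) = (\<Sum>i\<in>{a, b}. g (xs[i := D (xs ! i)]))"
  proof (intro sum.mono_neutral_right ballI)
    fix i assume i: "i \<in> {..<N} - {a, b}"
    then have "\<not> distinct (xs[i := D (xs ! i)])"
      using ab len by (metis DiffE insertCI length_list_update nth_eq_iff_index_eq nth_list_update_neq)
    then show "g (xs[i := D (xs ! i)]) = 0" using g len by (simp add: alternating_def)
  qed (use ab in auto)
  also have "\<dots> = g (xs[a := D (xs ! a), b := xs ! b]) + g (xs[a := xs ! a, b := D (xs ! b)])"
  proof -
    have "xs[a := u, b := xs ! b] = xs[a := u]" for u
      using list_update_swap[OF ab(3), of xs u "xs ! b"] by simp
    then show ?thesis using ab(3) by simp
  qed
  also have "\<dots> = 0"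
    using alternating_swap[OF g len ab(1-3), of "D (xs ! a)" "xs ! a"] ab(4) by simp
  finally show ?thesis .
qed

text \<open>A wrong block length is included, so that skewness in a block and vanishing off the
  domain pass to contractions together, without reference to the degree.\<close>

definition block_alt :: "nat \<Rightarrow> 'w::ab_group_add cochain \<Rightarrow> bool" where
  "block_alt m F \<longleftrightarrow> (\<forall>Xs x. (\<exists>X\<in>set Xs. length X \<noteq> m \<or> \<not> distinct X) \<longrightarrow> F Xs x = 0)"

text \<open>The last block and the final vector form an \<open>n\<close>-fold wedge. The blocks in
  front are arbitrary, so that the property passes to contractions; in degree 0 it is automatic from
  homogeneity.\<close>

definition last_alt :: "'w::ab_group_add cochain \<Rightarrow> bool" where
  "last_alt F \<longleftrightarrow> (\<forall>Xs X x. \<not> distinct (X @ [x]) \<longrightarrow> F (Xs @ [X]) x = 0)"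

lemma block_altD: "\<lbrakk>block_alt m F; X \<in> set Xs; length X \<noteq> m \<or> \<not> distinct X\<rbrakk> \<Longrightarrow> F Xs x = 0"
  by (auto simp: block_alt_def)

lemma block_alt_contract: "block_alt m F \<Longrightarrow> block_alt m (contract X F)"
  by (simp add: block_alt_def contract_def)

lemma contract_bad_block:
  "\<lbrakk>block_alt m F; length X \<noteq> m \<or> \<not> distinct X\<rbrakk> \<Longrightarrow> contract X F = 0"
  by (intro ext) (auto simp: block_alt_def contract_def cochain_apply)

lemma last_altD: "\<lbrakk>last_alt F; \<not> distinct (X @ [x])\<rbrakk> \<Longrightarrow> F (Xs @ [X]) x = 0"
  by (auto simp: last_alt_def)

lemma last_alt_contract: "last_alt F \<Longrightarrow> last_alt (contract X F)"
  unfolding last_alt_def contract_def by (metis append_Cons)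

lemma alternating_head:
  assumes "multilin m s F" "block_alt m F"
  shows "alternating m (\<lambda>X. F (X # Xs) x)"
  unfolding alternating_def
proof (intro conjI allI impI)
  show "F (X # Xs) x = 0" if "\<not> distinct X" for X
    using that by (intro block_altD[OF assms(2)]) auto
qed (rule multilin_head(1)[OF assms(1)])

lemma alternating_last:
  assumes ml: "multilin m s F" and "last_alt F"
  shows "alternating (Suc m) (\<lambda>ws. F [butlast ws] (last ws))"
  unfolding alternating_def
proof (intro conjI allI impI)
  fix ws :: "'b list" assume ws: "length ws = Suc m" "\<not> distinct ws"
  then have "ws = butlast ws @ [last ws]" by (metis append_butlast_last_id list.size(3) nat.simps(3))
  then show "F [butlast ws] (last ws) = 0"
    using last_altD[OF assms(2), of "butlast ws" "last ws" "[]"] ws by simp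
next
  fix ws :: "'b list" and i x y assume ws: "length ws = Suc m" "i < Suc m"
  then have "ws \<noteq> []" by auto
  have l: "last (ws[i := z]) = (if i = m then z else last ws)" for z
    using ws \<open>ws \<noteq> []\<close> by (simp add: last_list_update)
  have b: "butlast (ws[i := z]) = (if i = m then butlast ws else (butlast ws)[i := z])" for z
    using ws by (simp add: butlast_list_update)
  show "F [butlast (ws[i := x + y])] (last (ws[i := x + y])) =
    F [butlast (ws[i := x])] (last (ws[i := x])) + F [butlast (ws[i := y])] (last (ws[i := y]))"
    unfolding l b using ws by (simp add: multilin_last[OF ml] multilin_head[OF ml])
qed

lemma block_alt_rec_circ:
  assumes "multilin m s F" "block_alt m F" "block_alt m Q"
  shows "block_alt m (rec_circ m q F Q)"
  unfolding block_alt_def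
proof (intro allI impI)
  fix Xs :: "'b list list" and x
  assume "\<exists>X\<in>set Xs. length X \<noteq> m \<or> \<not> distinct X"
  then show "rec_circ m q F Q Xs x = 0"
    using assms
  proof (induction Xs arbitrary: F Q q)
    case Nil
    then show ?case by simp
  next
    case (Cons X Xs)
    note p = Cons.prems
    have "rec_circ m q (contract X F) Q Xs x = 0 \<and> rec_circ m (q - 1) F (contract X Q) Xs x = 0 \<and>
      slot_deriv m X Q F Xs x = 0"
    proof (cases "\<exists>X\<in>set Xs. length X \<noteq> m \<or> \<not> distinct X")
      case True
      have "slot_deriv m X Q F Xs x = 0"
        unfolding slot_deriv_def
        by (intro sum.neutral ballI, use True in \<open>auto intro: block_altD[OF p(3)]\<close>)
      moreover have "rec_circ m q (contract X F) Q Xs x = 0"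
        by (intro Cons.IH True multilin_contract block_alt_contract p)
      moreover have "rec_circ m (q - 1) F (contract X Q) Xs x = 0"
        by (intro Cons.IH True block_alt_contract p)
      ultimately show ?thesis by simp
    next
      case False
      \<comment> \<open>The first block is now the bad one: both contractions with it are zero, and
        the derivation term vanishes because a derivation respects wedges.\<close>
      then have X: "length X \<noteq> m \<or> \<not> distinct X" using p(1) by auto
      have "slot_deriv m X Q F Xs x = 0"
      proof (cases "length X = m")
        case True
        then show ?thesis
          unfolding slot_deriv_def using X
          by (intro alternating_derivation[OF alternating_head[OF p(2,3)]]) auto
      next
        case False
        then show ?thesis
          unfolding slot_deriv_def by (intro sum.neutral ballI block_altD[OF p(3)]) auto
      qed
      then show ?thesis
        using contract_bad_block[OF p(3) X] contract_bad_block[OF p(4) X] rec_circ_zero_right[OF p(2)]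
        by (simp add: cochain_apply)
    qed
    then show ?case by (simp add: rec_circ_Cons sgnp_def)
  qed
qed

text \<open>The terms in which the derivation acts on the last block and the terms in which \<open>Q\<close> is applied
  to the last vector are not skew separately; together they form the derivation on the \<open>(m + 1)\<close>-fold
  wedge.\<close>

lemma last_alt_rec_circ:
  assumes "multilin m s F" "block_alt m F" "block_alt m Q" "last_alt F" "last_alt Q"
  shows "last_alt (rec_circ m q F Q)"
  unfolding last_alt_def
proof (intro allI impI)
  fix Xs and X :: "'b list" and x
  assume X: "\<not> distinct (X @ [x])"
  show "rec_circ m q F Q (Xs @ [X]) x = 0"
    using assms
  proof (induction Xs arbitrary: F Q q)
    case Nil
    have Q1: "Q [X] x = 0" using last_altD[OF Nil(5) X, of "[]"] by simp
    show ?case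
    proof (cases "q = 0")
      \<comment> \<open>With a single block and \<open>q > 0\<close>, a term survives only if
        \<open>Q\<close> receives the block, and then \<open>Q [X] x = 0\<close>.\<close>
      case False
      then show ?thesis
        by (auto simp: rec_circ_Cons rec_circ_Nil sgnp_def contract_def Q1 multilin_last[OF Nil(1)])
    next
      case True
      show ?thesis
      proof (cases "length X = m")
        case False
        then show ?thesis
          using block_altD[OF block_alt_rec_circ[OF Nil(1-3)], of X "[X]"] by simp
      next
        case len: True
        let ?g = "\<lambda>ws. F [butlast ws] (last ws)"
        have "0 = (\<Sum>i<Suc m. ?g ((X @ [x])[i := Q [] ((X @ [x]) ! i)]))"
          using X len by (intro alternating_derivation[OF alternating_last[OF Nil(1,4)], symmetric]) auto
        also have "\<dots> = (\<Sum>i<m. F [X[i := Q [] (X ! i)]] x) + F [X] (Q [] x)"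
          using len by (simp add: nth_append list_update_append)
        finally show ?thesis
          using True by (simp add: rec_circ_Cons rec_circ_Nil sgnp_def contract_def slot_deriv_def add.commute)
      qed
    qed
  next
    case (Cons Y Xs)
    note p = Cons.prems
    have "rec_circ m q (contract Y F) Q (Xs @ [X]) x = 0"
      by (intro Cons.IH multilin_contract block_alt_contract last_alt_contract p)
    moreover have "rec_circ m (q - 1) F (contract Y Q) (Xs @ [X]) x = 0"
      by (intro Cons.IH block_alt_contract last_alt_contract p)
    moreover have "slot_deriv m Y Q F (Xs @ [X]) x = 0"
      unfolding slot_deriv_def append_Cons[symmetric]
      by (intro sum.neutral ballI last_altD[OF p(4) X])
    ultimately show ?case by (simp add: rec_circ_Cons sgnp_def)
  qed
qed

text \<open>Vanishing off the domain allows the conditions of \<open>cochains\<close> to be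
  quantified over all lists, the form in which they pass to contractions and are open to induction.
  Writing \<open>n\<close> as \<open>Suc m\<close> makes \<open>m\<close> the length of a
  block.\<close>

lemma cochains_iff:
  assumes "vector_space s"
  shows "P \<in> cochains (Suc m) s p \<longleftrightarrow>
    homog p P \<and> multilin m s P \<and> block_alt m P \<and> (0 < p \<longrightarrow> last_alt P)"
proof -
  interpret vector_space s by fact
  show ?thesis
  proof
    assume P: "P \<in> cochains (Suc m) s p"
    then have off: "P Xs x = 0" if "Xs \<notin> wedge_args (Suc m) p" for Xs x
      using that by (simp add: cochains_def)
    have "homog p P" using off by (auto simp: homog_def wedge_args_def)
    moreover have "block_alt m P"
      unfolding block_alt_def
    proof (intro allI impI)
      fix Xs :: "'b list list" and x assume "\<exists>X\<in>set Xs. length X \<noteq> m \<or> \<not> distinct X"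
      then show "P Xs x = 0"
        using P off[of Xs x] by (cases "Xs \<in> wedge_args (Suc m) p") (auto simp: cochains_def wedge_args_def)
    qed
    moreover have "last_alt P" if "0 < p"
      unfolding last_alt_def
    proof (intro allI impI)
      fix Xs and X :: "'b list" and x assume "\<not> distinct (X @ [x])"
      then show "P (Xs @ [X]) x = 0"
        using P that off[of "Xs @ [X]" x] by (cases "Xs @ [X] \<in> wedge_args (Suc m) p") (auto simp: cochains_def)
    qed
    moreover have "multilin m s P"
      unfolding multilin_def
    proof (intro conjI allI impI)
      fix Xs
      show "Vector_Spaces.linear s s (P Xs)"
      proof (cases "Xs \<in> wedge_args (Suc m) p")
        case False
        then have "P Xs = (\<lambda>x. 0)" using off by auto
        then show ?thesis by (simp add: linear_zero_fun)
      qed (use P in \<open>auto simp: cochains_def\<close>)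
    next
      fix As and X :: "'b list" and Bs x j assume j: "j < m"
      let ?Xs = "As @ X # Bs"
      have upd: "As @ X[j := y] # Bs = ?Xs[length As := (?Xs ! length As)[j := y]]" for y by simp
      show "Vector_Spaces.linear s s (\<lambda>y. P (As @ X[j := y] # Bs) x)"
      proof (cases "?Xs \<in> wedge_args (Suc m) p")
        case True
        then have "length As < p" by (auto simp: wedge_args_def)
        with P True j show ?thesis
          unfolding upd cochains_def mem_Collect_eq by (metis diff_Suc_1)
      next
        case False
        then have "As @ X[j := y] # Bs \<notin> wedge_args (Suc m) p" for y by (simp add: wedge_args_def)
        then show ?thesis by (simp add: off linear_zero_fun)
      qed
    qed
    ultimately show "homog p P \<and> multilin m s P \<and> block_alt m P \<and> (0 < p \<longrightarrow> last_alt P)" by blast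
  next
    assume *: "homog p P \<and> multilin m s P \<and> block_alt m P \<and> (0 < p \<longrightarrow> last_alt P)"
    show "P \<in> cochains (Suc m) s p"
      unfolding cochains_def mem_Collect_eq
    proof (intro conjI allI ballI impI)
      show "P Xs x = 0" if "Xs \<notin> wedge_args (Suc m) p" for Xs x
        using that * by (auto simp: wedge_args_def homog_def block_alt_def)
      show "Vector_Spaces.linear s s (P Xs)" for Xs
        using * by (simp add: multilin_def)
      show "Vector_Spaces.linear s s (\<lambda>y. P (Xs[i := (Xs ! i)[j := y]]) x)"
        if "Xs \<in> wedge_args (Suc m) p" "i < p" "j < Suc m - 1" for Xs x i j
      proof -
        have "Xs[i := (Xs ! i)[j := y]] = take i Xs @ (Xs ! i)[j := y] # drop (Suc i) Xs" for y
          using that by (simp add: wedge_args_def upd_conv_take_nth_drop)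
        then show ?thesis using * that by (simp add: multilin_def)
      qed
      show "P Xs x = 0" if "\<exists>X\<in>set Xs. \<not> distinct X" for Xs x
        using that * by (auto simp: block_alt_def)
      show "P Xs x = 0" if "Xs \<in> wedge_args (Suc m) p" "0 < p \<and> \<not> distinct (last Xs @ [x])" for Xs x
      proof -
        have "Xs = butlast Xs @ [last Xs]" using that by (auto simp: wedge_args_def)
        then show ?thesis using * that last_altD[of P "last Xs" x "butlast Xs"] by simp
      qed
    qed
  qed
qed

section \<open>Shuffles\<close>

definition lift_perm :: "(nat \<Rightarrow> nat) \<Rightarrow> nat \<Rightarrow> nat" where
  "lift_perm \<sigma> a = (case a of 0 \<Rightarrow> 0 | Suc b \<Rightarrow> Suc (\<sigma> b))"

text \<open>The cycle that moves the entry in position 0 to position \<open>i\<close>.\<close>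

primrec insert_cycle :: "nat \<Rightarrow> nat \<Rightarrow> nat" where
  "insert_cycle 0 = id"
| "insert_cycle (Suc i) = insert_cycle i \<circ> transpose i (Suc i)"

lemma lift_perm_simps [simp]: "lift_perm \<sigma> 0 = 0" "lift_perm \<sigma> (Suc b) = Suc (\<sigma> b)"
  by (simp_all add: lift_perm_def)

lemma insert_cycle_apply: "insert_cycle i a = (if a < i then Suc a else if a = i then 0 else a)"
  by (induction i arbitrary: a) (auto simp: transpose_def)

lemma permutes_insert_cycle: "i < N \<Longrightarrow> insert_cycle i permutes {..<N}"
  by (induction i) (auto simp: permutes_id intro!: permutes_compose permutes_swap_id)

lemma sign_insert_cycle: "sign (insert_cycle i) = (-1) ^ i"
proof (induction i)
  case (Suc i)
  have "permutation (insert_cycle i)"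
    using permutes_insert_cycle[of i "Suc i"] permutation_permutes finite_lessThan by blast
  then have "sign (insert_cycle i \<circ> transpose i (Suc i)) = sign (insert_cycle i) * sign (transpose i (Suc i))"
    by (intro sign_compose permutation_swap_id)
  then have "sign (insert_cycle i \<circ> transpose i (Suc i)) = (-1) ^ Suc i"
    using Suc by (simp add: sign_swap_id)
  then show ?case unfolding insert_cycle.simps .
qed (simp add: sign_id)

text \<open>Transport along \<open>Suc\<close> leaves 0 fixed; the sign and the permutation property
  of \<open>lift_perm\<close> are then those of \<open>map_permutation\<close>.\<close>

lemma lift_perm_eq_map_permutation:
  assumes "\<sigma> permutes {..<N}"
  shows "lift_perm \<sigma> = map_permutation {..<N} Suc \<sigma>"
proof
  fix a
  show "lift_perm \<sigma> a = map_permutation {..<N} Suc \<sigma> a"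
  proof (cases "a \<in> Suc ` {..<N}")
    case True
    then obtain b where "b < N" "a = Suc b" by auto
    then show ?thesis by (simp add: map_permutation_apply)
  next
    case False
    then have "\<sigma> b = b" if "a = Suc b" for b
      using that assms by (auto simp: permutes_def)
    with False show ?thesis by (cases a) (auto simp: map_permutation_def restrict_id_def)
  qed
qed

lemma permutes_lift_perm: "\<sigma> permutes {..<N} \<Longrightarrow> lift_perm \<sigma> permutes {..<Suc N}"
proof -
  assume \<sigma>: "\<sigma> permutes {..<N}"
  have "map_permutation {..<N} Suc \<sigma> permutes (Suc ` {..<N})"
    by (intro map_permutation_permutes \<sigma>) (auto simp: bij_betw_def)
  then show ?thesis
    unfolding lift_perm_eq_map_permutation[OF \<sigma>] by (rule permutes_subset) auto
qed

lemma sign_lift_perm: "\<sigma> permutes {..<N} \<Longrightarrow> sign (lift_perm \<sigma>) = sign \<sigma>"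
  by (simp add: lift_perm_eq_map_permutation sign_map_permutation)

lemma lift_perm_surj:
  assumes \<tau>: "\<tau> permutes {..<Suc N}" "\<tau> 0 = 0"
  shows "\<exists>\<sigma>. \<sigma> permutes {..<N} \<and> \<tau> = lift_perm \<sigma>"
proof (intro exI conjI)
  let ?\<sigma> = "\<lambda>a. \<tau> (Suc a) - 1"
  have pos: "\<tau> (Suc a) \<noteq> 0" for a
    using \<tau> permutes_inj[OF \<tau>(1)] by (metis injD nat.distinct(1))
  show "\<tau> = lift_perm ?\<sigma>"
  proof
    show "\<tau> a = lift_perm ?\<sigma> a" for a using pos \<tau>(2) by (cases a) auto
  qed
  have "inj ?\<sigma>"
  proof
    fix a b assume "\<tau> (Suc a) - 1 = \<tau> (Suc b) - 1"
    then have "\<tau> (Suc a) = \<tau> (Suc b)" using pos[of a] pos[of b] by simp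
    then show "a = b" using permutes_inj[OF \<tau>(1)] by (auto dest: injD)
  qed
  moreover have "?\<sigma> a < N" if "a < N" for a
    using that permutes_in_image[OF \<tau>(1), of "Suc a"] pos[of a] by simp
  ultimately have "bij_betw ?\<sigma> {..<N} {..<N}"
    unfolding bij_betw_def by (intro conjI endo_inj_surj) (auto intro: inj_on_subset)
  then show "?\<sigma> permutes {..<N}"
  proof (rule bij_imp_permutes)
    fix a assume "a \<notin> {..<N}"
    then have "\<tau> (Suc a) = Suc a" using \<tau>(1) by (auto simp: permutes_def)
    then show "?\<sigma> a = a" by simp
  qed
qed

lemma finite_shuffle_perms: "finite (shuffle_perms i j)"
  by (rule finite_subset[OF _ finite_permutations[of "{..<i + j}"]]) (auto simp: shuffle_perms_def)

text \<open>The preimage of 0 is least in its increasing run, hence position 0 or position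
  \<open>i\<close>: the argument in front comes first for \<open>P\<close> or first for
  \<open>Q\<close>.\<close>

lemma shuffle_perms_head:
  assumes "\<sigma> \<in> shuffle_perms i j" "0 < i + j"
  shows "(0 < i \<and> \<sigma> 0 = 0) \<or> (0 < j \<and> \<sigma> i = 0)"
proof -
  have \<sigma>: "\<sigma> permutes {..<i + j}" "strict_mono_on {..<i} \<sigma>" "strict_mono_on {i..<i + j} \<sigma>"
    using assms by (auto simp: shuffle_perms_def)
  obtain a where a: "a < i + j" "\<sigma> a = 0"
    using permutes_image[OF \<sigma>(1)] assms(2) by (metis imageE lessThan_iff)
  show ?thesis
  proof (cases "a < i")
    case True
    then have "a = 0"
      using strict_mono_onD[OF \<sigma>(2), of 0 a] a(2) by (cases a) auto
    then show ?thesis using True a by auto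
  next
    case False
    then have "a = i"
      using strict_mono_onD[OF \<sigma>(3), of i a] a by (cases "i = a") auto
    then show ?thesis using a by auto
  qed
qed

lemma shuffle_perms_first:
  "{\<sigma> \<in> shuffle_perms (Suc i) j. \<sigma> 0 = 0} = lift_perm ` shuffle_perms i j"
proof (intro equalityI subsetI)
  fix \<tau> assume "\<tau> \<in> {\<sigma> \<in> shuffle_perms (Suc i) j. \<sigma> 0 = 0}"
  then have \<tau>: "\<tau> permutes {..<Suc (i + j)}" "\<tau> 0 = 0"
      "strict_mono_on {..<Suc i} \<tau>" "strict_mono_on {Suc i..<Suc (i + j)} \<tau>"
    by (auto simp: shuffle_perms_def)
  obtain \<sigma> where \<sigma>: "\<sigma> permutes {..<i + j}" "\<tau> = lift_perm \<sigma>" using lift_perm_surj[OF \<tau>(1,2)] by blast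
  have "strict_mono_on {..<i} \<sigma>"
  proof (rule strict_mono_onI)
    fix a b assume "a \<in> {..<i}" "b \<in> {..<i}" "a < b"
    then show "\<sigma> a < \<sigma> b" using strict_mono_onD[OF \<tau>(3), of "Suc a" "Suc b"] \<sigma>(2) by simp
  qed
  moreover have "strict_mono_on {i..<i + j} \<sigma>"
  proof (rule strict_mono_onI)
    fix a b assume "a \<in> {i..<i + j}" "b \<in> {i..<i + j}" "a < b"
    then show "\<sigma> a < \<sigma> b" using strict_mono_onD[OF \<tau>(4), of "Suc a" "Suc b"] \<sigma>(2) by simp
  qed
  ultimately show "\<tau> \<in> lift_perm ` shuffle_perms i j" using \<sigma> by (auto simp: shuffle_perms_def)
next
  fix \<tau> assume "\<tau> \<in> lift_perm ` shuffle_perms i j"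
  then obtain \<sigma> where \<sigma>: "\<sigma> permutes {..<i + j}" "strict_mono_on {..<i} \<sigma>"
      "strict_mono_on {i..<i + j} \<sigma>" "\<tau> = lift_perm \<sigma>"
    by (auto simp: shuffle_perms_def)
  have "strict_mono_on {..<Suc i} \<tau>"
  proof (rule strict_mono_onI)
    fix a b assume "a \<in> {..<Suc i}" "b \<in> {..<Suc i}" "a < b"
    then show "\<tau> a < \<tau> b"
      using strict_mono_onD[OF \<sigma>(2), of "a - 1" "b - 1"] \<sigma>(4) by (cases a; cases b) auto
  qed
  moreover have "strict_mono_on {Suc i..<Suc i + j} \<tau>"
  proof (rule strict_mono_onI)
    fix a b assume "a \<in> {Suc i..<Suc i + j}" "b \<in> {Suc i..<Suc i + j}" "a < b"
    then show "\<tau> a < \<tau> b"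
      using strict_mono_onD[OF \<sigma>(3), of "a - 1" "b - 1"] \<sigma>(4) by (cases a; cases b) auto
  qed
  ultimately show "\<tau> \<in> {\<sigma> \<in> shuffle_perms (Suc i) j. \<sigma> 0 = 0}"
    using permutes_lift_perm[OF \<sigma>(1)] \<sigma>(4) by (simp add: shuffle_perms_def)
qed

text \<open>Undoing the cycle brings the value 0 from position \<open>i\<close> to the front, where
  \<open>lift_perm_surj\<close> applies. Positions before \<open>i\<close> shift by one and those
  after \<open>i\<close> stay, so both runs remain increasing.\<close>

lemma shuffle_perms_second:
  "{\<sigma> \<in> shuffle_perms i (Suc j). \<sigma> i = 0} = (\<lambda>\<sigma>. lift_perm \<sigma> \<circ> insert_cycle i) ` shuffle_perms i j"
proof (intro equalityI subsetI)
  fix \<tau> assume "\<tau> \<in> {\<sigma> \<in> shuffle_perms i (Suc j). \<sigma> i = 0}"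
  then have \<tau>: "\<tau> permutes {..<Suc (i + j)}" "\<tau> i = 0"
      "strict_mono_on {..<i} \<tau>" "strict_mono_on {i..<Suc (i + j)} \<tau>"
    by (auto simp: shuffle_perms_def)
  have c: "insert_cycle i permutes {..<Suc (i + j)}" by (rule permutes_insert_cycle) simp
  let ?\<rho> = "\<tau> \<circ> inv (insert_cycle i)"
  have "?\<rho> permutes {..<Suc (i + j)}" by (intro permutes_compose permutes_inv c \<tau>(1))
  moreover have inv0: "inv (insert_cycle i) 0 = i"
    using permutes_inv_eq[OF c, of 0 i] by (simp add: insert_cycle_apply)
  then have "?\<rho> 0 = 0" using \<tau>(2) by simp
  ultimately obtain \<sigma> where \<sigma>: "\<sigma> permutes {..<i + j}" "?\<rho> = lift_perm \<sigma>" using lift_perm_surj by blast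
  have eq: "\<tau> = lift_perm \<sigma> \<circ> insert_cycle i"
    unfolding \<sigma>(2)[symmetric] comp_assoc using permutes_inv_o(2)[OF c] by simp
  have "strict_mono_on {..<i} \<sigma>"
  proof (rule strict_mono_onI)
    fix a b assume "a \<in> {..<i}" "b \<in> {..<i}" "a < b"
    then show "\<sigma> a < \<sigma> b" using strict_mono_onD[OF \<tau>(3), of a b] eq by (simp add: insert_cycle_apply)
  qed
  moreover have "strict_mono_on {i..<i + j} \<sigma>"
  proof (rule strict_mono_onI)
    fix a b assume "a \<in> {i..<i + j}" "b \<in> {i..<i + j}" "a < b"
    then show "\<sigma> a < \<sigma> b"
      using strict_mono_onD[OF \<tau>(4), of "Suc a" "Suc b"] eq by (simp add: insert_cycle_apply)
  qed
  ultimately show "\<tau> \<in> (\<lambda>\<sigma>. lift_perm \<sigma> \<circ> insert_cycle i) ` shuffle_perms i j"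
    using \<sigma>(1) eq by (auto simp: shuffle_perms_def)
next
  fix \<tau> assume "\<tau> \<in> (\<lambda>\<sigma>. lift_perm \<sigma> \<circ> insert_cycle i) ` shuffle_perms i j"
  then obtain \<sigma> where \<sigma>: "\<sigma> permutes {..<i + j}" "strict_mono_on {..<i} \<sigma>"
      "strict_mono_on {i..<i + j} \<sigma>" "\<tau> = lift_perm \<sigma> \<circ> insert_cycle i"
    by (auto simp: shuffle_perms_def)
  have "strict_mono_on {..<i} \<tau>"
  proof (rule strict_mono_onI)
    fix a b assume "a \<in> {..<i}" "b \<in> {..<i}" "a < b"
    then show "\<tau> a < \<tau> b"
      using strict_mono_onD[OF \<sigma>(2), of a b] \<sigma>(4) by (simp add: insert_cycle_apply)
  qed
  moreover have "strict_mono_on {i..<i + Suc j} \<tau>"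
  proof (rule strict_mono_onI)
    fix a b assume "a \<in> {i..<i + Suc j}" "b \<in> {i..<i + Suc j}" "a < b"
    then show "\<tau> a < \<tau> b"
      using strict_mono_onD[OF \<sigma>(3), of "a - 1" "b - 1"] \<sigma>(4)
      by (cases a; cases b) (auto simp: insert_cycle_apply)
  qed
  moreover have "\<tau> permutes {..<i + Suc j}"
    unfolding \<sigma>(4) using permutes_lift_perm[OF \<sigma>(1)] permutes_insert_cycle[of i "i + Suc j"]
    by (intro permutes_compose) simp_all
  ultimately show "\<tau> \<in> {\<sigma> \<in> shuffle_perms i (Suc j). \<sigma> i = 0}"
    using \<sigma>(4) by (simp add: shuffle_perms_def insert_cycle_apply)
qed

section \<open>Sums over shuffles and agreement of the two compositions\<close>

definition shuffle_sum ::
    "('k::field \<Rightarrow> 'w::ab_group_add \<Rightarrow> 'w) \<Rightarrow> nat \<Rightarrow> nat \<Rightarrow> ('b list \<Rightarrow> 'b list \<Rightarrow> 'w) \<Rightarrow> 'b list \<Rightarrow> 'w" where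
  "shuffle_sum s i j G Xs = (\<Sum>\<sigma>\<in>shuffle_perms i j. s (of_int (sign \<sigma>))
     (G (map (\<lambda>a. Xs ! \<sigma> a) [0..<i]) (map (\<lambda>a. Xs ! \<sigma> a) [i..<i + j])))"

lemma inj_lift_perm: "inj lift_perm"
  by (intro injI ext) (metis Suc_inject lift_perm_simps(2))

lemma map_Suc_upt_shift: "map f [Suc i..<Suc j] = map (\<lambda>a. f (Suc a)) [i..<j]"
  by (simp add: map_Suc_upt[symmetric] del: upt_Suc)

context vector_space
begin

lemma scale_neg_one_power: "scale ((-1) ^ q) v = sgnp q v"
  by (cases "even q") (simp_all add: sgnp_def)

lemma shuffle_sum_0_0: "shuffle_sum scale 0 0 G Xs = G [] []"
proof -
  have "shuffle_perms 0 0 = {id}" by (auto simp: shuffle_perms_def strict_mono_on_def permutes_id)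
  then show ?thesis by (simp add: shuffle_sum_def sign_id)
qed

text \<open>\<open>X\<close> heads either the first or the second group. In the second case the
  shuffle contains the cycle through the \<open>i\<close> positions of the first group, whose sign
  is the factor \<open>sgnp i\<close>.\<close>

lemma shuffle_sum_Cons:
  assumes "0 < i + j"
  shows "shuffle_sum scale i j G (X # Xs) =
    (if i = 0 then 0 else shuffle_sum scale (i - 1) j (\<lambda>A B. G (X # A) B) Xs) +
    (if j = 0 then 0 else sgnp i (shuffle_sum scale i (j - 1) (\<lambda>A B. G A (X # B)) Xs))"
proof -
  let ?t = "\<lambda>\<sigma>. scale (of_int (sign \<sigma>)) (G (map (\<lambda>a. (X # Xs) ! \<sigma> a) [0..<i])
     (map (\<lambda>a. (X # Xs) ! \<sigma> a) [i..<i + j]))"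
  let ?A = "{\<sigma> \<in> shuffle_perms i j. 0 < i \<and> \<sigma> 0 = 0}" and ?B = "{\<sigma> \<in> shuffle_perms i j. 0 < j \<and> \<sigma> i = 0}"
  have "\<sigma> 0 \<noteq> \<sigma> i" if "\<sigma> \<in> shuffle_perms i j" "0 < i" for \<sigma>
  proof -
    have "inj \<sigma>" using that permutes_inj by (auto simp: shuffle_perms_def)
    then show ?thesis using that(2) by (metis injD less_irrefl)
  qed
  then have disj: "?A \<inter> ?B = {}" by (intro equals0I) (metis (mono_tags, lifting) IntE mem_Collect_eq)
  have "sum ?t (shuffle_perms i j) = sum ?t (?A \<union> ?B)"
    by (rule arg_cong[where f = "sum ?t"]) (use shuffle_perms_head[OF _ assms] in blast)
  also have "\<dots> = sum ?t ?A + sum ?t ?B"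
    by (intro sum.union_disjoint disj) (simp_all add: finite_shuffle_perms)
  finally have "shuffle_sum scale i j G (X # Xs) = sum ?t ?A + sum ?t ?B"
    by (simp add: shuffle_sum_def)
  also have "sum ?t ?A = (if i = 0 then 0 else shuffle_sum scale (i - 1) j (\<lambda>A B. G (X # A) B) Xs)"
  proof (cases i)
    case (Suc k)
    have "sum ?t ?A = sum ?t (lift_perm ` shuffle_perms k j)"
      unfolding shuffle_perms_first[symmetric] using Suc by (intro sum.cong) auto
    also have "\<dots> = (\<Sum>\<sigma>\<in>shuffle_perms k j. ?t (lift_perm \<sigma>))"
      by (subst sum.reindex) (auto intro: inj_on_subset[OF inj_lift_perm])
    also have "\<dots> = shuffle_sum scale k j (\<lambda>A B. G (X # A) B) Xs"
      unfolding shuffle_sum_def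
    proof (intro sum.cong refl)
      fix \<sigma> assume \<sigma>: "\<sigma> \<in> shuffle_perms k j"
      have 1: "map (\<lambda>a. (X # Xs) ! lift_perm \<sigma> a) [0..<i] = X # map (\<lambda>a. Xs ! \<sigma> a) [0..<k]"
        unfolding Suc upt_conv_Cons[OF zero_less_Suc] by (simp add: map_Suc_upt_shift del: upt_Suc)
      have 2: "map (\<lambda>a. (X # Xs) ! lift_perm \<sigma> a) [i..<i + j] = map (\<lambda>a. Xs ! \<sigma> a) [k..<k + j]"
        unfolding Suc add_Suc by (simp add: map_Suc_upt_shift del: upt_Suc)
      have 3: "sign (lift_perm \<sigma>) = sign \<sigma>" using \<sigma> by (intro sign_lift_perm[of _ "k + j"]) (simp add: shuffle_perms_def)
      show "?t (lift_perm \<sigma>) = scale (of_int (sign \<sigma>))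
          (G (X # map (\<lambda>a. Xs ! \<sigma> a) [0..<k]) (map (\<lambda>a. Xs ! \<sigma> a) [k..<k + j]))"
        unfolding 1 2 3 ..
    qed
    finally show ?thesis using Suc by simp
  qed simp
  also have "sum ?t ?B = (if j = 0 then 0 else sgnp i (shuffle_sum scale i (j - 1) (\<lambda>A B. G A (X # B)) Xs))"
  proof (cases j)
    case (Suc k)
    have inj: "inj_on (\<lambda>\<sigma>. lift_perm \<sigma> \<circ> insert_cycle i) (shuffle_perms i k)"
    proof (rule inj_onI)
      fix \<sigma> \<tau> assume eq: "lift_perm \<sigma> \<circ> insert_cycle i = lift_perm \<tau> \<circ> insert_cycle i"
      have "surj (insert_cycle i)" using permutes_insert_cycle[of i "Suc i"] permutes_surj by blast
      have "lift_perm \<sigma> = lift_perm \<tau>"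
      proof
        fix a
        obtain b where "a = insert_cycle i b" using \<open>surj (insert_cycle i)\<close> by (rule surjE)
        then show "lift_perm \<sigma> a = lift_perm \<tau> a" using fun_cong[OF eq, of b] by simp
      qed
      then show "\<sigma> = \<tau>" using inj_lift_perm by (auto dest: injD)
    qed
    have "sum ?t ?B = sum ?t ((\<lambda>\<sigma>. lift_perm \<sigma> \<circ> insert_cycle i) ` shuffle_perms i k)"
      unfolding shuffle_perms_second[symmetric] using Suc by (intro sum.cong) auto
    also have "\<dots> = (\<Sum>\<sigma>\<in>shuffle_perms i k. ?t (lift_perm \<sigma> \<circ> insert_cycle i))"
      by (subst sum.reindex[OF inj]) simp
    also have "\<dots> = (\<Sum>\<sigma>\<in>shuffle_perms i k. sgnp i (scale (of_int (sign \<sigma>))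
        (G (map (\<lambda>a. Xs ! \<sigma> a) [0..<i]) (X # map (\<lambda>a. Xs ! \<sigma> a) [i..<i + k]))))"
    proof (intro sum.cong refl)
      fix \<sigma> assume \<sigma>: "\<sigma> \<in> shuffle_perms i k"
      have 1: "map (\<lambda>a. (X # Xs) ! (lift_perm \<sigma> \<circ> insert_cycle i) a) [0..<i] = map (\<lambda>a. Xs ! \<sigma> a) [0..<i]"
        by (simp add: insert_cycle_apply)
      have "map (\<lambda>a. (X # Xs) ! (lift_perm \<sigma> \<circ> insert_cycle i) a) [i..<Suc (i + k)] =
          X # map (\<lambda>a. (X # Xs) ! (lift_perm \<sigma> \<circ> insert_cycle i) a) [Suc i..<Suc (i + k)]"
        by (subst upt_conv_Cons) (simp_all add: insert_cycle_apply del: upt_Suc)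
      also have "\<dots> = X # map (\<lambda>a. Xs ! \<sigma> a) [i..<i + k]"
        unfolding map_Suc_upt_shift by (simp add: insert_cycle_apply)
      finally have 2: "map (\<lambda>a. (X # Xs) ! (lift_perm \<sigma> \<circ> insert_cycle i) a) [i..<i + j] =
          X # map (\<lambda>a. Xs ! \<sigma> a) [i..<i + k]"
        using Suc by simp
      have p: "\<sigma> permutes {..<i + k}" using \<sigma> by (simp add: shuffle_perms_def)
      have "permutation (lift_perm \<sigma>)" "permutation (insert_cycle i)"
        using permutes_lift_perm[OF p] permutes_insert_cycle[of i "Suc i"] permutation_permutes finite_lessThan by blast+
      then have 3: "sign (lift_perm \<sigma> \<circ> insert_cycle i) = sign \<sigma> * (-1) ^ i"
        by (simp add: sign_compose sign_lift_perm[OF p] sign_insert_cycle)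
      show "?t (lift_perm \<sigma> \<circ> insert_cycle i) = sgnp i (scale (of_int (sign \<sigma>))
          (G (map (\<lambda>a. Xs ! \<sigma> a) [0..<i]) (X # map (\<lambda>a. Xs ! \<sigma> a) [i..<i + k])))"
        unfolding 1 2 3 by (cases "even i") (simp_all add: sgnp_def)
    qed
    finally show ?thesis using Suc by (simp add: shuffle_sum_def sgnp_sum)
  qed simp
  finally show ?thesis .
qed

text \<open>The two parts of the formula differ only in how they use the two groups of arguments, so
  \<open>shuffle_sum_Cons\<close> serves for both.\<close>

lemma circ_shuffle_sum:
  "circ (Suc m) scale p q P Q Xs x =
    (\<Sum>k<p. sgnp (k * q) (shuffle_sum scale k q (\<lambda>A B. \<Sum>i<m.
      P (A @ [(Xs ! (k + q))[i := Q B (Xs ! (k + q) ! i)]] @ drop (k + q + 1) Xs) x) Xs)) +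
    sgnp (p * q) (shuffle_sum scale p q (\<lambda>A B. P A (Q B x)) Xs)"
  unfolding circ_def shuffle_sum_def scale_scale[symmetric] scale_sum_right[symmetric]
    scale_neg_one_power sgnp_sum by simp

text \<open>For \<open>k = 0\<close> and \<open>q = 0\<close> no argument is shuffled and
  \<open>Q\<close> is inserted into the first block itself, which gives \<open>slot_deriv\<close>.
  In every other term the first block goes to \<open>P\<close> or to \<open>Q\<close>.\<close>

lemma circ_Cons:
  assumes "0 < p + q"
  shows "circ (Suc m) scale p q P Q (X # Xs) x =
    (if p = 0 then 0 else sgnp q (circ (Suc m) scale (p - 1) q (contract X P) Q Xs x)) +
    (if q = 0 then slot_deriv m X Q P Xs x else circ (Suc m) scale p (q - 1) P (contract X Q) Xs x)"
proof -
  define f where "f = (\<lambda>k q (P :: 'b cochain) (Q :: 'b cochain) Xs. sgnp (k * q) (shuffle_sum scale k q (\<lambda>A B. \<Sum>i<m.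
      P (A @ [(Xs ! (k + q))[i := Q B (Xs ! (k + q) ! i)]] @ drop (k + q + 1) Xs) x) Xs))"
  define h where "h = (\<lambda>p q (P :: 'b cochain) (Q :: 'b cochain) Xs. sgnp (p * q) (shuffle_sum scale p q (\<lambda>A B. P A (Q B x)) Xs))"
  have circ: "circ (Suc m) scale p q P Q Xs x = (\<Sum>k<p. f k q P Q Xs) + h p q P Q Xs"
    for p q P Q Xs
    unfolding f_def h_def by (rule circ_shuffle_sum)
  \<comment> \<open>Giving a block to \<open>P\<close> lowers \<open>k\<close>, and
    \<open>(-1)^(kq)\<close> splits off \<open>(-1)^q\<close>. Giving it to \<open>Q\<close> lowers
    \<open>q\<close>, and the sign \<open>(-1)^k\<close> of the cycle turns \<open>(-1)^(kq)\<close>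
    into \<open>(-1)^(k(q-1))\<close>.\<close>
  have par1: "sgnp (k * q) v = sgnp q (sgnp ((k - 1) * q) v)" if "0 < k" for k v
    using that by (cases k) (auto simp: sgnp_def)
  have par2: "sgnp (k * q) (sgnp k v) = sgnp (k * (q - 1)) v" if "0 < q" for k v
    using that by (cases q) (auto simp: sgnp_def)
  have fC: "f k q P Q (X # Xs) = (if k = 0 then 0 else sgnp q (f (k - 1) q (contract X P) Q Xs)) +
      (if q = 0 then (if k = 0 then slot_deriv m X Q P Xs x else 0) else f k (q - 1) P (contract X Q) Xs)"
    for k
  proof (cases "k + q = 0")
    case True
    then show ?thesis by (simp add: f_def sgnp_def shuffle_sum_0_0 slot_deriv_def)
  next
    case False
    let ?G = "\<lambda>A B. \<Sum>i<m. P (A @ [(Xs ! (k + q - 1))[i := Q B (Xs ! (k + q - 1) ! i)]] @ drop (k + q) Xs) x"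
    have "f k q P Q (X # Xs) = sgnp (k * q) (shuffle_sum scale k q ?G (X # Xs))"
    proof -
      obtain r where "k + q = Suc r" using False by (cases "k + q") auto
      then show ?thesis by (simp add: f_def)
    qed
    also have "\<dots> = (if k = 0 then 0 else sgnp (k * q) (shuffle_sum scale (k - 1) q (\<lambda>A B. ?G (X # A) B) Xs)) +
      (if q = 0 then 0 else sgnp (k * q) (sgnp k (shuffle_sum scale k (q - 1) (\<lambda>A B. ?G A (X # B)) Xs)))"
      using False by (subst shuffle_sum_Cons) (simp_all add: sgnp_simps)
    also have "(if k = 0 then 0 else sgnp (k * q) (shuffle_sum scale (k - 1) q (\<lambda>A B. ?G (X # A) B) Xs)) =
      (if k = 0 then 0 else sgnp q (f (k - 1) q (contract X P) Q Xs))"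
      using par1[of k] by (cases k) (simp_all add: f_def contract_def)
    also have "(if q = 0 then 0 else sgnp (k * q) (sgnp k (shuffle_sum scale k (q - 1) (\<lambda>A B. ?G A (X # B)) Xs))) =
      (if q = 0 then 0 else f k (q - 1) P (contract X Q) Xs)"
      using par2[of k] by (cases q) (simp_all add: f_def contract_def)
    finally show ?thesis using False by (cases "q = 0") simp_all
  qed
  have hC: "h p q P Q (X # Xs) = (if p = 0 then 0 else sgnp q (h (p - 1) q (contract X P) Q Xs)) +
      (if q = 0 then 0 else h p (q - 1) P (contract X Q) Xs)"
  proof -
    have "h p q P Q (X # Xs) =
      (if p = 0 then 0 else sgnp (p * q) (shuffle_sum scale (p - 1) q (\<lambda>A B. P (X # A) (Q B x)) Xs)) +
      (if q = 0 then 0 else sgnp (p * q) (sgnp p (shuffle_sum scale p (q - 1) (\<lambda>A B. P A (Q (X # B) x)) Xs)))"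
      unfolding h_def using assms by (subst shuffle_sum_Cons) (simp_all add: sgnp_simps)
    then show ?thesis
      by (cases p; cases q) (auto simp: h_def contract_def sgnp_def)
  qed
  have "(\<Sum>k<p. f k q P Q (X # Xs)) =
      (\<Sum>k<p. if k = 0 then 0 else sgnp q (f (k - 1) q (contract X P) Q Xs)) +
      (\<Sum>k<p. if q = 0 then (if k = 0 then slot_deriv m X Q P Xs x else 0) else f k (q - 1) P (contract X Q) Xs)"
    by (simp only: fC sum.distrib)
  also have "(\<Sum>k<p. if k = 0 then 0 else sgnp q (f (k - 1) q (contract X P) Q Xs)) =
      (if p = 0 then 0 else sgnp q (\<Sum>k<p - 1. f k q (contract X P) Q Xs))"
    by (cases p) (simp_all add: sum.lessThan_Suc_shift sgnp_sum del: sum.lessThan_Suc)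
  also have "(\<Sum>k<p. if q = 0 then (if k = 0 then slot_deriv m X Q P Xs x else 0) else f k (q - 1) P (contract X Q) Xs) =
      (if q = 0 then slot_deriv m X Q P Xs x else (\<Sum>k<p. f k (q - 1) P (contract X Q) Xs))"
    using assms by (cases "q = 0") simp_all
  finally show ?thesis
    unfolding circ hC using assms by (auto simp: sgnp_simps)
qed

text \<open>The recursion of \<open>circ\<close> stops contracting \<open>P\<close> at
  \<open>p = 0\<close>, that of \<open>rec_circ\<close> does not. Homogeneity closes the gap, since
  a cochain of degree 0 has zero contractions.\<close>

theorem circ_eq_rec_circ:
  assumes "multilin m scale P" "homog p P" "length Xs = p + q"
  shows "circ (Suc m) scale p q P Q Xs x = rec_circ m q P Q Xs x"
  using assms
proof (induction Xs arbitrary: P Q p q)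
  case Nil
  then show ?case by (simp add: circ_shuffle_sum shuffle_sum_0_0 rec_circ_Nil sgnp_def)
next
  case (Cons X Xs)
  have pq: "0 < p + q" using Cons.prems(3) by (cases p) auto
  have 1: "(if p = 0 then 0 else sgnp q (circ (Suc m) scale (p - 1) q (contract X P) Q Xs x)) =
      sgnp q (rec_circ m q (contract X P) Q Xs x)"
  proof (cases p)
    case 0
    then show ?thesis using Cons.prems by (simp add: contract_homog_0 cochain_apply sgnp_simps)
  next
    case (Suc k)
    have "circ (Suc m) scale k q (contract X P) Q Xs x = rec_circ m q (contract X P) Q Xs x"
      by (intro Cons.IH multilin_contract homog_contract) (use Cons.prems Suc in auto)
    then show ?thesis using Suc by simp
  qed
  have 2: "circ (Suc m) scale p (q - 1) P (contract X Q) Xs x = rec_circ m (q - 1) P (contract X Q) Xs x"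
    if "q \<noteq> 0"
    by (intro Cons.IH) (use Cons.prems that in auto)
  show ?case unfolding circ_Cons[OF pq] rec_circ_Cons 1 using 2 by simp
qed

end

section \<open>Bidegree\<close>

text \<open>Recovers the blocks from their concatenation; entries after the last block are
  dropped.\<close>

primrec chunks :: "nat \<Rightarrow> nat \<Rightarrow> 'a list \<Rightarrow> 'a list list" where
  "chunks m 0 ws = []"
| "chunks m (Suc p) ws = take m ws # chunks m p (drop m ws)"

lemma chunks_concat:
  assumes "Xs \<in> wedge_args (Suc m) p"
  shows "chunks m p (concat Xs @ ys) = Xs"
  using assms
proof (induction p arbitrary: Xs)
  case (Suc p)
  then obtain X Ys where "Xs = X # Ys" "length X = m" "Ys \<in> wedge_args (Suc m) p"
    by (cases Xs) (auto simp: wedge_args_def)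
  then show ?case using Suc.IH by simp
qed (simp add: wedge_args_def)

lemma length_concat_wedge_args: "Xs \<in> wedge_args (Suc m) p \<Longrightarrow> length (concat Xs) = p * m"
proof (induction p arbitrary: Xs)
  case (Suc p)
  then obtain X Ys where "Xs = X # Ys" "length X = m" "Ys \<in> wedge_args (Suc m) p"
    by (cases Xs) (auto simp: wedge_args_def)
  then show ?case using Suc.IH by simp
qed (simp add: wedge_args_def)

lemma chunks_wedge_args: "length ws = p * m + 1 \<Longrightarrow> chunks m p ws \<in> wedge_args (Suc m) p"
proof (induction p arbitrary: ws)
  case (Suc p)
  then have "chunks m p (drop m ws) \<in> wedge_args (Suc m) p" by (intro Suc.IH) simp
  then show ?case using Suc.prems by (simp add: wedge_args_def)
qed (simp add: wedge_args_def)

lemma concat_chunks: "length ws = p * m + 1 \<Longrightarrow> concat (chunks m p ws) @ [last ws] = ws"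
proof (induction p arbitrary: ws)
  case 0
  then show ?case by (cases ws) auto
next
  case (Suc p)
  then have "concat (chunks m p (drop m ws)) @ [last (drop m ws)] = drop m ws"
    by (intro Suc.IH) simp
  moreover have "last (drop m ws) = last ws" using Suc.prems by (intro last_drop) simp
  ultimately show ?case by (metis append.assoc append_take_drop_id chunks.simps(2) concat.simps(2))
qed

text \<open>A cochain as a function of the list of all its \<open>p * m + 1\<close> entries, the
  list on which \<open>pure_entries\<close> counts and in which all entries can be treated
  alike.\<close>

definition flat :: "nat \<Rightarrow> nat \<Rightarrow> 'w cochain \<Rightarrow> 'w list \<Rightarrow> 'w" where
  "flat m p F ws = F (chunks m p ws) (last ws)"

lemma flat_concat: "Xs \<in> wedge_args (Suc m) p \<Longrightarrow> flat m p F (concat Xs @ [x]) = F Xs x"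
  by (simp add: flat_def chunks_concat)

lemma linear_flat:
  assumes "multilin m s F" "length ws = p * m + 1" "i < p * m + 1"
  shows "Vector_Spaces.linear s s (\<lambda>y. flat m p F (ws[i := y]))"
  using assms
proof (induction p arbitrary: F ws i)
  case 0
  then obtain w where "ws = [w]" by (cases ws) auto
  then show ?case using 0 by (simp add: flat_def multilin_def)
next
  case (Suc p)
  have last: "last (ws[i := y]) = last (drop m (ws[i := y]))" for y
    using Suc.prems by (intro last_drop[symmetric]) simp
  have flat: "flat m (Suc p) F (ws[i := y]) =
      flat m p (contract (take m (ws[i := y])) F) (drop m (ws[i := y]))" for y
    unfolding flat_def contract_def last by simp
  show ?case
  proof (cases "i < m")
    case True
    have "Vector_Spaces.linear s s
        (\<lambda>y. F ([] @ (take m ws)[i := y] # chunks m p (drop m ws)) (last (drop m ws)))"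
      using Suc.prems(1) True unfolding multilin_def by blast
    then show ?thesis
      unfolding flat using True by (simp add: flat_def contract_def take_update_swap drop_update_cancel)
  next
    case False
    have "Vector_Spaces.linear s s (\<lambda>y. flat m p (contract (take m ws) F) ((drop m ws)[i - m := y]))"
      by (intro Suc.IH multilin_contract Suc.prems) (use Suc.prems False in auto)
    then show ?thesis
      unfolding flat using False by (simp add: drop_update_swap)
  qed
qed

text \<open>\<open>\<phi>\<close> is applied to the entries from left to right; each entry outside
  \<open>A\<close> contributes one factor \<open>c\<close> by linearity in its slot.\<close>

lemma slot_scaling:
  assumes s: "vector_space s"
    and G: "\<And>ws i. \<lbrakk>length ws = N; i < N\<rbrakk> \<Longrightarrow> Vector_Spaces.linear s s (\<lambda>y. G (ws[i := y]))"
    and len: "length ws = N" and A: "A \<subseteq> {..<N}"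
    and \<phi>: "\<And>i. i < N \<Longrightarrow> \<phi> (ws ! i) = (if i \<in> A then ws ! i else s c (ws ! i))"
  shows "G (map \<phi> ws) = s (c ^ (N - card A)) (G ws)"
proof -
  interpret vector_space s by fact
  have "G (map \<phi> (take k ws) @ drop k ws) = s (c ^ card ({..<k} - A)) (G ws)" if "k \<le> N" for k
    using that
  proof (induction k)
    case (Suc k)
    let ?w = "map \<phi> (take k ws) @ drop k ws"
    have k: "k < length ws" and k': "k < N" using Suc.prems len by auto
    have w: "length ?w = N" "?w ! k = ws ! k" using len k by (auto simp: nth_append)
    have upd: "?w[k := ws ! k] = ?w" using list_update_id[of ?w k] unfolding w(2) .
    have "map \<phi> (take (Suc k) ws) @ drop (Suc k) ws = ?w[k := \<phi> (ws ! k)]"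
      using k by (simp add: take_Suc_conv_app_nth list_update_append Cons_nth_drop_Suc[OF k, symmetric])
    moreover have "G (?w[k := \<phi> (ws ! k)]) = (if k \<in> A then G ?w else s c (G ?w))"
    proof (cases "k \<in> A")
      case True
      then have e: "\<phi> (ws ! k) = ws ! k" using \<phi>[OF k'] by simp
      show ?thesis unfolding e upd using True by simp
    next
      case False
      interpret L: Vector_Spaces.linear s s "\<lambda>y. G (?w[k := y])" by (rule G[OF w(1) k'])
      have "G (?w[k := s c (ws ! k)]) = s c (G (?w[k := ws ! k]))" by (rule L.scale)
      then have "G (?w[k := s c (ws ! k)]) = s c (G ?w)" unfolding upd .
      then show ?thesis using False \<phi>[OF k'] by simp
    qed
    moreover have "card ({..<Suc k} - A) = (if k \<in> A then 0 else 1) + card ({..<k} - A)"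
      by (simp add: lessThan_Suc insert_Diff_if)
    ultimately show ?case using Suc by simp
  qed simp
  from this[of N] show ?thesis
    using len A by (simp add: card_Diff_subset finite_subset)
qed

definition pure_vector :: "'g::zero \<times> 'v::zero \<Rightarrow> bool" where
  "pure_vector w \<longleftrightarrow> fst w = 0 \<or> snd w = 0"

text \<open>Each entry is the sum of its two components. The induction variable \<open>k\<close>
  bounds the positions that may still be mixed, and splitting the last of them lowers it.\<close>

lemma additive_eq_on_pure:
  fixes G H :: "('g::ab_group_add \<times> 'v::ab_group_add) list \<Rightarrow> 'b::ab_group_add"
  assumes G: "\<And>ws i x y. \<lbrakk>length ws = N; i < N\<rbrakk> \<Longrightarrow> G (ws[i := x + y]) = G (ws[i := x]) + G (ws[i := y])"
    and H: "\<And>ws i x y. \<lbrakk>length ws = N; i < N\<rbrakk> \<Longrightarrow> H (ws[i := x + y]) = H (ws[i := x]) + H (ws[i := y])"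
    and eq: "\<And>ws. \<lbrakk>length ws = N; \<And>w. w \<in> set ws \<Longrightarrow> pure_vector w\<rbrakk> \<Longrightarrow> G ws = H ws"
    and len: "length ws = N"
  shows "G ws = H ws"
proof -
  have "\<lbrakk>length ws = N; \<And>i. \<lbrakk>k \<le> i; i < N\<rbrakk> \<Longrightarrow> pure_vector (ws ! i)\<rbrakk> \<Longrightarrow> G ws = H ws" if "k \<le> N" for k ws
    using that
  proof (induction k arbitrary: ws)
    case 0
    show ?case
    proof (rule eq)
      fix w assume "w \<in> set ws"
      then obtain i where "i < length ws" "w = ws ! i" by (auto simp: in_set_conv_nth)
      then show "pure_vector w" using "0.prems" by simp
    qed (use "0.prems" in simp)
  next
    case (Suc k)
    let ?a = "(fst (ws ! k), 0)" and ?b = "(0, snd (ws ! k))"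
    have k: "k < N" using Suc.prems by simp
    have "G (ws[k := u]) = H (ws[k := u])" if "pure_vector u" for u
    proof (intro Suc.IH)
      show "pure_vector (ws[k := u] ! i)" if "k \<le> i" "i < N" for i
        using that \<open>pure_vector u\<close> Suc.prems by (cases "i = k") auto
    qed (use Suc.prems in auto)
    then have "G (ws[k := ?a]) = H (ws[k := ?a])" "G (ws[k := ?b]) = H (ws[k := ?b])"
      by (simp_all add: pure_vector_def)
    moreover have "ws = ws[k := ?a + ?b]" by simp
    ultimately show ?case using G[OF Suc.prems(1) k, of ?a ?b] H[OF Suc.prems(1) k, of ?a ?b] by simp
  qed
  from this[of N ws] show ?thesis using len by simp
qed

definition dbl :: "('k::field \<Rightarrow> 'v \<Rightarrow> 'v) \<Rightarrow> 'g \<times> 'v \<Rightarrow> 'g \<times> 'v" where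
  "dbl sv w = (fst w, sv 2 (snd w))"

lemma two_power_neq:
  assumes "i \<noteq> j"
  shows "(2::'k::field_char_0) ^ i \<noteq> 2 ^ j"
proof -
  have "of_nat (2 ^ i) \<noteq> (of_nat (2 ^ j) :: 'k)"
    unfolding of_nat_eq_iff using assms by simp
  then show ?thesis by simp
qed

text \<open>Bidegree \<open>pm|0\<close> means that \<open>f\<close> commutes with scaling \<open>V\<close>; over a field of characteristic 0 a
  single factor suffices, since its powers are distinct.\<close>

lemma bideg_cochains_iff:
  fixes sg :: "'k::field_char_0 \<Rightarrow> 'g::ab_group_add \<Rightarrow> 'g"
    and sv :: "'k \<Rightarrow> 'v::ab_group_add \<Rightarrow> 'v"
  assumes "vector_space sg" "vector_space sv"
  shows "f \<in> bideg_cochains (Suc m) sg sv p (p * m) 0 \<longleftrightarrow>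
    f \<in> cochains (Suc m) (module_prod.scale sg sv) p \<and> intertwines (dbl sv) f f"
proof -
  interpret g: vector_space sg by fact
  interpret v: vector_space sv by fact
  interpret pr: vector_space_prod sg sv by unfold_locales
  let ?s = "module_prod.scale sg sv" and ?N = "p * m + 1"
  have vs: "vector_space ?s" by unfold_locales
  have scale: "?s c w = (sg c (fst w), sv c (snd w))" for c w by (rule pr.scale_def)
  have dbl_add: "dbl sv (x + y) = dbl sv x + dbl sv y" for x y :: "'g \<times> 'v"
    by (simp add: dbl_def v.scale_right_distrib)
  have scaled: "flat m p f (map (dbl sv) ws) = ?s (2 ^ (?N - card A)) (flat m p f ws)"
    if "multilin m ?s f" "length ws = ?N" "A \<subseteq> {..<?N}"
      "\<And>i. i < ?N \<Longrightarrow> if i \<in> A then snd (ws ! i) = 0 else fst (ws ! i) = 0" for ws A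
  proof (rule slot_scaling[OF vs linear_flat[OF that(1)] that(2,3)])
    fix i assume "i < ?N"
    then show "dbl sv (ws ! i) = (if i \<in> A then ws ! i else ?s 2 (ws ! i))"
      using that(4)[of i] by (auto simp: dbl_def scale prod_eq_iff)
  qed
  show ?thesis
  proof
    assume f: "f \<in> bideg_cochains (Suc m) sg sv p (p * m) 0"
    then have fc: "f \<in> cochains (Suc m) ?s p" by (simp add: bideg_cochains_def)
    then have ml: "multilin m ?s f" and bl: "block_alt m f" and hom: "homog p f"
      using cochains_iff[OF vs] by auto
    have add: "flat m p f (ws[i := x + y]) = flat m p f (ws[i := x]) + flat m p f (ws[i := y])"
      if "length ws = ?N" "i < ?N" for ws i x y
      using linear_additive(1)[OF linear_flat[OF ml that], of x y] .
    have "flat m p f (map (dbl sv) ws) = dbl sv (flat m p f ws)" if "length ws = ?N" for ws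
    proof (rule additive_eq_on_pure[OF _ _ _ that])
      fix ws :: "('g \<times> 'v) list" and i x y assume "length ws = ?N" "i < ?N"
      then show "flat m p f (map (dbl sv) (ws[i := x + y])) =
          flat m p f (map (dbl sv) (ws[i := x])) + flat m p f (map (dbl sv) (ws[i := y]))"
        "dbl sv (flat m p f (ws[i := x + y])) =
          dbl sv (flat m p f (ws[i := x])) + dbl sv (flat m p f (ws[i := y]))"
        using add[of "map (dbl sv) ws" i "dbl sv x" "dbl sv y"] add[of ws i x y]
        by (simp_all add: map_update dbl_add)
    next
      fix ws :: "('g \<times> 'v) list"
      assume len: "length ws = ?N" and pure: "\<And>w. w \<in> set ws \<Longrightarrow> pure_vector w"
      \<comment> \<open>A zero entry could be assigned to either summand; it is counted in the
        first, so that \<open>A\<close> is a legitimate designation.\<close>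
      define A where "A = {i. i < ?N \<and> snd (ws ! i) = 0}"
      have AN: "A \<subseteq> {..<?N}" by (auto simp: A_def)
      then have card: "card A \<le> ?N" using card_mono[OF finite_lessThan AN] by simp
      have A: "if i \<in> A then snd (ws ! i) = 0 else fst (ws ! i) = 0" if "i < ?N" for i
        using pure[of "ws ! i"] that len by (auto simp: A_def pure_vector_def)
      have cN: "card A + (?N - card A) = ?N" using card by simp
      have pe: "pure_entries (card A) (?N - card A) (chunks m p ws) (last ws)"
        unfolding pure_entries_def Let_def concat_chunks[OF len] cN
        by (intro conjI exI[of _ A] len AN refl allI impI A)
      have "\<forall>x i j. pure_entries i j (chunks m p ws) x \<longrightarrow>
        (if (i, j) = (p * m + 1, 0) then snd (f (chunks m p ws) x) = 0
         else if (i, j) = (p * m, 0 + 1) then fst (f (chunks m p ws) x) = 0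
         else f (chunks m p ws) x = 0)"
        using f chunks_wedge_args[OF len] unfolding bideg_cochains_def mem_Collect_eq
        by (elim conjE) (rule bspec)
      from this[THEN spec, THEN spec, THEN spec, THEN mp, OF pe]
      have h: "if (card A, ?N - card A) = (p * m + 1, 0) then snd (flat m p f ws) = 0
         else if (card A, ?N - card A) = (p * m, 0 + 1) then fst (flat m p f ws) = 0
         else flat m p f ws = 0"
        unfolding flat_def .
      define j where "j = ?N - card A"
      have eq: "flat m p f (map (dbl sv) ws) = ?s (2 ^ j) (flat m p f ws)"
        unfolding j_def by (rule scaled[OF ml len AN A])
      \<comment> \<open>\<open>j\<close> is the number of entries from \<open>V\<close>. The value
        lies in \<open>\<gg>\<close> for \<open>j = 0\<close>, in \<open>V\<close> for
        \<open>j = 1\<close>, and is 0 otherwise; in each case scaling it by \<open>2 ^ j\<close> is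
        \<open>dbl sv\<close>.\<close>
      consider "j = 0" "card A = ?N" | "j = 1" "card A = p * m" | "2 \<le> j"
        using card unfolding j_def by linarith
      then have "?s (2 ^ j) (flat m p f ws) = dbl sv (flat m p f ws)"
      proof cases
        case 1
        with h have "snd (flat m p f ws) = 0" by simp
        with 1 show ?thesis by (simp add: dbl_def scale prod_eq_iff)
      next
        case 2
        with h have "fst (flat m p f ws) = 0" by simp
        with 2 show ?thesis by (simp add: dbl_def scale prod_eq_iff)
      next
        case 3
        with h have "flat m p f ws = 0" unfolding j_def by auto
        then show ?thesis by (simp add: dbl_def scale prod_eq_iff)
      qed
      with eq show "flat m p f (map (dbl sv) ws) = dbl sv (flat m p f ws)" by (rule trans)
    qed
    note flat_eq = this
    have "f (map (map (dbl sv)) Xs) (dbl sv x) = dbl sv (f Xs x)" for Xs x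
    proof (cases "Xs \<in> wedge_args (Suc m) p")
      case True
      then have "map (map (dbl sv)) Xs \<in> wedge_args (Suc m) p" by (auto simp: wedge_args_def)
      from flat_concat[OF this, of f "dbl sv x"] flat_concat[OF True, of f x]
        flat_eq[of "concat Xs @ [x]"] length_concat_wedge_args[OF True]
      show ?thesis by (simp add: map_concat)
    next
      case False
      then have "map (map (dbl sv)) Xs \<notin> wedge_args (Suc m) p" by (auto simp: wedge_args_def)
      moreover have "\<forall>Xs x. Xs \<notin> wedge_args (Suc m) p \<longrightarrow> f Xs x = 0"
        using fc unfolding cochains_def mem_Collect_eq by (rule conjunct1)
      ultimately have "f (map (map (dbl sv)) Xs) (dbl sv x) = 0" "f Xs x = 0"
        using False by blast+
      then show ?thesis by (simp add: dbl_def zero_prod_def)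
    qed
    then show "f \<in> cochains (Suc m) ?s p \<and> intertwines (dbl sv) f f"
      using fc by (simp add: intertwines_def)
  next
    assume *: "f \<in> cochains (Suc m) ?s p \<and> intertwines (dbl sv) f f"
    then have ml: "multilin m ?s f" using cochains_iff[OF vs] by blast
    show "f \<in> bideg_cochains (Suc m) sg sv p (p * m) 0"
      unfolding bideg_cochains_def mem_Collect_eq
    proof (intro conjI ballI allI impI)
      fix Xs :: "('g \<times> 'v) list list" and x i j assume Xs: "Xs \<in> wedge_args (Suc m) p" and pure: "pure_entries i j Xs x"
      let ?ws = "concat Xs @ [x]"
      have len: "length ?ws = ?N" using length_concat_wedge_args[OF Xs] by simp
      from pure have pe: "i + j = ?N" "\<exists>A\<subseteq>{..<i + j}. card A = i \<and>
          (\<forall>a<i + j. if a \<in> A then snd (?ws ! a) = 0 else fst (?ws ! a) = 0)"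
        unfolding pure_entries_def Let_def len by simp_all
      from pe obtain A where A: "A \<subseteq> {..<?N}" "card A = i" "i + j = ?N"
        "\<And>a. a < ?N \<Longrightarrow> if a \<in> A then snd (?ws ! a) = 0 else fst (?ws ! a) = 0"
        by (elim exE conjE) simp
      have "map (map (dbl sv)) Xs \<in> wedge_args (Suc m) p" using Xs by (auto simp: wedge_args_def)
      moreover have "?N - card A = j" using A(2,3) by linarith
      ultimately have "f (map (map (dbl sv)) Xs) (dbl sv x) = ?s (2 ^ j) (f Xs x)"
        using scaled[OF ml len A(1,4)] flat_concat[of "map (map (dbl sv)) Xs" m p f "dbl sv x"]
          flat_concat[OF Xs, of f x] by (simp add: map_concat)
      then have eq: "?s (2 ^ j) (f Xs x) = dbl sv (f Xs x)"
        using * unfolding intertwines_def by metis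
      \<comment> \<open>On the first component \<open>dbl sv\<close> multiplies by
        \<open>2 ^ 0\<close>, on the second by \<open>2 ^ 1\<close>; a component can be nonzero only
        for the matching \<open>j\<close>.\<close>
      then have "sg (2 ^ j) (fst (f Xs x)) = sg (2 ^ 0) (fst (f Xs x))"
        "sv (2 ^ j) (snd (f Xs x)) = sv (2 ^ 1) (snd (f Xs x))"
        by (simp_all add: dbl_def scale)
      then have "j \<noteq> 0 \<Longrightarrow> fst (f Xs x) = 0" "j \<noteq> 1 \<Longrightarrow> snd (f Xs x) = 0"
        using g.scale_cancel_right[of "2 ^ j" "fst (f Xs x)" "2 ^ 0"]
          v.scale_cancel_right[of "2 ^ j" "snd (f Xs x)" "2 ^ 1"]
          two_power_neq[of j 0, where 'k = 'k] two_power_neq[of j 1, where 'k = 'k] by metis+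
      then show "if (i, j) = (p * m + 1, 0) then snd (f Xs x) = 0
         else if (i, j) = (p * m, 0 + 1) then fst (f Xs x) = 0 else f Xs x = 0"
        using A(3) by (auto simp: prod_eq_iff)
    qed (use * in simp_all)
  qed
qed

lemma multilin_slot:
  assumes "multilin m s F" "j < m"
  shows "F (As @ X[j := x + y] # Bs) z = F (As @ X[j := x] # Bs) z + F (As @ X[j := y] # Bs) z"
    "F (As @ X[j := s c x] # Bs) z = s c (F (As @ X[j := x] # Bs) z)"
proof -
  interpret Vector_Spaces.linear s s "\<lambda>y. F (As @ X[j := y] # Bs) z"
    using assms by (simp add: multilin_def)
  show "F (As @ X[j := x + y] # Bs) z = F (As @ X[j := x] # Bs) z + F (As @ X[j := y] # Bs) z"
    "F (As @ X[j := s c x] # Bs) z = s c (F (As @ X[j := x] # Bs) z)"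
    by (rule add scale)+
qed

lemma homogD: "homog p P \<Longrightarrow> length Xs \<noteq> p \<Longrightarrow> P Xs x = 0"
  unfolding homog_def by blast

lemma multilin_last_scale: "multilin m s F \<Longrightarrow> F Xs (s c x) = s c (F Xs x)"
  unfolding multilin_def by (metis Vector_Spaces.linear_iff)

section \<open>Linear structure on cochains and bilinearity of the bracket\<close>

context vector_space
begin

lemma vector_space_cochain_scale: "vector_space (cochain_scale scale)"
  by unfold_locales
    (auto simp: cochain_scale_def fun_eq_iff cochain_apply scale_right_distrib scale_left_distrib)

lemma cochain_scale_neg_one_power: "cochain_scale scale ((-1) ^ k) F = sgnp k F"
proof (intro ext)
  show "cochain_scale scale ((-1) ^ k) F Xs x = sgnp k F Xs x" for Xs x
    by (simp add: cochain_scale_def scale_neg_one_power) (simp add: sgnp_def cochain_apply)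
qed

lemma multilin_add:
  assumes "multilin m scale F" "multilin m scale G"
  shows "multilin m scale (F + G)"
proof -
  have "F + G = (\<lambda>Xs x. F Xs x + G Xs x)" by (intro ext) (rule cochain_apply)
  then show ?thesis
    using assms unfolding multilin_def by (auto intro!: linear_add_fun)
qed

lemma multilin_cochain_scale:
  assumes "multilin m scale F"
  shows "multilin m scale (cochain_scale scale c F)"
proof -
  have lin: "Vector_Spaces.linear scale scale (\<lambda>x. scale c (f x))"
    if "Vector_Spaces.linear scale scale f" for f
    by (rule linear_comp_fun[OF linear_scale_self that])
  show ?thesis
    using assms unfolding multilin_def cochain_scale_def by (intro conjI allI impI lin) blast+
qed

lemma multilin_zero: "multilin m scale 0"
  unfolding multilin_def zero_fun_def by (simp add: linear_zero_fun)

lemma subspace_multilin: "module.subspace (cochain_scale scale) {F. multilin m scale F}"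
proof -
  interpret c: vector_space "cochain_scale scale" by (rule vector_space_cochain_scale)
  show ?thesis
    unfolding c.subspace_def by (simp add: multilin_zero multilin_add multilin_cochain_scale)
qed

lemma circ_left:
  "circ n scale p q (P + P') Q Xs x = circ n scale p q P Q Xs x + circ n scale p q P' Q Xs x"
  "circ n scale p q (cochain_scale scale c P) Q Xs x = scale c (circ n scale p q P Q Xs x)"
  unfolding circ_def
  by (simp_all add: cochain_apply cochain_scale_def sum.distrib scale_right_distrib scale_sum_right mult.commute)

lemma circ_right:
  assumes "multilin m scale P"
  shows "circ (Suc m) scale p q P (Q + Q') Xs x =
      circ (Suc m) scale p q P Q Xs x + circ (Suc m) scale p q P Q' Xs x"
    "circ (Suc m) scale p q P (cochain_scale scale c Q) Xs x = scale c (circ (Suc m) scale p q P Q Xs x)"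
  unfolding circ_def
  by (simp_all add: cochain_apply cochain_scale_def sum.distrib scale_right_distrib scale_sum_right
      mult.commute multilin_slot[OF assms] multilin_last(1)[OF assms] multilin_last_scale[OF assms])

text \<open>Multilinearity is required of \<open>Q\<close> because in the term
  \<open>Q \<circ> P\<close> the sum occupies a slot of \<open>Q\<close>.\<close>

lemma nlie_bracket_add_left:
  assumes "multilin m scale Q"
  shows "nlie_bracket (Suc m) scale (P + P') Q =
    nlie_bracket (Suc m) scale P Q + nlie_bracket (Suc m) scale P' Q"
  by (intro ext) (simp add: nlie_bracket_def Let_def cochain_apply circ_left(1) circ_right(1)[OF assms]
      scale_right_distrib sum_subtractf sum.distrib)

lemma nlie_bracket_add_right:
  assumes "multilin m scale P"
  shows "nlie_bracket (Suc m) scale P (Q + Q') =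
    nlie_bracket (Suc m) scale P Q + nlie_bracket (Suc m) scale P Q'"
  by (intro ext) (simp add: nlie_bracket_def Let_def cochain_apply circ_left(1) circ_right(1)[OF assms]
      scale_right_distrib sum_subtractf sum.distrib)

lemma nlie_bracket_scale_left:
  assumes "multilin m scale Q"
  shows "nlie_bracket (Suc m) scale (cochain_scale scale c P) Q =
    cochain_scale scale c (nlie_bracket (Suc m) scale P Q)"
  unfolding cochain_scale_def[of scale c "nlie_bracket (Suc m) scale P Q"]
  by (intro ext) (simp add: nlie_bracket_def Let_def circ_left(2) circ_right(2)[OF assms]
      scale_right_diff_distrib scale_sum_right mult.commute)

lemma nlie_bracket_scale_right:
  assumes "multilin m scale P"
  shows "nlie_bracket (Suc m) scale P (cochain_scale scale c Q) =
    cochain_scale scale c (nlie_bracket (Suc m) scale P Q)"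
  unfolding cochain_scale_def[of scale c "nlie_bracket (Suc m) scale P Q"]
  by (intro ext) (simp add: nlie_bracket_def Let_def circ_left(2) circ_right(2)[OF assms]
      scale_right_diff_distrib scale_sum_right mult.commute)

lemma cochainsD:
  assumes "P \<in> cochains (Suc m) scale p"
  shows "homog p P" "multilin m scale P" "block_alt m P" "last_alt P"
proof -
  show *: "homog p P" "multilin m scale P" "block_alt m P"
    using assms cochains_iff[OF vector_space_axioms] by blast+
  show "last_alt P"
  proof (cases "p = 0")
    case True
    with *(1) show ?thesis by (simp add: last_alt_def homog_def)
  qed (use assms cochains_iff[OF vector_space_axioms] in blast)
qed

text \<open>Carries the results on the recursion over to the bracket defined by shuffles: they agree
  on lists of length \<open>p + q\<close>, and both vanish on all others.\<close>

lemma nlie_bracket_eq_rec_bracket: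
  assumes P: "P \<in> cochains (Suc m) scale p" and Q: "Q \<in> cochains (Suc m) scale q"
  shows "nlie_bracket (Suc m) scale P Q = rec_bracket m p q P Q"
proof (intro ext)
  fix Xs x
  note PD = cochainsD[OF P] and QD = cochainsD[OF Q]
  note hom = homog_rec_circ[OF PD(2,1) QD(1)] homog_rec_circ[OF QD(2,1) PD(1)]
  have eq: "nlie_bracket (Suc m) scale P Q Xs x = (if length Xs = p + q
      then circ (Suc m) scale p q P Q Xs x - scale ((-1) ^ (p * q)) (circ (Suc m) scale q p Q P Xs x)
      else 0)"
    by (rule nlie_bracket_homogeneous[OF vector_space_axioms P Q])
  show "nlie_bracket (Suc m) scale P Q Xs x = rec_bracket m p q P Q Xs x"
  proof (cases "length Xs = p + q")
    case True
    then show ?thesis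
      unfolding eq scale_neg_one_power circ_eq_rec_circ[OF PD(2,1) True]
      using circ_eq_rec_circ[OF QD(2,1), of Xs p P x]
      by (simp add: rec_bracket_def add.commute) (simp add: sgnp_def cochain_apply)
  next
    case False
    then have "rec_circ m q P Q Xs x = 0" "rec_circ m p Q P Xs x = 0"
      using hom by (simp_all add: homog_def)
    with False show ?thesis
      unfolding eq by (simp add: rec_bracket_def cochain_apply) (simp add: sgnp_def cochain_apply)
  qed
qed

lemma subspace_cochains: "module.subspace (cochain_scale scale) (cochains (Suc m) scale p)"
proof -
  interpret c: vector_space "cochain_scale scale" by (rule vector_space_cochain_scale)
  have "cochains (Suc m) scale p =
      {P. homog p P \<and> multilin m scale P \<and> block_alt m P \<and> (0 < p \<longrightarrow> last_alt P)}"
    using cochains_iff[OF vector_space_axioms] by blast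
  then show ?thesis
    unfolding c.subspace_def
    by (auto simp: multilin_zero multilin_add
        multilin_cochain_scale[unfolded cochain_scale_def] homog_def block_alt_def last_alt_def
        cochain_apply cochain_scale_def)
qed

lemma rec_circ_in_cochains:
  assumes P: "P \<in> cochains (Suc m) scale p" and Q: "Q \<in> cochains (Suc m) scale q"
  shows "rec_circ m q P Q \<in> cochains (Suc m) scale (p + q)"
  unfolding cochains_iff[OF vector_space_axioms]
  using cochainsD[OF P] cochainsD[OF Q]
  by (intro conjI impI homog_rec_circ multilin_rec_circ block_alt_rec_circ last_alt_rec_circ)

end

section \<open>The differential graded Lie algebra of cochains of bidegree
  \<open>k(n-1)|0\<close>\<close>

locale lie_rep_spaces =
  g: vector_space sg + v: vector_space sv
  for sg :: "'k::field_char_0 \<Rightarrow> 'g::ab_group_add \<Rightarrow> 'g" and sv :: "'k \<Rightarrow> 'v::ab_group_add \<Rightarrow> 'v" +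
  fixes m :: nat
begin

abbreviation s where "s \<equiv> module_prod.scale sg sv"
abbreviation S where "S \<equiv> cochain_scale s"
abbreviation C where "C k \<equiv> bideg_cochains (Suc m) sg sv k (k * m) 0"
abbreviation br where "br \<equiv> nlie_bracket (Suc m) s"

sublocale vector_space_prod sg sv by unfold_locales

sublocale c: vector_space S by (rule p.vector_space_cochain_scale)

lemma C_iff: "f \<in> C k \<longleftrightarrow> f \<in> cochains (Suc m) s k \<and> intertwines (dbl sv) f f"
  by (rule bideg_cochains_iff) unfold_locales

lemma C_cochains: "f \<in> C k \<Longrightarrow> f \<in> cochains (Suc m) s k"
  by (simp add: C_iff)

lemmas CD = p.cochainsD[OF C_cochains]

lemma dbl_linear:
  "dbl sv (x + y) = dbl sv x + dbl sv (y :: 'g \<times> 'v)" "dbl sv (s c x) = s c (dbl sv x)"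
  "dbl sv (0 :: 'g \<times> 'v) = 0"
  by (simp_all add: dbl_def scale_def v.scale_right_distrib zero_prod_def mult.commute)

lemma subspace_C: "c.subspace (C k)"
proof -
  have "C k = {f. f \<in> cochains (Suc m) s k} \<inter> {f. intertwines (dbl sv) f f}"
    using C_iff by blast
  moreover have "c.subspace {f. intertwines (dbl sv) f f}"
    unfolding c.subspace_def intertwines_def cochain_apply cochain_scale_def mem_Collect_eq
    by (simp only: dbl_linear) simp
  ultimately show ?thesis
    using p.subspace_cochains[of m k] by (simp add: c.subspace_inter)
qed

lemma bracket_C:
  assumes "P \<in> C p" "Q \<in> C q"
  shows "br P Q = rec_bracket m p q P Q" "br P Q \<in> C (p + q)"
proof -
  show eq: "br P Q = rec_bracket m p q P Q"
    by (rule p.nlie_bracket_eq_rec_bracket) (use assms C_cochains in auto)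
  have rcC: "rec_circ m q P Q \<in> C (p + q)" if "P \<in> C p" "Q \<in> C q" for P Q p q
    unfolding C_iff
  proof
    show "rec_circ m q P Q \<in> cochains (Suc m) s (p + q)"
      by (rule p.rec_circ_in_cochains) (use that C_cochains in auto)
    show "intertwines (dbl sv) (rec_circ m q P Q) (rec_circ m q P Q)"
      using that CD(2)[OF that(1)] unfolding C_iff
      by (intro intertwines_rec_circ[of _ m s _ s] dbl_linear) auto
  qed
  have "rec_circ m p Q P \<in> C (p + q)" using rcC[OF assms(2,1)] by (simp add: add.commute)
  then show "br P Q \<in> C (p + q)"
    unfolding eq rec_bracket_def p.cochain_scale_neg_one_power[symmetric]
    using rcC[OF assms] subspace_C by (intro c.subspace_diff c.subspace_scale)
qed

text \<open>Bilinearity of the bracket concerns inhomogeneous elements too. Multilinearity, unlike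
  homogeneity, defines a subspace containing every component, hence their span.\<close>

lemma span_C_multilin: "P \<in> c.span (\<Union>k. C k) \<Longrightarrow> multilin m s P"
  using c.span_minimal[OF _ p.subspace_multilin, of "\<Union>k. C k" m] CD(2) by blast

lemma bracket_jacobi_C:
  assumes "P \<in> C p" "Q \<in> C q" "R \<in> C r"
  shows "br P (br Q R) = br (br P Q) R + S ((-1) ^ (p * q)) (br Q (br P R))"
  unfolding bracket_C(1)[OF assms(2,3)] bracket_C(1)[OF assms(1,2)] bracket_C(1)[OF assms(1,3)]
    bracket_C(1)[OF assms(1) bracket_C(2)[OF assms(2,3), unfolded bracket_C(1)[OF assms(2,3)]]]
    bracket_C(1)[OF bracket_C(2)[OF assms(1,2), unfolded bracket_C(1)[OF assms(1,2)]] assms(3)]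
    bracket_C(1)[OF assms(2) bracket_C(2)[OF assms(1,3), unfolded bracket_C(1)[OF assms(1,3)]]]
    p.cochain_scale_neg_one_power
  by (rule rec_bracket_jacobi[of m s]) (use CD assms in blast)+

lemma bracket_skew_C:
  assumes "P \<in> C p" "Q \<in> C q"
  shows "br P Q = - S ((-1) ^ (p * q)) (br Q P)"
  unfolding bracket_C(1)[OF assms] bracket_C(1)[OF assms(2,1)] p.cochain_scale_neg_one_power
  by (simp add: rec_bracket_def mult.commute[of q p]) (simp add: sgnp_def)

text \<open>Evaluation on lists of length \<open>p\<close> annihilates every component except that
  of degree \<open>p\<close>.\<close>

lemma independent_C:
  assumes "finite I" "\<And>p. p \<in> I \<Longrightarrow> f p \<in> C p" "(\<Sum>p\<in>I. f p) = 0" "p \<in> I"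
  shows "f p = 0"
proof (intro ext)
  fix Xs x
  show "f p Xs x = 0 Xs x"
  proof (cases "length Xs = p")
    case False
    then show ?thesis using CD(1)[OF assms(2)[OF assms(4)]] by (simp add: homogD cochain_apply)
  next
    case True
    have "0 = (\<Sum>p\<in>I. f p) Xs x" by (simp add: assms(3) cochain_apply)
    also have "\<dots> = (\<Sum>q\<in>I. f q Xs x)" by (simp add: sum_fun_apply)
    also have "\<dots> = (\<Sum>q\<in>{p}. f q Xs x)"
    proof (rule sum.mono_neutral_right[OF assms(1)])
      show "\<forall>q\<in>I - {p}. f q Xs x = 0"
      proof
        fix q assume "q \<in> I - {p}"
        then show "f q Xs x = 0" using CD(1)[OF assms(2)[of q]] True by (simp add: homogD)
      qed
    qed (use assms(4) in simp)
    finally show ?thesis by (simp add: cochain_apply)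
  qed
qed

lemma dg_lie_algebra_C:
  assumes \<pi>: "\<pi> \<in> C 1" "br \<pi> \<pi> = 0"
  shows "dg_lie_algebra S C br (br \<pi>)"
proof -
  let ?U = "c.span (\<Union>k. C k)"
  have in_span: "P \<in> ?U" if "P \<in> C k" for P k by (rule c.span_base) (use that in blast)
  note ml = span_C_multilin CD(2)[OF \<pi>(1)]
  have dd: "br \<pi> (br \<pi> P) = 0" if "P \<in> C k" for P k
  proof -
    let ?z = "br \<pi> (br \<pi> P)"
    have "br 0 P = 0"
      using p.nlie_bracket_add_left[OF CD(2)[OF that], of 0 0] by simp
    moreover have "S ((-1) ^ (1 * 1)) F = - F" for F
      unfolding p.cochain_scale_neg_one_power by (simp add: sgnp_def)
    \<comment> \<open>The Jacobi identity with the odd element \<open>\<pi>\<close> twice reads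
      \<open>[\<pi>, [\<pi>, P]] = [[\<pi>, \<pi>], P] - [\<pi>, [\<pi>, P]]\<close>, and the
      bracket of \<open>\<pi>\<close> with itself is zero.\<close>
    ultimately have "?z = - ?z"
      using bracket_jacobi_C[OF \<pi>(1) \<pi>(1) that] unfolding \<pi>(2) by (simp only: add_0_left)
    then have "?z + ?z = ?z + - ?z" by (rule arg_cong)
    then have "?z + ?z = 0" by (simp only: add.right_inverse)
    then have "S 2 ?z = 0" using c.scale_left_distrib[of 1 1 ?z] by simp
    then show ?thesis by simp
  qed
  have d_C: "br \<pi> P \<in> C (k + 1)" if "P \<in> C k" for P k
    using bracket_C(2)[OF \<pi>(1) that] by (simp add: add.commute)
  have d_add: "br \<pi> (P + Q) = br \<pi> P + br \<pi> Q" for P Q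
    by (rule p.nlie_bracket_add_right[OF ml(2)])
  have d_scale: "br \<pi> (S a P) = S a (br \<pi> P)" for a P
    by (rule p.nlie_bracket_scale_right[OF ml(2)])
  have d_0: "br \<pi> 0 = 0" using d_add[of 0 0] by simp
  \<comment> \<open>This extends \<open>d (d P) = 0\<close> from the components to the span: the
    elements with the property form a subspace.\<close>
  have sub: "c.subspace {P. P \<in> ?U \<and> br \<pi> P \<in> ?U \<and> br \<pi> (br \<pi> P) = 0}"
  proof (rule c.subspaceI)
    show "0 \<in> {P. P \<in> ?U \<and> br \<pi> P \<in> ?U \<and> br \<pi> (br \<pi> P) = 0}"
      by (simp only: mem_Collect_eq d_0 c.span_zero simp_thms)
    show "P + Q \<in> {P. P \<in> ?U \<and> br \<pi> P \<in> ?U \<and> br \<pi> (br \<pi> P) = 0}"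
      if "P \<in> {P. P \<in> ?U \<and> br \<pi> P \<in> ?U \<and> br \<pi> (br \<pi> P) = 0}"
        "Q \<in> {P. P \<in> ?U \<and> br \<pi> P \<in> ?U \<and> br \<pi> (br \<pi> P) = 0}" for P Q
      using that by (simp only: mem_Collect_eq d_add c.span_add simp_thms add_0_left)
    show "S a P \<in> {P. P \<in> ?U \<and> br \<pi> P \<in> ?U \<and> br \<pi> (br \<pi> P) = 0}"
      if "P \<in> {P. P \<in> ?U \<and> br \<pi> P \<in> ?U \<and> br \<pi> (br \<pi> P) = 0}" for a P
      using that by (simp only: mem_Collect_eq d_scale c.span_scale simp_thms c.scale_zero_right)
  qed
  have "P \<in> {P. P \<in> ?U \<and> br \<pi> P \<in> ?U \<and> br \<pi> (br \<pi> P) = 0}" if "P \<in> (\<Union>k. C k)" for P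
    using that in_span d_C dd by blast
  then have "?U \<subseteq> {P. P \<in> ?U \<and> br \<pi> P \<in> ?U \<and> br \<pi> (br \<pi> P) = 0}"
    by (intro c.span_minimal sub subsetI)
  then have d_span: "br \<pi> (br \<pi> P) = 0" if "P \<in> ?U" for P using that by blast
  show ?thesis
  proof (rule dg_lie_algebra.intro[OF c.vector_space_axioms], rule dg_lie_algebra_axioms.intro)
    \<comment> \<open>The derivation law is the Jacobi identity with \<open>\<pi>\<close>, of degree
      1, in front.\<close>
    show "br \<pi> (br P Q) = br (br \<pi> P) Q + S ((-1) ^ p) (br P (br \<pi> Q))"
      if "P \<in> C p" "Q \<in> C q" for P Q p q
      using bracket_jacobi_C[OF \<pi>(1) that] by simp
    show "br (P + P') Q = br P Q + br P' Q" if "Q \<in> ?U" for P P' Q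
      by (rule p.nlie_bracket_add_left[OF ml(1)[OF that]])
    show "br P (Q + Q') = br P Q + br P Q'" if "P \<in> ?U" for P Q Q'
      by (rule p.nlie_bracket_add_right[OF ml(1)[OF that]])
    show "br (S a P) Q = S a (br P Q)" if "Q \<in> ?U" for P Q a
      by (rule p.nlie_bracket_scale_left[OF ml(1)[OF that]])
    show "br P (S a Q) = S a (br P Q)" if "P \<in> ?U" for P Q a
      by (rule p.nlie_bracket_scale_right[OF ml(1)[OF that]])
    show "f p = 0" if "finite I" "\<And>p. p \<in> I \<Longrightarrow> f p \<in> C p" "(\<Sum>p\<in>I. f p) = 0" "p \<in> I" for I f p
      using that by (rule independent_C)
    show "br \<pi> (P + Q) = br \<pi> P + br \<pi> Q" for P Q by (rule d_add)
    show "br \<pi> (S a P) = S a (br \<pi> P)" for a P by (rule d_scale)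
    show "br \<pi> P \<in> C (k + 1)" if "P \<in> C k" for P k using that by (rule d_C)
    show "br \<pi> (br \<pi> P) = 0" if "P \<in> ?U" for P using that by (rule d_span)
  qed (fact subspace_C bracket_C(2) bracket_jacobi_C bracket_skew_C)+
qed

end

section \<open>The operation on the direct sum\<close>

lemma length_omit: "i < length L \<Longrightarrow> length (omit i L) = length L - 1"
  by (simp add: omit_def)

lemma nth_omit:
  assumes "i < length L" "k < length L - 1"
  shows "omit i L ! k = L ! (if k < i then k else Suc k)"
  using assms by (simp add: omit_def nth_append)

lemma omit_update_same: "omit i (L[i := a]) = omit i L"
  by (simp add: omit_def)

lemma omit_update:
  assumes "i < length L" "j < length L" "i \<noteq> j"
  shows "omit i (L[j := a]) = (omit i L)[(if j < i then j else j - 1) := a]"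
proof (rule nth_equalityI)
  show "length (omit i (L[j := a])) = length ((omit i L)[(if j < i then j else j - 1) := a])"
    using assms by (simp add: length_omit)
  fix k assume "k < length (omit i (L[j := a]))"
  then have k: "k < length L - 1" using assms by (simp add: length_omit)
  then show "omit i (L[j := a]) ! k = (omit i L)[(if j < i then j else j - 1) := a] ! k"
    using assms by (auto simp: nth_omit length_omit nth_list_update)
qed

lemma omit_last: "omit (length L) (L @ [a]) = L"
  by (simp add: omit_def)

lemma not_distinct_omit:
  assumes ab: "a < length L" "b < length L" "a \<noteq> b" "L ! a = L ! b"
    and i: "i < length L" "i \<noteq> a" "i \<noteq> b"
  shows "\<not> distinct (omit i L)"
proof
  assume d: "distinct (omit i L)"
  let ?f = "\<lambda>j. if j < i then j else j - 1"
  have "?f a < length L - 1" "?f b < length L - 1" "?f a \<noteq> ?f b" using ab i by auto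
  moreover have "omit i L ! ?f a = L ! a" "omit i L ! ?f b = L ! b"
    using ab i by (auto simp: nth_omit)
  ultimately show False
    using nth_eq_iff_index_eq[OF d, of "?f a" "?f b"] ab(4) by (simp add: length_omit[OF i(1)])
qed

text \<open>Omitting one or the other of two equal entries leaves the same entries up to a cycle,
  which is a product of \<open>b - a - 1\<close> transpositions. Needed for the skewness of the
  \<open>\<rho>\<close> part of \<open>\<pi>\<close>.\<close>

lemma alternating_omit:
  assumes f: "alternating N f" and len: "length L = Suc N" and ab: "a < b" "b < Suc N" "L ! a = L ! b"
  shows "f (omit a L) = sgnp (b - Suc a) (f (omit b L))"
  using len ab
proof (induction "b - Suc a" arbitrary: b L)
  case 0
  then have b: "b = Suc a" by simp
  have "omit a L = omit b L"
  proof (rule nth_equalityI)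
    show "length (omit a L) = length (omit b L)" using 0 by (simp add: length_omit)
    fix k assume "k < length (omit a L)"
    then have k: "k < N" using 0 by (simp add: length_omit)
    show "omit a L ! k = omit b L ! k"
      using 0(2-) k b by (auto simp: nth_omit less_Suc_eq)
  qed
  then show ?case using b by (simp add: sgnp_simps)
next
  case (Suc d)
  then obtain c where c: "b = Suc c" "a < c" "c < N" by (cases b) auto
  \<comment> \<open>The equal entry is moved one place to the left, towards \<open>a\<close>.
    Omitting it gives the same list as before, while the list without position \<open>a\<close>
    undergoes one transposition.\<close>
  define L' where "L' = L[c := L ! b, b := L ! c]"
  have len': "length L' = Suc N" using Suc by (simp add: L'_def)
  have "f (omit a L') = sgnp (c - Suc a) (f (omit c L'))"
    using Suc c len' by (intro Suc(1)) (auto simp: L'_def)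
  moreover have "omit c L' = omit b L"
  proof (rule nth_equalityI)
    show "length (omit c L') = length (omit b L)" using Suc c len' by (simp add: length_omit)
    fix k assume "k < length (omit c L')"
    then have k: "k < N" using c len' by (simp add: length_omit)
    show "omit c L' ! k = omit b L ! k"
      using Suc(3,5) k c len' by (auto simp: nth_omit L'_def nth_list_update)
  qed
  moreover have "f (omit a L) = - f (omit a L')"
  proof -
    obtain e where e: "c = Suc e" using c by (cases c) auto
    let ?M = "omit a L"
    have M: "length ?M = N" using Suc c by (simp add: length_omit)
    have "omit a L' = ?M[e := L ! b, c := L ! c]"
      unfolding L'_def using Suc(3) c e by (simp add: omit_update)
    moreover have "?M = ?M[e := L ! c, c := L ! b]"
      using Suc(3) c e M
      by (intro nth_equalityI) (auto simp: nth_omit nth_list_update less_Suc_eq)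
    moreover have "f (?M[e := L ! b, c := L ! c]) = - f (?M[e := L ! c, c := L ! b])"
      by (rule alternating_swap[OF f M]) (use c e in auto)
    ultimately show ?thesis by simp
  qed
  moreover have "b - Suc a = Suc (c - Suc a)" using c by simp
  ultimately show ?case by (simp add: sgnp_simps)
qed

lemma wedge_hom_alternating:
  fixes f :: "'a::ab_group_add list \<Rightarrow> 'b::ab_group_add"
  assumes "f \<in> wedge_hom sA sB N"
  shows "alternating N f"
  unfolding alternating_def
proof (intro conjI allI impI)
  fix xs :: "'a list" and i x y assume "length xs = N" "i < N"
  then interpret Vector_Spaces.linear sA sB "\<lambda>y. f (xs[i := y])"
    using assms by (simp add: wedge_hom_def)
  show "f (xs[i := x + y]) = f (xs[i := x]) + f (xs[i := y])" by (rule add)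
qed (use assms in \<open>simp add: wedge_hom_def\<close>)

text \<open>The \<open>n\<close>-ary operation on \<open>\<gg> \<oplus> V\<close> that \<open>\<mu> + \<rho>\<close> stands for, without the guard on the
  length.\<close>

definition semidirect ::
    "nat \<Rightarrow> ('k::field \<Rightarrow> 'v::ab_group_add \<Rightarrow> 'v) \<Rightarrow> ('g list \<Rightarrow> 'g) \<Rightarrow> ('g list \<Rightarrow> 'v \<Rightarrow> 'v)
      \<Rightarrow> ('g \<times> 'v) list \<Rightarrow> 'g \<times> 'v" where
  "semidirect n sv \<mu> \<rho> ws = (\<mu> (map fst ws),
     \<Sum>i<n. sv ((-1) ^ (n - 1 - i)) (\<rho> (omit i (map fst ws)) (snd (ws ! i))))"

lemma sum_cochain_apply:
  "length X = m \<Longrightarrow> sum_cochain (Suc m) sv \<mu> \<rho> [X] x = semidirect (Suc m) sv \<mu> \<rho> (X @ [x])"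
  by (simp add: sum_cochain_def semidirect_def wedge_args_def Let_def)

lemma sum_cochain_off: "Xs \<notin> wedge_args (Suc m) 1 \<Longrightarrow> sum_cochain (Suc m) sv \<mu> \<rho> Xs x = 0"
  by (simp add: sum_cochain_def)

section \<open>The element of degree 1 attached to a pair\<close>

locale lie_rep_data = lie_rep_spaces sg sv m
  for sg :: "'k::field_char_0 \<Rightarrow> 'g::ab_group_add \<Rightarrow> 'g" and sv :: "'k \<Rightarrow> 'v::ab_group_add \<Rightarrow> 'v"
    and m :: nat +
  fixes \<mu> :: "'g list \<Rightarrow> 'g" and \<rho> :: "'g list \<Rightarrow> 'v \<Rightarrow> 'v"
  assumes \<mu>: "\<mu> \<in> wedge_hom sg sg (Suc m)" and \<rho>: "\<rho> \<in> action_hom sg sv m" and m: "0 < m"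
begin

abbreviation sd where "sd \<equiv> semidirect (Suc m) sv \<mu> \<rho>"
abbreviation \<pi> where "\<pi> \<equiv> sum_cochain (Suc m) sv \<mu> \<rho>"

lemma \<mu>_linear:
  assumes "length L = Suc m" "j < Suc m"
  shows "\<mu> (L[j := x + y]) = \<mu> (L[j := x]) + \<mu> (L[j := y])" "\<mu> (L[j := sg c x]) = sg c (\<mu> (L[j := x]))"
    "\<mu> (L[j := 0]) = 0"
proof -
  interpret Vector_Spaces.linear sg sg "\<lambda>y. \<mu> (L[j := y])"
    using \<mu> assms by (simp add: wedge_hom_def)
  show "\<mu> (L[j := x + y]) = \<mu> (L[j := x]) + \<mu> (L[j := y])" "\<mu> (L[j := sg c x]) = sg c (\<mu> (L[j := x]))"
    "\<mu> (L[j := 0]) = 0"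
    by (rule add scale zero)+
qed

lemma \<rho>_wedge: "(\<lambda>xs. \<rho> xs u) \<in> wedge_hom sg sv m"
  using \<rho> by (simp add: action_hom_def)

lemma \<rho>_linear:
  assumes "length L = m" "j < m"
  shows "\<rho> (L[j := x + y]) u = \<rho> (L[j := x]) u + \<rho> (L[j := y]) u"
    "\<rho> (L[j := sg c x]) u = sv c (\<rho> (L[j := x]) u)"
    "\<rho> (L[j := 0]) u = 0"
proof -
  interpret Vector_Spaces.linear sg sv "\<lambda>y. \<rho> (L[j := y]) u"
    using \<rho>_wedge[of u] assms by (simp add: wedge_hom_def)
  show "\<rho> (L[j := x + y]) u = \<rho> (L[j := x]) u + \<rho> (L[j := y]) u"
    "\<rho> (L[j := sg c x]) u = sv c (\<rho> (L[j := x]) u)"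
    "\<rho> (L[j := 0]) u = 0"
    by (rule add scale zero)+
qed

lemma \<rho>_vector:
  assumes "length L = m"
  shows "\<rho> L (u + w) = \<rho> L u + \<rho> L w" "\<rho> L (sv c u) = sv c (\<rho> L u)" "\<rho> L 0 = 0" "\<rho> L (- u) = - \<rho> L u"
proof -
  interpret Vector_Spaces.linear sv sv "\<rho> L"
    using \<rho> assms by (simp add: action_hom_def)
  show "\<rho> L (u + w) = \<rho> L u + \<rho> L w" "\<rho> L (sv c u) = sv c (\<rho> L u)" "\<rho> L 0 = 0" "\<rho> L (- u) = - \<rho> L u"
    by (rule add scale zero neg)+
qed

lemma sd_linear:
  assumes len: "length ws = Suc m" and j: "j < Suc m"
  shows "Vector_Spaces.linear s s (\<lambda>y. sd (ws[j := y]))"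
proof -
  let ?L = "map fst ws"
  let ?t = "\<lambda>y i. \<rho> (omit i (map fst (ws[j := y]))) (snd (ws[j := y] ! i))"
  have t: "?t (x + y) i = ?t x i + ?t y i \<and> ?t (s c x) i = sv c (?t x i)" if i: "i < Suc m" for x y c i
  proof (cases "i = j")
    case True
    then show ?thesis
      using len i by (simp add: map_update omit_update_same \<rho>_vector length_omit scale_def)
  next
    case False
    then show ?thesis
      using len i j by (simp add: map_update omit_update \<rho>_linear length_omit scale_def)
  qed
  have "sd (ws[j := x + y]) = sd (ws[j := x]) + sd (ws[j := y])" for x y
    using t len j unfolding semidirect_def
    by (simp add: \<mu>_linear map_update v.scale_right_distrib sum.distrib)
  moreover have "sd (ws[j := s c x]) = s c (sd (ws[j := x]))" for c x
  proof -
    have "(\<Sum>i<Suc m. sv ((-1) ^ (Suc m - 1 - i)) (?t (s c x) i)) =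
        (\<Sum>i<Suc m. sv c (sv ((-1) ^ (Suc m - 1 - i)) (?t x i)))"
      using t by (intro sum.cong refl) (simp add: v.scale_left_commute)
    then show ?thesis
      using len j unfolding semidirect_def
      by (simp add: \<mu>_linear map_update scale_def v.scale_sum_right v.scale_right_distrib)
  qed
  ultimately show ?thesis
    unfolding Vector_Spaces.linear_iff using p.vector_space_axioms by blast
qed

text \<open>A summand that omits neither of the equal entries vanishes. The two that omit one of
  them cancel: \<open>alternating_omit\<close> contributes \<open>(-1)^(b-a-1)\<close>, while the
  coefficients differ by \<open>(-1)^(b-a)\<close>.\<close>

lemma sd_nondistinct:
  assumes len: "length ws = Suc m" and nd: "\<not> distinct ws"
  shows "sd ws = 0"
proof -
  let ?L = "map fst ws" and ?t = "\<lambda>i. sv ((-1) ^ (m - i)) (\<rho> (omit i (map fst ws)) (snd (ws ! i)))"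
  obtain a b where ab: "a < b" "b < Suc m" "ws ! a = ws ! b"
    using nd len by (auto simp: distinct_conv_nth) (metis linorder_neqE_nat)
  have "\<mu> ?L = 0"
    using \<mu> len nd by (simp add: wedge_hom_def distinct_map)
  moreover have "sum ?t {..<Suc m} = sum ?t {a, b}"
  proof (rule sum.mono_neutral_right)
    show "\<forall>i\<in>{..<Suc m} - {a, b}. ?t i = 0"
    proof
      fix i assume i: "i \<in> {..<Suc m} - {a, b}"
      then have "\<not> distinct (omit i ?L)"
        using ab len by (intro not_distinct_omit[of a _ b]) auto
      then have "\<rho> (omit i ?L) (snd (ws ! i)) = 0"
        using \<rho>_wedge[of "snd (ws ! i)"] len i by (simp add: wedge_hom_def length_omit)
      then show "?t i = 0" by simp
    qed
  qed (use ab in auto)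
  moreover have "sum ?t {a, b} = 0"
  proof -
    have "\<rho> (omit a ?L) (snd (ws ! b)) = sgnp (b - Suc a) (\<rho> (omit b ?L) (snd (ws ! b)))"
      using alternating_omit[OF wedge_hom_alternating[OF \<rho>_wedge], of ?L a b "snd (ws ! b)"] ab len by simp
    moreover obtain d where d: "b = Suc (a + d)" using ab(1) less_iff_Suc_add by auto
    moreover obtain e where "m = b + e" using ab(2) by (metis le_Suc_ex less_Suc_eq_le)
    ultimately show ?thesis
      using ab by (simp add: v.scale_neg_one_power sgnp_simps add.commute) (simp add: sgnp_def)
  qed
  ultimately show ?thesis by (simp add: semidirect_def zero_prod_def)
qed

lemma \<pi>_in_C: "\<pi> \<in> C 1"
  unfolding C_iff cochains_iff[OF p.vector_space_axioms]
proof (intro conjI impI)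
  show "homog 1 \<pi>"
    unfolding homog_def by (intro allI impI sum_cochain_off) (simp add: wedge_args_def)
  show "block_alt m \<pi>"
    unfolding block_alt_def
  proof (intro allI impI)
    fix Xs :: "('g \<times> 'v) list list" and x assume bad: "\<exists>X\<in>set Xs. length X \<noteq> m \<or> \<not> distinct X"
    show "\<pi> Xs x = 0"
    proof (cases "Xs \<in> wedge_args (Suc m) 1")
      case True
      then obtain X where "Xs = [X]" "length X = m" by (auto simp: wedge_args_def length_Suc_conv)
      then show ?thesis using bad sd_nondistinct[of "X @ [x]"] by (auto simp: sum_cochain_apply)
    qed (rule sum_cochain_off)
  qed
  show "last_alt \<pi>"
    unfolding last_alt_def
  proof (intro allI impI)
    fix Xs and X :: "('g \<times> 'v) list" and x assume nd: "\<not> distinct (X @ [x])"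
    show "\<pi> (Xs @ [X]) x = 0"
    proof (cases "Xs @ [X] \<in> wedge_args (Suc m) 1")
      case True
      then have "Xs = []" "length X = m" by (auto simp: wedge_args_def)
      then show ?thesis using sd_nondistinct[OF _ nd] by (simp add: sum_cochain_apply)
    qed (rule sum_cochain_off)
  qed
  show "multilin m s \<pi>"
    unfolding multilin_def
  proof (intro conjI allI impI)
    fix Xs :: "('g \<times> 'v) list list"
    show "Vector_Spaces.linear s s (\<pi> Xs)"
    proof (cases "Xs \<in> wedge_args (Suc m) 1")
      case True
      then obtain X where X: "Xs = [X]" "length X = m" by (auto simp: wedge_args_def length_Suc_conv)
      \<comment> \<open>The final vector is position \<open>m\<close> of the list; the 0 is a
        placeholder to be overwritten by \<open>y\<close>.\<close>
      have "\<pi> Xs = (\<lambda>y. sd ((X @ [0])[m := y]))"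
        using X by (intro ext) (simp add: sum_cochain_apply list_update_append)
      then show ?thesis using sd_linear[of "X @ [0]" m] X by simp
    next
      case False
      then have "\<pi> Xs = (\<lambda>x. 0)" by (intro ext sum_cochain_off)
      then show ?thesis by (simp add: p.linear_zero_fun)
    qed
  next
    fix As and X :: "('g \<times> 'v) list" and Bs x j assume j: "j < m"
    show "Vector_Spaces.linear s s (\<lambda>y. \<pi> (As @ X[j := y] # Bs) x)"
    proof (cases "As @ X # Bs \<in> wedge_args (Suc m) 1")
      case True
      then have X: "As = []" "Bs = []" "length X = m" by (auto simp: wedge_args_def)
      have "(\<lambda>y. \<pi> (As @ X[j := y] # Bs) x) = (\<lambda>y. sd ((X @ [x])[j := y]))"
        using X j by (intro ext) (simp add: sum_cochain_apply list_update_append)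
      then show ?thesis using sd_linear[of "X @ [x]" j] X j by simp
    next
      case False
      then have "As @ X[j := y] # Bs \<notin> wedge_args (Suc m) 1" for y by (auto simp: wedge_args_def)
      then have "(\<lambda>y. \<pi> (As @ X[j := y] # Bs) x) = (\<lambda>y. 0)" by (intro ext sum_cochain_off)
      then show ?thesis by (simp add: p.linear_zero_fun)
    qed
  qed
  \<comment> \<open>The first component does not see \<open>V\<close>, and each summand of the
    second is linear in the \<open>V\<close> component of one entry and independent of the
    others.\<close>
  show "intertwines (dbl sv) \<pi> \<pi>"
    unfolding intertwines_def
  proof (intro allI)
    fix Xs :: "('g \<times> 'v) list list" and x
    show "\<pi> (map (map (dbl sv)) Xs) (dbl sv x) = dbl sv (\<pi> Xs x)"
    proof (cases "Xs \<in> wedge_args (Suc m) 1")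
      case True
      then obtain X where X: "Xs = [X]" "length X = m" by (auto simp: wedge_args_def length_Suc_conv)
      have fst: "map fst (map (dbl sv) ws) = map fst ws" for ws :: "('g \<times> 'v) list"
        by (simp add: dbl_def)
      have "sd (map (dbl sv) (X @ [x])) = dbl sv (sd (X @ [x]))"
      proof -
        let ?ws = "X @ [x]"
        have "sv ((-1) ^ (m - i)) (\<rho> (omit i (map fst ?ws)) (snd (map (dbl sv) ?ws ! i))) =
            sv 2 (sv ((-1) ^ (m - i)) (\<rho> (omit i (map fst ?ws)) (snd (?ws ! i))))" if "i < Suc m" for i
        proof -
          have "snd (map (dbl sv) ?ws ! i) = sv 2 (snd (?ws ! i))"
            using that X(2) by (subst nth_map) (simp_all add: dbl_def)
          moreover have "length (omit i (map fst ?ws)) = m" using that X(2) by (simp add: length_omit)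
          ultimately show ?thesis by (simp only: \<rho>_vector v.scale_left_commute)
        qed
        then have "(\<Sum>i<Suc m. sv ((-1) ^ (m - i)) (\<rho> (omit i (map fst ?ws)) (snd (map (dbl sv) ?ws ! i)))) =
            sv 2 (\<Sum>i<Suc m. sv ((-1) ^ (m - i)) (\<rho> (omit i (map fst ?ws)) (snd (?ws ! i))))"
          unfolding v.scale_sum_right by (intro sum.cong refl) simp
        then show ?thesis unfolding semidirect_def fst by (simp only: dbl_def diff_Suc_1 fst_conv snd_conv)
      qed
      then show ?thesis using X by (simp add: sum_cochain_apply)
    next
      case False
      then have "map (map (dbl sv)) Xs \<notin> wedge_args (Suc m) 1" by (auto simp: wedge_args_def)
      then show ?thesis by (simp only: sum_cochain_off[OF False] sum_cochain_off dbl_linear not_False_eq_True)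
    qed
  qed
qed

end

abbreviation (input) emb :: "'g \<Rightarrow> 'g \<times> 'v::zero" where
  "emb a \<equiv> (a, 0)"

text \<open>A transposition moves the entry from the second summand to the last position.\<close>

lemma alternating_single_entry:
  fixes G :: "('g::ab_group_add \<times> 'v::ab_group_add) list \<Rightarrow> 'b::ab_group_add"
  assumes G: "alternating (Suc N) G" and len: "length L = Suc N"
    and k: "k < Suc N" "fst (L ! k) = 0" "\<And>i. \<lbrakk>i < Suc N; i \<noteq> k\<rbrakk> \<Longrightarrow> snd (L ! i) = 0"
    and zero: "\<And>as u. length as = N \<Longrightarrow> G (map emb as @ [(0, u)]) = 0"
  shows "G L = 0"
proof -
  have normal: "G M = 0" if "length M = Suc N" "fst (M ! N) = 0" "\<And>i. i < N \<Longrightarrow> snd (M ! i) = 0" for M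
  proof -
    have "M = map emb (map fst (take N M)) @ [(0, snd (M ! N))]"
    proof (rule nth_equalityI)
      fix i assume "i < length M"
      then show "M ! i = (map emb (map fst (take N M)) @ [(0, snd (M ! N))]) ! i"
        using that by (auto simp: nth_append prod_eq_iff less_Suc_eq)
    qed (use that in simp)
    moreover have "G (map emb (map fst (take N M)) @ [(0, snd (M ! N))]) = 0"
      by (rule zero) (use that in simp)
    ultimately show ?thesis by (rule ssubst)
  qed
  show ?thesis
  proof (cases "k = N")
    case True
    then show ?thesis using normal[of L] len k by simp
  next
    case False
    let ?M = "L[k := L ! N, N := L ! k]"
    have "G L = G (L[k := L ! k, N := L ! N])" by simp
    also have "\<dots> = - G ?M" by (rule alternating_swap[OF G len]) (use k False in auto)
    also have "G ?M = 0"
      by (rule normal) (use len k False in \<open>auto simp: nth_list_update\<close>)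
    finally show ?thesis by simp
  qed
qed

section \<open>The defect of the fundamental identity\<close>

context lie_rep_data
begin

text \<open>Right-hand side minus left-hand side, the sign with which the identity appears in
  \<open>\<pi> \<circ> \<pi>\<close>.\<close>

definition fi_defect :: "('g \<times> 'v) list \<Rightarrow> ('g \<times> 'v) list \<Rightarrow> 'g \<times> 'v" where
  "fi_defect xs ys = (\<Sum>i<Suc m. sd (ys[i := sd (xs @ [ys ! i])])) - sd (xs @ [sd ys])"

text \<open>\<open>X\<close> goes either to the outer \<open>\<pi>\<close>, with sign
  \<open>-1\<close> and leaving \<open>Y\<close> for the inner one, or to the inner
  \<open>\<pi>\<close>, which then acts as a derivation on \<open>Y\<close> and
  \<open>x\<close>.\<close>

lemma rec_circ_\<pi>_\<pi>:
  assumes "length X = m" "length Y = m"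
  shows "rec_circ m 1 \<pi> \<pi> [X, Y] x = fi_defect X (Y @ [x])"
proof -
  have "rec_circ m 1 \<pi> \<pi> [X, Y] x =
      - \<pi> [X] (\<pi> [Y] x) + (\<pi> [Y] (\<pi> [X] x) + (\<Sum>i<m. \<pi> [Y[i := \<pi> [X] (Y ! i)]] x))"
    by (simp add: rec_circ_Cons rec_circ_Nil sgnp_simps contract_apply slot_deriv_def)
  also have "\<dots> = - sd (X @ [sd (Y @ [x])]) + (sd (Y @ [sd (X @ [x])]) +
      (\<Sum>i<m. sd (Y[i := sd (X @ [Y ! i])] @ [x])))"
    using assms by (simp add: sum_cochain_apply)
  also have "(\<Sum>i<m. sd (Y[i := sd (X @ [Y ! i])] @ [x])) =
      (\<Sum>i<m. sd ((Y @ [x])[i := sd (X @ [(Y @ [x]) ! i])]))"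
    using assms by (intro sum.cong refl) (simp add: nth_append list_update_append)
  finally show ?thesis
    using assms by (simp add: fi_defect_def nth_append list_update_append)
qed

lemma sd_emb: "length as = Suc m \<Longrightarrow> sd (map emb as) = emb (\<mu> as)"
  by (simp add: semidirect_def o_def \<rho>_vector length_omit)

text \<open>The first component of \<open>(0, u)\<close> is 0, which annihilates
  \<open>\<mu>\<close>; the other entries have no component in \<open>V\<close>, so only the summand
  omitting position \<open>k\<close> remains.\<close>

lemma sd_single:
  assumes len: "length as = Suc m" and k: "k < Suc m"
  shows "sd ((map emb as)[k := (0, u)]) = (0, sgnp (m - k) (\<rho> (omit k as) u))"
proof -
  have fst: "map fst ((map emb as)[k := (0, u)]) = as[k := 0]"
    by (simp add: map_update o_def)
  have "sv ((-1) ^ (m - i)) (\<rho> (omit i (as[k := 0])) (snd ((map emb as)[k := (0, u)] ! i))) =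
      (if i = k then sgnp (m - k) (\<rho> (omit k as) u) else 0)" if "i < Suc m" for i
    using that len k
    by (auto simp: omit_update_same v.scale_neg_one_power \<rho>_vector length_omit nth_list_update sgnp_simps)
  then have "(\<Sum>i<Suc m. sv ((-1) ^ (m - i)) (\<rho> (omit i (as[k := 0])) (snd ((map emb as)[k := (0, u)] ! i)))) =
      (\<Sum>i<Suc m. if i = k then sgnp (m - k) (\<rho> (omit k as) u) else 0)"
    by (intro sum.cong refl) simp
  also have "\<dots> = sgnp (m - k) (\<rho> (omit k as) u)"
    using k by (simp del: sum.lessThan_Suc)
  finally show ?thesis
    unfolding semidirect_def fst using len k by (simp add: \<mu>_linear(3) del: sum.lessThan_Suc)
qed

lemma sd_last:
  assumes "length as = m"
  shows "sd (map emb as @ [(0, u)]) = (0, \<rho> as u)"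
  using sd_single[of "as @ [0]" m u] assms omit_last[of as 0]
  by (simp add: list_update_append sgnp_simps)

text \<open>An entry from \<open>V\<close> at the end of a block becomes second to last once a
  vector is appended, whence the sign \<open>-1\<close>.\<close>

lemma sd_before_last:
  assumes "Suc (length as) = m"
  shows "sd (map emb as @ [(0, u), emb b]) = (0, - \<rho> (as @ [b]) u)"
proof -
  have "sd (map emb as @ [(0, u), emb b]) = sd ((map emb (as @ [0, b]))[length as := (0, u)])"
    by (simp add: list_update_append)
  also have "\<dots> = (0, sgnp (m - length as) (\<rho> (omit (length as) (as @ [0, b])) u))"
    using assms by (intro sd_single) auto
  also have "omit (length as) (as @ [0, b]) = as @ [b]"
    by (simp add: omit_def)
  also have "m - length as = Suc 0" using assms by simp
  finally show ?thesis by (simp add: sgnp_simps)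
qed

lemma prod_sum: "(\<Sum>i\<in>I. (f i, h i)) = (\<Sum>i\<in>I. f i, \<Sum>i\<in>I. h i)"
  by (induction I rule: infinite_finite_induct) (simp_all add: zero_prod_def)

lemma fi_defect_emb:
  assumes "length xs = m" "length ys = Suc m"
  shows "fi_defect (map emb xs) (map emb ys) =
    emb ((\<Sum>i<Suc m. \<mu> (ys[i := \<mu> (xs @ [ys ! i])])) - \<mu> (xs @ [\<mu> ys]))"
proof -
  have 1: "sd (map emb xs @ [emb a]) = emb (\<mu> (xs @ [a]))" for a
    using sd_emb[of "xs @ [a]"] assms by simp
  have "(\<Sum>i<Suc m. sd ((map emb ys)[i := sd (map emb xs @ [map emb ys ! i])])) =
      (\<Sum>i<Suc m. emb (\<mu> (ys[i := \<mu> (xs @ [ys ! i])])))"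
    using assms by (intro sum.cong refl) (simp add: 1 map_update[of emb, symmetric] sd_emb)
  then show ?thesis
    unfolding fi_defect_def sd_emb[OF assms(2)] 1 by (simp add: prod_sum del: sum.lessThan_Suc)
qed

text \<open>The terms with \<open>i < m\<close> give the action of \<open>X \<circ> Y\<close>; the
  term \<open>i = m\<close> and the left-hand side of the fundamental identity give the commutator
  in condition (1).\<close>

lemma fi_defect_last:
  assumes "length xs = m" "length ys = m"
  shows "fi_defect (map emb xs) (map emb ys @ [(0, u)]) =
    (0, (\<Sum>i<m. \<rho> (ys[i := \<mu> (xs @ [ys ! i])]) u) + \<rho> ys (\<rho> xs u) - \<rho> xs (\<rho> ys u))"
proof -
  have 1: "sd (map emb xs @ [emb a]) = emb (\<mu> (xs @ [a]))" for a
    using sd_emb[of "xs @ [a]"] assms by simp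
  have "(\<Sum>i<m. sd ((map emb ys @ [(0, u)])[i := sd (map emb xs @ [(map emb ys @ [(0, u)]) ! i])])) =
      (\<Sum>i<m. (0, \<rho> (ys[i := \<mu> (xs @ [ys ! i])]) u))"
    using assms
    by (intro sum.cong refl) (simp add: 1 nth_append list_update_append map_update[of emb, symmetric] sd_last)
  then show ?thesis
    unfolding fi_defect_def sum.lessThan_Suc using assms
    by (simp add: prod_sum nth_append list_update_append sd_last)
qed

text \<open>All terms carry the sign of \<open>sd_before_last\<close>, so the defect is the
  left-hand side minus the right-hand side of condition (2).\<close>

lemma fi_defect_before_last:
  assumes "Suc (length xs) = m" "length ys = Suc m"
  shows "fi_defect (map emb xs @ [(0, u)]) (map emb ys) =
    (0, \<rho> (xs @ [\<mu> ys]) u - (\<Sum>i<Suc m. sgnp (m - i) (\<rho> (omit i ys) (\<rho> (xs @ [ys ! i]) u))))"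
proof -
  have "sd ((map emb ys)[i := sd ((map emb xs @ [(0, u)]) @ [map emb ys ! i])]) =
      (0, - sgnp (m - i) (\<rho> (omit i ys) (\<rho> (xs @ [ys ! i]) u)))" if "i < Suc m" for i
    using that assms sd_before_last[OF assms(1), of u "ys ! i"]
    by (simp add: sd_single \<rho>_vector length_omit) (simp add: sgnp_def)
  then have "(\<Sum>i<Suc m. sd ((map emb ys)[i := sd ((map emb xs @ [(0, u)]) @ [map emb ys ! i])])) =
      (\<Sum>i<Suc m. (0, - sgnp (m - i) (\<rho> (omit i ys) (\<rho> (xs @ [ys ! i]) u))))"
    by (intro sum.cong refl) simp
  then show ?thesis
    unfolding fi_defect_def sd_emb[OF assms(2)] using sd_before_last[OF assms(1), of u "\<mu> ys"]
    by (simp add: prod_sum sum_negf del: sum.lessThan_Suc)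
qed

lemma n_lie_algebra_iff:
  "n_lie_algebra (Suc m) sg \<mu> \<longleftrightarrow>
    (\<forall>xs ys. length xs = m \<longrightarrow> length ys = Suc m \<longrightarrow> fi_defect (map emb xs) (map emb ys) = 0)"
proof -
  have "fi_defect (map emb xs) (map emb ys) = 0 \<longleftrightarrow>
      \<mu> (xs @ [\<mu> ys]) = (\<Sum>i<Suc m. \<mu> (ys[i := \<mu> (xs @ [ys ! i])]))"
    if "length xs = m" "length ys = Suc m" for xs ys
    unfolding fi_defect_emb[OF that] zero_prod_def prod.inject right_minus_eq
    by (simp only: eq_commute simp_thms)
  then show ?thesis
    using \<mu> unfolding n_lie_algebra_def diff_Suc_1 by blast
qed

lemma n_lie_representation_iff:
  "n_lie_representation (Suc m) sg sv \<mu> \<rho> \<longleftrightarrow>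
    (\<forall>xs ys u. length xs = m \<longrightarrow> length ys = m \<longrightarrow> fi_defect (map emb xs) (map emb ys @ [(0, u)]) = 0) \<and>
    (\<forall>xs ys u. Suc (length xs) = m \<longrightarrow> length ys = Suc m \<longrightarrow>
      fi_defect (map emb xs @ [(0, u)]) (map emb ys) = 0)"
proof -
  have "fi_defect (map emb xs) (map emb ys @ [(0, u)]) = 0 \<longleftrightarrow>
      \<rho> xs (\<rho> ys u) - \<rho> ys (\<rho> xs u) = (\<Sum>i<m. \<rho> (ys[i := \<mu> (xs @ [ys ! i])]) u)"
    if "length xs = m" "length ys = m" for xs ys u
    unfolding fi_defect_last[OF that] zero_prod_def prod.inject right_minus_eq diff_eq_eq
    by (simp only: add_0_left eq_commute simp_thms)
  moreover have "fi_defect (map emb xs @ [(0, u)]) (map emb ys) = 0 \<longleftrightarrow>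
      \<rho> (xs @ [\<mu> ys]) u =
        (\<Sum>i<Suc m. sv ((-1) ^ (Suc m - 1 - i)) (\<rho> (omit i ys) (\<rho> (xs @ [ys ! i]) u)))"
    if "Suc (length xs) = m" "length ys = Suc m" for xs ys u
    unfolding fi_defect_before_last[OF that] zero_prod_def prod.inject right_minus_eq
      v.scale_neg_one_power diff_Suc_1 by (simp only: simp_thms)
  \<comment> \<open>As \<open>0 < m\<close>, the truncated subtraction is exact.\<close>
  moreover have "length xs = Suc m - 2 \<longleftrightarrow> Suc (length xs) = m" for xs :: "'g list" using m by auto
  ultimately show ?thesis
    using \<rho> unfolding n_lie_representation_def diff_Suc_1 by (simp only: simp_thms) blast
qed

lemma n_lie_rep_pair_iff: "n_lie_rep_pair (Suc m) sg sv \<mu> \<rho> \<longleftrightarrow> rec_circ m 1 \<pi> \<pi> = 0"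
proof
  assume z: "rec_circ m 1 \<pi> \<pi> = 0"
  have fi_defect: "fi_defect X (Y @ [x]) = 0" if "length X = m" "length Y = m" for X Y x
    using rec_circ_\<pi>_\<pi>[OF that, of x] unfolding z cochain_apply by (rule sym)
  have fi_defect': "fi_defect X Y = 0" if "length X = m" "length Y = Suc m" for X Y
  proof -
    have "Y = butlast Y @ [last Y]" using that by (metis append_butlast_last_id list.size(3) nat.distinct(1))
    then show ?thesis using fi_defect[of X "butlast Y" "last Y"] that by simp
  qed
  show "n_lie_rep_pair (Suc m) sg sv \<mu> \<rho>"
    unfolding n_lie_rep_pair_def n_lie_algebra_iff n_lie_representation_iff
    by (intro conjI allI impI fi_defect') auto
next
  assume "n_lie_rep_pair (Suc m) sg sv \<mu> \<rho>"
  then have f0: "\<And>xs ys. \<lbrakk>length xs = m; length ys = Suc m\<rbrakk> \<Longrightarrow> fi_defect (map emb xs) (map emb ys) = 0"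
    and f1: "\<And>xs ys u. \<lbrakk>length xs = m; length ys = m\<rbrakk> \<Longrightarrow> fi_defect (map emb xs) (map emb ys @ [(0, u)]) = 0"
    and f2: "\<And>xs ys u. \<lbrakk>Suc (length xs) = m; length ys = Suc m\<rbrakk> \<Longrightarrow> fi_defect (map emb xs @ [(0, u)]) (map emb ys) = 0"
    unfolding n_lie_rep_pair_def n_lie_algebra_iff n_lie_representation_iff by blast+
  let ?E = "rec_circ m 1 \<pi> \<pi>"
  let ?N = "2 * m + 1"
  note \<pi>D = CD[OF \<pi>_in_C]
  have "?E \<in> cochains (Suc m) s (1 + 1)"
    using \<pi>_in_C C_cochains by (intro p.rec_circ_in_cochains) blast+
  moreover have "intertwines (dbl sv) ?E ?E"
    using \<pi>_in_C \<pi>D(2) unfolding C_iff by (intro intertwines_rec_circ[of _ m s _ s] dbl_linear) auto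
  ultimately have "?E \<in> C (1 + 1)" unfolding C_iff by blast
  then have EC: "?E \<in> C 2" by (simp only: one_add_one)
  note ED = CD[OF EC]
  have zero: "?E [X, Y] x = 0" if X: "length X = m" and Y: "length Y = m"
    and pure: "\<And>w. w \<in> set (X @ Y @ [x]) \<Longrightarrow> pure_vector w" for X Y x
  proof -
    let ?ws = "X @ Y @ [x]"
    have len: "length ?ws = ?N" using X Y by simp
    define B where "B = {i. i < ?N \<and> snd (?ws ! i) \<noteq> 0}"
    have BN: "B \<subseteq> {..<?N}" by (auto simp: B_def)
    then have "finite B" by (rule finite_subset) simp
    have fst0: "fst (?ws ! i) = 0" if "i \<in> B" for i
      using pure[of "?ws ! i"] that len unfolding B_def pure_vector_def
      by (metis (mono_tags, lifting) mem_Collect_eq nth_mem)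
    \<comment> \<open>Zero entries count for \<open>\<gg>\<close>, so \<open>B\<close> consists of
      the entries that genuinely involve \<open>V\<close>. The axioms of the pair settle at most one
      such entry, the bidegree settles two or more.\<close>
    consider "B = {}" | k where "B = {k}" | "2 \<le> card B"
      using \<open>finite B\<close> by (metis One_nat_def Suc_1 card_1_singletonE card_0_eq less_2_cases not_less)
    then show ?thesis
    proof cases
      case 1
      have "?ws = map emb (map fst ?ws)"
        by (rule nth_equalityI) (use 1 len in \<open>auto simp: B_def prod_eq_iff simp del: map_append\<close>)
      then have "X = map emb (map fst X)" "Y @ [x] = map emb (map fst (Y @ [x]))"
        by (simp_all add: append_eq_append_conv)
      moreover have "fi_defect (map emb (map fst X)) (map emb (map fst (Y @ [x]))) = 0"
        by (rule f0) (use X Y in simp_all)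
      ultimately show ?thesis unfolding rec_circ_\<pi>_\<pi>[OF X Y] by simp
    next
      case (2 k)
      have k: "k < ?N" "fst (?ws ! k) = 0" using 2 BN fst0 by auto
      have others: "snd (?ws ! i) = 0" if "i < ?N" "i \<noteq> k" for i using that 2 unfolding B_def by blast
      show ?thesis
      proof (cases "k < m")
        case True
        have Xk: "fst (X ! k) = 0" "\<And>i. \<lbrakk>i < m; i \<noteq> k\<rbrakk> \<Longrightarrow> snd (X ! i) = 0"
        proof -
          show "fst (X ! k) = 0" using k True X by (simp add: nth_append)
          show "snd (X ! i) = 0" if "i < m" "i \<noteq> k" for i
            using others[of i] that X by (simp add: nth_append)
        qed
        have Ye: "Y @ [x] = map emb (map fst (Y @ [x]))"
        proof (rule nth_equalityI)
          fix i assume i: "i < length (Y @ [x])"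
          then have "snd ((Y @ [x]) ! i) = 0" using others[of "m + i"] True X Y by (simp add: nth_append)
          then show "(Y @ [x]) ! i = map emb (map fst (Y @ [x])) ! i"
            using i by (simp only: nth_map length_map prod_eq_iff fst_conv snd_conv simp_thms)
        qed simp
        \<comment> \<open>\<open>f2\<close> is stated for the entry from \<open>V\<close> in the
          last position \<open>N\<close> of the block, where skewness of the block brings
          it.\<close>
        obtain N where N: "m = Suc N" using m by (cases m) auto
        have alt: "alternating (Suc N) (\<lambda>X. ?E (X # [Y]) x)"
          using alternating_head[OF ED(2,3)] unfolding N .
        show ?thesis
        proof (rule alternating_single_entry[OF alt, of X k])
          fix as :: "'g list" and u assume as: "length as = N"
          have "?E [map emb as @ [(0, u)], Y] x = fi_defect (map emb as @ [(0, u)]) (Y @ [x])"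
            by (rule rec_circ_\<pi>_\<pi>) (use as N Y in simp_all)
          also have "\<dots> = 0" by (subst Ye) (rule f2, use as N Y in simp_all)
          finally show "?E [map emb as @ [(0, u)], Y] x = 0" .
        qed (use X True Xk N in auto)
      next
        case False
        have Xe: "X = map emb (map fst X)"
        proof (rule nth_equalityI)
          fix i assume i: "i < length X"
          then have "snd (X ! i) = 0" using others[of i] False X by (simp add: nth_append)
          then show "X ! i = map emb (map fst X) ! i" using i by (simp add: prod_eq_iff)
        qed simp
        \<comment> \<open>The entry from \<open>V\<close> lies in the wedge of \<open>Y\<close> and
          \<open>x\<close>: with \<open>X\<close> fixed by contraction, skewness of that wedge moves
          it to the end, where \<open>f1\<close> applies.\<close>
        let ?G = "\<lambda>ws. contract X ?E [butlast ws] (last ws)"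
        have alt: "alternating (Suc m) ?G"
          by (intro alternating_last[of m s] multilin_contract last_alt_contract ED)
        have "?G (Y @ [x]) = 0"
        proof (rule alternating_single_entry[OF alt, of _ "k - m"])
          show "fst ((Y @ [x]) ! (k - m)) = 0" using k False X by (simp add: nth_append)
          show "snd ((Y @ [x]) ! i) = 0" if "i < Suc m" "i \<noteq> k - m" for i
          proof -
            have "?ws ! (m + i) = (Y @ [x]) ! i" using X by (simp add: nth_append)
            then show ?thesis using others[of "m + i"] that False by simp
          qed
          fix as :: "'g list" and u assume as: "length as = m"
          have "?E [X, map emb as] (0, u) = fi_defect X (map emb as @ [(0, u)])"
            by (rule rec_circ_\<pi>_\<pi>) (use as X in simp_all)
          also have "\<dots> = 0" by (subst Xe) (rule f1, use as X in simp_all)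
          finally show "?G (map emb as @ [(0, u)]) = 0" by (simp add: contract_apply)
        qed (use Y k False in auto)
        then show ?thesis by (simp add: contract_apply)
      qed
    next
      case 3
      have card: "card ({..<?N} - B) + card B = ?N"
        using card_Diff_subset[OF \<open>finite B\<close> BN] card_mono[OF finite_lessThan BN] by simp
      have cc: "concat [X, Y] @ [x] = ?ws" by simp
      have pe: "pure_entries (card ({..<?N} - B)) (card B) [X, Y] x"
        unfolding pure_entries_def Let_def cc card
      proof (intro conjI exI[of _ "{..<?N} - B"] allI impI len refl)
        fix i assume "i < ?N"
        then show "if i \<in> {..<?N} - B then snd (?ws ! i) = 0 else fst (?ws ! i) = 0"
          using fst0 unfolding B_def by auto
      qed blast
      have "[X, Y] \<in> wedge_args (Suc m) 2" using X Y by (simp add: wedge_args_def)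
      then have "\<forall>x i j. pure_entries i j [X, Y] x \<longrightarrow>
          (if (i, j) = (2 * m + 1, 0) then snd (?E [X, Y] x) = 0
           else if (i, j) = (2 * m, 0 + 1) then fst (?E [X, Y] x) = 0
           else ?E [X, Y] x = 0)"
        using EC unfolding bideg_cochains_def mem_Collect_eq by (elim conjE) (rule bspec)
      from this[THEN spec, THEN spec, THEN spec, THEN mp, OF pe]
      show ?thesis using 3 by (simp split: if_splits)
    qed
  qed
  have flat0: "flat m 2 ?E ws = 0" if "length ws = ?N" for ws
  proof (rule additive_eq_on_pure[OF _ _ _ that])
    fix ws :: "('g \<times> 'v) list" and i x y assume "length ws = ?N" "i < ?N"
    then show "flat m 2 ?E (ws[i := x + y]) = flat m 2 ?E (ws[i := x]) + flat m 2 ?E (ws[i := y])"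
      by (rule linear_additive(1)[OF linear_flat[OF ED(2)]])
  next
    fix ws :: "('g \<times> 'v) list"
    assume len: "length ws = ?N" and pure: "\<And>w. w \<in> set ws \<Longrightarrow> pure_vector w"
    obtain X Y where XY: "chunks m 2 ws = [X, Y]" "length X = m" "length Y = m"
      using len by (simp add: numeral_2_eq_2)
    have "concat [X, Y] @ [last ws] = ws" using concat_chunks[OF len] XY by simp
    then have "ws = X @ Y @ [last ws]" by simp
    then show "flat m 2 ?E ws = 0"
      unfolding flat_def XY(1) using pure by (intro zero XY) simp
  qed simp
  show "?E = 0"
  proof (intro ext)
    fix Xs :: "('g \<times> 'v) list list" and x
    show "?E Xs x = 0 Xs x"
    proof (cases "Xs \<in> wedge_args (Suc m) 2")
      case True
      have "flat m 2 ?E (concat Xs @ [x]) = 0"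
        by (rule flat0) (use length_concat_wedge_args[OF True] in simp)
      then show ?thesis unfolding flat_concat[OF True] cochain_apply .
    next
      case False
      have "?E Xs x = 0"
      proof (cases "length Xs = 2")
        case len: True
        with False obtain X where X: "X \<in> set Xs" "length X \<noteq> m" by (auto simp: wedge_args_def)
        show ?thesis by (rule block_altD[OF ED(3) X(1)]) (use X in simp)
      qed (rule homogD[OF ED(1)])
      then show ?thesis unfolding cochain_apply .
    qed
  qed
qed

end

section \<open>Deformations of a pair and Maurer-Cartan elements\<close>

lemma wedge_hom_add:
  assumes "f \<in> wedge_hom sA sB N" "h \<in> wedge_hom sA sB N"
  shows "f + h \<in> wedge_hom sA sB N"
proof -
  have "Vector_Spaces.linear sA sB (\<lambda>y. (f + h) (xs[i := y]))" if "length xs = N" "i < N" for xs i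
  proof -
    interpret F: Vector_Spaces.linear sA sB "\<lambda>y. f (xs[i := y])"
      using assms(1) that by (simp add: wedge_hom_def)
    interpret H: Vector_Spaces.linear sA sB "\<lambda>y. h (xs[i := y])"
      using assms(2) that by (simp add: wedge_hom_def)
    interpret vector_space_pair sA sB by unfold_locales
    show ?thesis
      unfolding plus_fun_apply by (rule linear_compose_add[OF F.linear_axioms H.linear_axioms])
  qed
  then show ?thesis using assms by (simp add: wedge_hom_def plus_fun_apply)
qed

lemma action_hom_add:
  assumes "f \<in> action_hom sA sB N" "h \<in> action_hom sA sB N"
  shows "f + h \<in> action_hom sA sB N"
  unfolding action_hom_def mem_Collect_eq
proof (intro conjI allI impI)
  fix xs :: "'a list" assume len: "length xs = N"
  interpret F: Vector_Spaces.linear sB sB "f xs"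
    using assms(1) len by (simp add: action_hom_def)
  interpret H: Vector_Spaces.linear sB sB "h xs"
    using assms(2) len by (simp add: action_hom_def)
  interpret vector_space_pair sB sB by unfold_locales
  have "(f + h) xs = (\<lambda>u. f xs u + h xs u)" by (intro ext) (simp add: plus_fun_apply)
  then show "Vector_Spaces.linear sB sB ((f + h) xs)"
    using linear_compose_add[OF F.linear_axioms H.linear_axioms] by simp
next
  fix u
  have "(\<lambda>xs. (f + h) xs u) = (\<lambda>xs. f xs u) + (\<lambda>xs. h xs u)" by (intro ext) (simp add: plus_fun_apply)
  then show "(\<lambda>xs. (f + h) xs u) \<in> wedge_hom sA sB N"
    using assms by (simp add: action_hom_def wedge_hom_add)
qed

lemma (in vector_space) sum_cochain_add:
  "sum_cochain n scale (\<mu> + \<mu>') (\<rho> + \<rho>') = sum_cochain n scale \<mu> \<rho> + sum_cochain n scale \<mu>' \<rho>'"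
  by (intro ext) (simp add: sum_cochain_def Let_def plus_fun_apply zero_prod_def scale_right_distrib sum.distrib)

text \<open>For two elements of odd degree the graded commutator is a sum, so
  \<open>[\<pi>, \<pi>]\<close> is twice \<open>\<pi> \<circ> \<pi>\<close>, and 2 is
  invertible.\<close>

lemma (in lie_rep_data) n_lie_rep_pair_iff_bracket:
  "n_lie_rep_pair (Suc m) sg sv \<mu> \<rho> \<longleftrightarrow> br \<pi> \<pi> = 0"
proof -
  have "br \<pi> \<pi> = rec_circ m 1 \<pi> \<pi> + rec_circ m 1 \<pi> \<pi>"
    unfolding bracket_C(1)[OF \<pi>_in_C \<pi>_in_C] rec_bracket_def by (simp add: sgnp_simps)
  also have "\<dots> = S 2 (rec_circ m 1 \<pi> \<pi>)"
    using c.scale_left_distrib[of 1 1 "rec_circ m 1 \<pi> \<pi>"] by simp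
  finally show ?thesis unfolding n_lie_rep_pair_iff by simp
qed

text \<open>The bracket is symmetric in degree 1. Since \<open>[\<pi>, \<pi>] = 0\<close>, the
  bracket of \<open>\<pi> + \<alpha>\<close> with itself is twice the left-hand side of the
  Maurer-Cartan equation.\<close>

lemma (in lie_rep_spaces) maurer_cartan_iff:
  assumes \<pi>: "\<pi> \<in> C 1" "br \<pi> \<pi> = 0" and \<alpha>: "\<alpha> \<in> C 1"
  shows "maurer_cartan S C br (br \<pi>) \<alpha> \<longleftrightarrow> br (\<pi> + \<alpha>) (\<pi> + \<alpha>) = 0"
proof -
  note ml = CD(2)[OF \<pi>(1)] CD(2)[OF \<alpha>] p.multilin_add[OF CD(2)[OF \<pi>(1)] CD(2)[OF \<alpha>]]
  have "br \<alpha> \<pi> = br \<pi> \<alpha>"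
    unfolding bracket_C(1)[OF \<pi>(1) \<alpha>] bracket_C(1)[OF \<alpha> \<pi>(1)] rec_bracket_def
    by (simp add: sgnp_simps add.commute)
  then have "br (\<pi> + \<alpha>) (\<pi> + \<alpha>) = br \<pi> \<alpha> + br \<pi> \<alpha> + br \<alpha> \<alpha>"
    unfolding p.nlie_bracket_add_left[OF ml(3)] p.nlie_bracket_add_right[OF ml(1)]
      p.nlie_bracket_add_right[OF ml(2)] \<pi>(2) by (simp add: add.assoc)
  also have "\<dots> = S 2 (br \<pi> \<alpha> + S (1 / 2) (br \<alpha> \<alpha>))"
    using c.scale_left_distrib[of 1 1 "br \<pi> \<alpha>"] by (simp add: c.scale_right_distrib)
  finally show ?thesis using \<alpha> by (simp add: maurer_cartan_def)
qed

theorem proposition2p8: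
  fixes n :: nat
    and sg :: "'k::{alg_closed_field, field_char_0} \<Rightarrow> 'g::ab_group_add \<Rightarrow> 'g"
    and sv :: "'k \<Rightarrow> 'v::ab_group_add \<Rightarrow> 'v"
    and Bg :: "'g set" and Bv :: "'v set"
    and \<mu> :: "'g list \<Rightarrow> 'g" and \<rho> :: "'g list \<Rightarrow> 'v \<Rightarrow> 'v"
  defines "S \<equiv> cochain_scale (module_prod.scale sg sv)"
    and "C \<equiv> (\<lambda>k. bideg_cochains n sg sv k (k * (n - 1)) 0)"
    and "br \<equiv> nlie_bracket n (module_prod.scale sg sv)"
    and "d \<equiv> nlie_bracket n (module_prod.scale sg sv) (sum_cochain n sv \<mu> \<rho>)"
  assumes "n \<ge> 2"
    and "finite_dimensional_vector_space sg Bg"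
    and "finite_dimensional_vector_space sv Bv"
    and "n_lie_rep_pair n sg sv \<mu> \<rho>"
  shows "dg_lie_algebra S C br d \<and>
    (\<forall>\<mu>' \<in> wedge_hom sg sg n. \<forall>\<rho>' \<in> action_hom sg sv (n - 1).
       n_lie_rep_pair n sg sv (\<mu> + \<mu>') (\<rho> + \<rho>') \<longleftrightarrow>
       maurer_cartan S C br d (sum_cochain n sv \<mu>' \<rho>'))"
proof -
  obtain m where n: "n = Suc m" and m: "0 < m" using \<open>n \<ge> 2\<close> by (cases n) auto
  interpret g: finite_dimensional_vector_space sg Bg by fact
  interpret v: finite_dimensional_vector_space sv Bv by fact
  interpret lie_rep_spaces sg sv m by unfold_locales
  have data: "lie_rep_data sg sv m \<mu>' \<rho>'"
    if "\<mu>' \<in> wedge_hom sg sg n" "\<rho>' \<in> action_hom sg sv (n - 1)" for \<mu>' \<rho>'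
    by unfold_locales (use that m n in simp_all)
  have \<mu>\<rho>: "\<mu> \<in> wedge_hom sg sg n" "\<rho> \<in> action_hom sg sv (n - 1)"
    using \<open>n_lie_rep_pair n sg sv \<mu> \<rho>\<close>
    by (simp_all add: n_lie_rep_pair_def n_lie_algebra_def n_lie_representation_def)
  let ?\<pi> = "sum_cochain (Suc m) sv \<mu> \<rho>"
  interpret P: lie_rep_data sg sv m \<mu> \<rho> by (rule data[OF \<mu>\<rho>])
  have \<pi>: "nlie_bracket (Suc m) s ?\<pi> ?\<pi> = 0"
    using P.n_lie_rep_pair_iff_bracket assms(8) n by simp
  have "n_lie_rep_pair n sg sv (\<mu> + \<mu>') (\<rho> + \<rho>') \<longleftrightarrow>
      maurer_cartan S C br d (sum_cochain n sv \<mu>' \<rho>')"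
    if "\<mu>' \<in> wedge_hom sg sg n" "\<rho>' \<in> action_hom sg sv (n - 1)" for \<mu>' \<rho>'
  proof -
    interpret P': lie_rep_data sg sv m \<mu>' \<rho>' by (rule data[OF that])
    interpret Q: lie_rep_data sg sv m "\<mu> + \<mu>'" "\<rho> + \<rho>'"
      by (intro data wedge_hom_add action_hom_add \<mu>\<rho> that)
    \<comment> \<open>The element of degree 1 depends additively on the pair, so the deformed pair
      corresponds to the sum to which \<open>maurer_cartan_iff\<close> applies.\<close>
    show ?thesis
      using Q.n_lie_rep_pair_iff_bracket maurer_cartan_iff[OF P.\<pi>_in_C \<pi> P'.\<pi>_in_C]
      unfolding v.sum_cochain_add S_def C_def br_def d_def n by simp
  qed
  moreover have "dg_lie_algebra S C br d"
    using dg_lie_algebra_C[OF P.\<pi>_in_C \<pi>] unfolding S_def C_def br_def d_def n by simp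
  ultimately show ?thesis by blast
qed

end
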